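(* Let $\mathcal{T}$ be a triangulated category, $\mathcal{S}$ a thick subcategory of $\mathcal{T}$, and $\mathcal{U}=\mathcal{T}/\mathcal{S}$ the Verdier quotient. Assume that $\mathcal{S}=\mathcal{X}\perp\mathcal{Y}$ is a stable t-structure, and that $\mathcal{T}$ has torsion pairs $\mathcal{T}=\mathcal{X}\perp\mathcal{X}^\perp={}^\perp\mathcal{Y}\perp\mathcal{Y}$. Put $\mathcal{Z}:=\mathcal{X}^\perp\cap{}^\perp(\mathcal{Y}[1])$. Then we have a weak semi-orthogonal decomposition $\mathcal{T}=\mathcal{X}\perp\mathcal{Z}\perp\mathcal{Y}$. In particular, the composition $\mathcal{Z}\subset\mathcal{T}\to\mathcal{U}$ is a triangle equivalence.
   Context: For full subcategories $\mathcal{X},\mathcal{Y}$ of a triangulated category $\mathcal{T}$ with shift $[1]$, $\mathcal{X}*\mathcal{Y}$ is the full subcategory of objects $T\in\mathcal{T}$ for which there is a triangle $X\to T\to Y\to X[1]$ with $X\in\mathcal{X}$, $Y\in\mathcal{Y}$. When $\mathrm{Hom}_{\mathcal{T}}(\mathcal{X},\mathcal{Y})=0$, one writes $\mathcal{X}\perp\mathcal{Y}$ for $\mathcal{X}*\mathcal{Y}$; $\mathcal{X}_1\perp\cdots\perp\mathcal{X}_n$ is defined inductively. Put $\mathcal{X}^\perp:=\{T\in\mathcal{T}\mid\mathrm{Hom}_{\mathcal{T}}(\mathcal{X},T)=0\}$ and ${}^\perp\mathcal{X}:=\{T\in\mathcal{T}\mid\mathrm{Hom}_{\mathcal{T}}(T,\mathcal{X})=0\}$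 (these perpendicular categories, in the claim, are formed in $\mathcal{T}$). A torsion pair $\mathcal{T}=\mathcal{X}\perp\mathcal{Y}$ of a triangulated category $\mathcal{T}$ means that $\mathcal{T}=\mathcal{X}\perp\mathcal{Y}$, $\mathcal{X}={}^\perp\mathcal{Y}$ and $\mathcal{Y}=\mathcal{X}^\perp$ hold, with perpendiculars formed in the category being decomposed (so for $\mathcal{S}=\mathcal{X}\perp\mathcal{Y}$ they are formed in $\mathcal{S}$). A stable t-structure is a torsion pair with $\mathcal{X}[1]=\mathcal{X}$. A weak semi-orthogonal decomposition of $\mathcal{T}$ is an equality $\mathcal{T}=\mathcal{X}_1\perp\cdots\perp\mathcal{X}_n$ with $\mathcal{X}_1,\ldots,\mathcal{X}_n$ thick subcategories of $\mathcal{T}$. *)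

theory Defs
  imports "HOL-Algebra.Group"
begin

section \<open>Categories, functors and equivalences\<close>

record ('o, 'm) cat =
  Obj :: "'o set"
  Arr :: "'m set"
  Dom :: "'m \<Rightarrow> 'o"
  Cod :: "'m \<Rightarrow> 'o"
  Ide :: "'o \<Rightarrow> 'm"
  Cmp :: "'m \<Rightarrow> 'm \<Rightarrow> 'm"  (infixl \<open>\<cdot>\<index>\<close> 70)

definition Hom :: "('o, 'm, 'z) cat_scheme \<Rightarrow> 'o \<Rightarrow> 'o \<Rightarrow> 'm set" where
  "Hom C a b = {f \<in> Arr C. Dom C f = a \<and> Cod C f = b}"

locale category =
  fixes C :: "('o, 'm, 'z) cat_scheme" (structure)
  assumes Dom_Obj: "f \<in> Arr C \<Longrightarrow> Dom C f \<in> Obj C"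
    and Cod_Obj: "f \<in> Arr C \<Longrightarrow> Cod C f \<in> Obj C"
    and Ide_Hom: "a \<in> Obj C \<Longrightarrow> Ide C a \<in> Hom C a a"
    and Cmp_Hom: "\<lbrakk>f \<in> Hom C a b; g \<in> Hom C b c\<rbrakk> \<Longrightarrow> g \<cdot> f \<in> Hom C a c"
    and Cmp_Ide_right: "f \<in> Hom C a b \<Longrightarrow> f \<cdot> Ide C a = f"
    and Cmp_Ide_left: "f \<in> Hom C a b \<Longrightarrow> Ide C b \<cdot> f = f"
    and Cmp_assoc: "\<lbrakk>f \<in> Hom C a b; g \<in> Hom C b c; h \<in> Hom C c d\<rbrakk>
      \<Longrightarrow> (h \<cdot> g) \<cdot> f = h \<cdot> (g \<cdot> f)"

definition iso_arr :: "('o, 'm, 'z) cat_scheme \<Rightarrow> 'm \<Rightarrow> bool" where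
  "iso_arr C f \<longleftrightarrow> f \<in> Arr C \<and>
     (\<exists>g \<in> Hom C (Cod C f) (Dom C f).
        g \<cdot>\<^bsub>C\<^esub> f = Ide C (Dom C f) \<and> f \<cdot>\<^bsub>C\<^esub> g = Ide C (Cod C f))"

definition isomorphic :: "('o, 'm, 'z) cat_scheme \<Rightarrow> 'o \<Rightarrow> 'o \<Rightarrow> bool" where
  "isomorphic C a b \<longleftrightarrow> (\<exists>f \<in> Hom C a b. iso_arr C f)"

locale cat_functor = C: category C + D: category D
  for C :: "('o, 'm, 'z) cat_scheme" and D :: "('p, 'n, 'w) cat_scheme" +
  fixes F0 :: "'o \<Rightarrow> 'p" and F1 :: "'m \<Rightarrow> 'n"
  assumes F0_Obj: "a \<in> Obj C \<Longrightarrow> F0 a \<in> Obj D"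
    and F1_Hom: "f \<in> Hom C a b \<Longrightarrow> F1 f \<in> Hom D (F0 a) (F0 b)"
    and F1_Ide: "a \<in> Obj C \<Longrightarrow> F1 (Ide C a) = Ide D (F0 a)"
    and F1_Cmp: "\<lbrakk>f \<in> Hom C a b; g \<in> Hom C b c\<rbrakk>
      \<Longrightarrow> F1 (g \<cdot>\<^bsub>C\<^esub> f) = F1 g \<cdot>\<^bsub>D\<^esub> F1 f"

definition natural_iso ::
  "('o, 'm, 'z) cat_scheme \<Rightarrow> ('p, 'n, 'w) cat_scheme \<Rightarrow> ('o \<Rightarrow> 'p) \<Rightarrow> ('m \<Rightarrow> 'n) \<Rightarrow>
   ('o \<Rightarrow> 'p) \<Rightarrow> ('m \<Rightarrow> 'n) \<Rightarrow> ('o \<Rightarrow> 'n) \<Rightarrow> bool" where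
  "natural_iso C D F0 F1 G0 G1 \<eta> \<longleftrightarrow>
     (\<forall>a \<in> Obj C. \<eta> a \<in> Hom D (F0 a) (G0 a) \<and> iso_arr D (\<eta> a)) \<and>
     (\<forall>f \<in> Arr C. G1 f \<cdot>\<^bsub>D\<^esub> \<eta> (Dom C f) = \<eta> (Cod C f) \<cdot>\<^bsub>D\<^esub> F1 f)"

locale equivalence_functor = cat_functor C D F0 F1
  for C :: "('o, 'm, 'z) cat_scheme" and D :: "('p, 'n, 'w) cat_scheme"
    and F0 :: "'o \<Rightarrow> 'p" and F1 :: "'m \<Rightarrow> 'n" +
  assumes quasi_inverse: "\<exists>G0 G1 \<eta> \<epsilon>. cat_functor D C G0 G1 \<and>
    natural_iso C C (\<lambda>a. a) (\<lambda>f. f) (G0 \<circ> F0) (G1 \<circ> F1) \<eta> \<and>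
    natural_iso D D (F0 \<circ> G0) (F1 \<circ> G1) (\<lambda>a. a) (\<lambda>f. f) \<epsilon>"


section \<open>Additive categories\<close>

record ('o, 'm) add_cat = "('o, 'm) cat" +
  Add :: "'m \<Rightarrow> 'm \<Rightarrow> 'm"
  Zer :: "'o \<Rightarrow> 'o \<Rightarrow> 'm"

definition hom_group :: "('o, 'm, 'z) add_cat_scheme \<Rightarrow> 'o \<Rightarrow> 'o \<Rightarrow> 'm monoid" where
  "hom_group C a b = \<lparr>carrier = Hom C a b, mult = Add C, one = Zer C a b\<rparr>"

definition Neg :: "('o, 'm, 'z) add_cat_scheme \<Rightarrow> 'm \<Rightarrow> 'm" where
  "Neg C f = inv\<^bsub>hom_group C (Dom C f) (Cod C f)\<^esub> f"

definition zero_object :: "('o, 'm, 'z) cat_scheme \<Rightarrow> 'o \<Rightarrow> bool" where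
  "zero_object C z \<longleftrightarrow> z \<in> Obj C \<and>
     (\<forall>a \<in> Obj C. (\<exists>!f. f \<in> Hom C a z) \<and> (\<exists>!f. f \<in> Hom C z a))"

definition biproduct ::
  "('o, 'm, 'z) add_cat_scheme \<Rightarrow> 'o \<Rightarrow> 'o \<Rightarrow> 'o \<Rightarrow> 'm \<Rightarrow> 'm \<Rightarrow> 'm \<Rightarrow> 'm \<Rightarrow> bool" where
  "biproduct C a b p i j q r \<longleftrightarrow>
     i \<in> Hom C a p \<and> j \<in> Hom C b p \<and> q \<in> Hom C p a \<and> r \<in> Hom C p b \<and>
     q \<cdot>\<^bsub>C\<^esub> i = Ide C a \<and> r \<cdot>\<^bsub>C\<^esub> j = Ide C b \<and>
     r \<cdot>\<^bsub>C\<^esub> i = Zer C a b \<and> q \<cdot>\<^bsub>C\<^esub> j = Zer C b a \<and>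
     Add C (i \<cdot>\<^bsub>C\<^esub> q) (j \<cdot>\<^bsub>C\<^esub> r) = Ide C p"

locale additive_category = category C
  for C :: "('o, 'm, 'z) add_cat_scheme" (structure) +
  assumes Hom_comm_group: "\<lbrakk>a \<in> Obj C; b \<in> Obj C\<rbrakk> \<Longrightarrow> comm_group (hom_group C a b)"
    and Cmp_Add_right: "\<lbrakk>f \<in> Hom C a b; f' \<in> Hom C a b; g \<in> Hom C b c\<rbrakk>
      \<Longrightarrow> g \<cdot> Add C f f' = Add C (g \<cdot> f) (g \<cdot> f')"
    and Cmp_Add_left: "\<lbrakk>f \<in> Hom C a b; g \<in> Hom C b c; g' \<in> Hom C b c\<rbrakk>
      \<Longrightarrow> Add C g g' \<cdot> f = Add C (g \<cdot> f) (g' \<cdot> f)"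
    and zero_object_exists: "\<exists>z. zero_object C z"
    and biproduct_exists: "\<lbrakk>a \<in> Obj C; b \<in> Obj C\<rbrakk>
      \<Longrightarrow> \<exists>p \<in> Obj C. \<exists>i j q r. biproduct C a b p i j q r"

locale additive_functor = cat_functor C D F0 F1 + C: additive_category C + D: additive_category D
  for C :: "('o, 'm, 'z) add_cat_scheme" and D :: "('p, 'n, 'w) add_cat_scheme"
    and F0 :: "'o \<Rightarrow> 'p" and F1 :: "'m \<Rightarrow> 'n" +
  assumes F1_Add: "\<lbrakk>f \<in> Hom C a b; g \<in> Hom C a b\<rbrakk>
    \<Longrightarrow> F1 (Add C f g) = Add D (F1 f) (F1 g)"


section \<open>Triangulated categories\<close>

text \<open>\<open>ShO\<close> and \<open>ShA\<close> are the shift on objects and on arrows. A triangle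
  \<open>a \<rightarrow> b \<rightarrow> c \<rightarrow> a[1]\<close> is represented by the triple of its arrows; \<open>Tri\<close> is the class of
  distinguished triangles. The shift is only required to be an autoequivalence.\<close>

record ('o, 'm) tri_cat = "('o, 'm) add_cat" +
  ShO :: "'o \<Rightarrow> 'o"
  ShA :: "'m \<Rightarrow> 'm"
  Tri :: "('m \<times> 'm \<times> 'm) set"

definition is_triangle ::
  "('o, 'm, 'z) tri_cat_scheme \<Rightarrow> 'm \<Rightarrow> 'm \<Rightarrow> 'm \<Rightarrow> 'o \<Rightarrow> 'o \<Rightarrow> 'o \<Rightarrow> bool" where
  "is_triangle C f g h a b c \<longleftrightarrow>
     f \<in> Hom C a b \<and> g \<in> Hom C b c \<and> h \<in> Hom C c (ShO C a)"

definition triangle_iso ::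
  "('o, 'm, 'z) tri_cat_scheme \<Rightarrow> 'm \<times> 'm \<times> 'm \<Rightarrow> 'm \<times> 'm \<times> 'm \<Rightarrow> bool" where
  "triangle_iso C t t' \<longleftrightarrow> (case (t, t') of ((f, g, h), (f', g', h')) \<Rightarrow>
     \<exists>a b c a' b' c' u v w.
       is_triangle C f g h a b c \<and> is_triangle C f' g' h' a' b' c' \<and>
       u \<in> Hom C a a' \<and> v \<in> Hom C b b' \<and> w \<in> Hom C c c' \<and>
       iso_arr C u \<and> iso_arr C v \<and> iso_arr C w \<and>
       v \<cdot>\<^bsub>C\<^esub> f = f' \<cdot>\<^bsub>C\<^esub> u \<and> w \<cdot>\<^bsub>C\<^esub> g = g' \<cdot>\<^bsub>C\<^esub> v \<and>
       ShA C u \<cdot>\<^bsub>C\<^esub> h = h' \<cdot>\<^bsub>C\<^esub> w)"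

locale triangulated_category =
  additive_category C +
  shift_equiv: equivalence_functor C C "ShO C" "ShA C" +
  shift_add: additive_functor C C "ShO C" "ShA C"
  for C :: "('o, 'm, 'z) tri_cat_scheme" (structure) +
  assumes Tri_is_triangle:
      "(f, g, h) \<in> Tri C \<Longrightarrow> \<exists>a b c. is_triangle C f g h a b c"
    and TR1_iso:
      "\<lbrakk>t \<in> Tri C; triangle_iso C t t'\<rbrakk> \<Longrightarrow> t' \<in> Tri C"
    and TR1_Ide:
      "\<lbrakk>a \<in> Obj C; zero_object C z\<rbrakk>
        \<Longrightarrow> (Ide C a, Zer C a z, Zer C z (ShO C a)) \<in> Tri C"
    and TR1_cone:
      "f \<in> Arr C \<Longrightarrow> \<exists>g h. (f, g, h) \<in> Tri C"
    and TR2: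
      "is_triangle C f g h a b c
        \<Longrightarrow> (f, g, h) \<in> Tri C \<longleftrightarrow> (g, h, Neg C (ShA C f)) \<in> Tri C"
    and TR3:
      "\<lbrakk>(f, g, h) \<in> Tri C; is_triangle C f g h a b c;
        (f', g', h') \<in> Tri C; is_triangle C f' g' h' a' b' c';
        u \<in> Hom C a a'; v \<in> Hom C b b'; v \<cdot> f = f' \<cdot> u\<rbrakk>
        \<Longrightarrow> \<exists>w \<in> Hom C c c'. w \<cdot> g = g' \<cdot> v \<and> ShA C u \<cdot> h = h' \<cdot> w"
    and TR4:
      "\<lbrakk>(f, f1, f2) \<in> Tri C; is_triangle C f f1 f2 x y z';
        (g, g1, g2) \<in> Tri C; is_triangle C g g1 g2 y z x';
        (g \<cdot> f, h1, h2) \<in> Tri C; is_triangle C (g \<cdot> f) h1 h2 x z y'\<rbrakk>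
        \<Longrightarrow> \<exists>u \<in> Hom C z' y'. \<exists>v \<in> Hom C y' x'.
              (u, v, ShA C f1 \<cdot> g2) \<in> Tri C \<and>
              u \<cdot> f1 = h1 \<cdot> g \<and> h2 \<cdot> u = f2 \<and>
              v \<cdot> h1 = g1 \<and> g2 \<cdot> v = ShA C f \<cdot> h2"

text \<open>Full subcategories are given by their sets of objects. The distinguished triangles of a full
  subcategory are those of \<open>C\<close> with all vertices in it; this is only meaningful as a triangulated
  structure if the subcategory is closed under the shift.\<close>

definition full_sub :: "('o, 'm, 'z) tri_cat_scheme \<Rightarrow> 'o set \<Rightarrow> ('o, 'm, 'z) tri_cat_scheme" where
  "full_sub C X = C\<lparr>
     Obj := X,
     Arr := {f \<in> Arr C. Dom C f \<in> X \<and> Cod C f \<in> X},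
     Tri := {(f, g, h). (f, g, h) \<in> Tri C \<and>
        (\<exists>a\<in>X. \<exists>b\<in>X. \<exists>c\<in>X. is_triangle C f g h a b c)}\<rparr>"

text \<open>Closure under isomorphism is the case \<open>b = 0\<close> of closure under direct summands.\<close>

definition thick :: "('o, 'm, 'z) tri_cat_scheme \<Rightarrow> 'o set \<Rightarrow> bool" where
  "thick C S \<longleftrightarrow> S \<subseteq> Obj C \<and> S \<noteq> {} \<and>
     (\<forall>a \<in> Obj C. ShO C a \<in> S \<longleftrightarrow> a \<in> S) \<and>
     (\<forall>f g h a b c. (f, g, h) \<in> Tri C \<longrightarrow> is_triangle C f g h a b c \<longrightarrow>
        a \<in> S \<longrightarrow> b \<in> S \<longrightarrow> c \<in> S) \<and>
     (\<forall>p \<in> S. \<forall>a \<in> Obj C. \<forall>b \<in> Obj C. \<forall>i j q r.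
        biproduct C a b p i j q r \<longrightarrow> a \<in> S)"

text \<open>A triangle functor is an additive functor \<open>F\<close> together with a natural isomorphism
  \<open>\<theta> : F \<circ> [1] \<rightarrow> [1] \<circ> F\<close> through which it preserves distinguished triangles.\<close>

locale triangle_functor =
  C: triangulated_category C + D: triangulated_category D + additive_functor C D F0 F1
  for C :: "('o, 'm, 'z) tri_cat_scheme" and D :: "('p, 'n, 'w) tri_cat_scheme"
    and F0 :: "'o \<Rightarrow> 'p" and F1 :: "'m \<Rightarrow> 'n" +
  fixes \<theta> :: "'o \<Rightarrow> 'n"
  assumes shift_natural_iso:
      "natural_iso C D (F0 \<circ> ShO C) (F1 \<circ> ShA C) (ShO D \<circ> F0) (ShA D \<circ> F1) \<theta>"
    and F1_Tri: "\<lbrakk>(f, g, h) \<in> Tri C; is_triangle C f g h a b c\<rbrakk>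
      \<Longrightarrow> (F1 f, F1 g, \<theta> a \<cdot>\<^bsub>D\<^esub> F1 h) \<in> Tri D"

locale triangle_equivalence = triangle_functor C D F0 F1 \<theta> + equivalence_functor C D F0 F1
  for C :: "('o, 'm, 'z) tri_cat_scheme" and D :: "('p, 'n, 'w) tri_cat_scheme"
    and F0 :: "'o \<Rightarrow> 'p" and F1 :: "'m \<Rightarrow> 'n" and \<theta> :: "'o \<Rightarrow> 'n"


section \<open>Torsion pairs and semi-orthogonal decompositions\<close>

definition hom_vanish :: "('o, 'm, 'z) add_cat_scheme \<Rightarrow> 'o set \<Rightarrow> 'o set \<Rightarrow> bool" where
  "hom_vanish C X Y \<longleftrightarrow> (\<forall>x \<in> X. \<forall>y \<in> Y. Hom C x y = {Zer C x y})"

definition right_perp :: "('o, 'm, 'z) add_cat_scheme \<Rightarrow> 'o set \<Rightarrow> 'o set" where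
  "right_perp C X = {t \<in> Obj C. hom_vanish C X {t}}"

definition left_perp :: "('o, 'm, 'z) add_cat_scheme \<Rightarrow> 'o set \<Rightarrow> 'o set" where
  "left_perp C X = {t \<in> Obj C. hom_vanish C {t} X}"

definition star :: "('o, 'm, 'z) tri_cat_scheme \<Rightarrow> 'o set \<Rightarrow> 'o set \<Rightarrow> 'o set" where
  "star C X Y = {t \<in> Obj C. \<exists>x \<in> X. \<exists>y \<in> Y. \<exists>f g h.
     (f, g, h) \<in> Tri C \<and> is_triangle C f g h x t y}"

text \<open>\<open>is_perp C [X\<^sub>1, \<dots>, X\<^sub>n] W\<close>: the expression \<open>X\<^sub>1 \<bottom> \<dots> \<bottom> X\<^sub>n\<close> is defined, i.e.\ the required
  Hom-spaces vanish, and \<open>W\<close> is its value.\<close>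

inductive is_perp :: "('o, 'm, 'z) tri_cat_scheme \<Rightarrow> 'o set list \<Rightarrow> 'o set \<Rightarrow> bool"
  for C where
  single: "X \<subseteq> Obj C \<Longrightarrow> is_perp C [X] X"
| snoc: "\<lbrakk>is_perp C Xs W; Y \<subseteq> Obj C; hom_vanish C W Y\<rbrakk> \<Longrightarrow> is_perp C (Xs @ [Y]) (star C W Y)"

definition torsion_pair :: "('o, 'm, 'z) tri_cat_scheme \<Rightarrow> 'o set \<Rightarrow> 'o set \<Rightarrow> bool" where
  "torsion_pair C X Y \<longleftrightarrow>
     is_perp C [X, Y] (Obj C) \<and> X = left_perp C Y \<and> Y = right_perp C X"

text \<open>\<open>X[1]\<close>, closed under isomorphism since the shift need not be bijective on objects.\<close>

definition shift_sub :: "('o, 'm, 'z) tri_cat_scheme \<Rightarrow> 'o set \<Rightarrow> 'o set" where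
  "shift_sub C X = {t \<in> Obj C. \<exists>x \<in> X. isomorphic C t (ShO C x)}"

definition stable_t_structure :: "('o, 'm, 'z) tri_cat_scheme \<Rightarrow> 'o set \<Rightarrow> 'o set \<Rightarrow> bool" where
  "stable_t_structure C X Y \<longleftrightarrow> torsion_pair C X Y \<and> shift_sub C X = X"

definition weak_semiorthogonal_decomposition ::
  "('o, 'm, 'z) tri_cat_scheme \<Rightarrow> 'o set list \<Rightarrow> bool" where
  "weak_semiorthogonal_decomposition C Xs \<longleftrightarrow>
     is_perp C Xs (Obj C) \<and> (\<forall>X \<in> set Xs. thick C X)"


section \<open>The Verdier quotient\<close>

text \<open>The quotient \<open>C/S\<close> has the objects of \<open>C\<close>. Its arrows are triples \<open>(a, b, R)\<close> where \<open>R\<close> is an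
  equivalence class of roofs \<open>a \<leftarrow> \<bullet> \<rightarrow> b\<close>; a roof is represented as \<open>(s, f)\<close>, where the
  leftward arrow \<open>s\<close> has its cone in \<open>S\<close>. The operations on classes are given by collecting the
  results for all choices of representatives.\<close>

definition cone_in :: "('o, 'm, 'z) tri_cat_scheme \<Rightarrow> 'o set \<Rightarrow> 'm set" where
  "cone_in C S = {s. \<exists>g h a b. \<exists>c \<in> S. (s, g, h) \<in> Tri C \<and> is_triangle C s g h a b c}"

definition roofs :: "('o, 'm, 'z) tri_cat_scheme \<Rightarrow> 'o set \<Rightarrow> 'o \<Rightarrow> 'o \<Rightarrow> ('m \<times> 'm) set" where
  "roofs C S a b = {(s, f). s \<in> cone_in C S \<and> (\<exists>c. s \<in> Hom C c a \<and> f \<in> Hom C c b)}"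

definition roof_equiv ::
  "('o, 'm, 'z) tri_cat_scheme \<Rightarrow> 'o set \<Rightarrow> 'o \<Rightarrow> 'o \<Rightarrow> 'm \<times> 'm \<Rightarrow> 'm \<times> 'm \<Rightarrow> bool" where
  "roof_equiv C S a b r r' \<longleftrightarrow> r \<in> roofs C S a b \<and> r' \<in> roofs C S a b \<and>
     (case (r, r') of ((s, f), (s', f')) \<Rightarrow>
        \<exists>d. \<exists>u \<in> Hom C d (Dom C s). \<exists>u' \<in> Hom C d (Dom C s').
          s \<cdot>\<^bsub>C\<^esub> u \<in> cone_in C S \<and>
          s \<cdot>\<^bsub>C\<^esub> u = s' \<cdot>\<^bsub>C\<^esub> u' \<and> f \<cdot>\<^bsub>C\<^esub> u = f' \<cdot>\<^bsub>C\<^esub> u')"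

definition roof_class ::
  "('o, 'm, 'z) tri_cat_scheme \<Rightarrow> 'o set \<Rightarrow> 'o \<Rightarrow> 'o \<Rightarrow> 'm \<times> 'm \<Rightarrow> ('m \<times> 'm) set" where
  "roof_class C S a b r = {r'. roof_equiv C S a b r r'}"

type_synonym ('o, 'm) fraction = "'o \<times> 'o \<times> ('m \<times> 'm) set"

definition quot_arr :: "('o, 'm, 'z) tri_cat_scheme \<Rightarrow> 'o set \<Rightarrow> 'm \<Rightarrow> ('o, 'm) fraction" where
  "quot_arr C S f =
     (Dom C f, Cod C f, roof_class C S (Dom C f) (Cod C f) (Ide C (Dom C f), f))"

definition quot_Cmp ::
  "('o, 'm, 'z) tri_cat_scheme \<Rightarrow> 'o set \<Rightarrow>
   ('o, 'm) fraction \<Rightarrow> ('o, 'm) fraction \<Rightarrow> ('o, 'm) fraction" where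
  "quot_Cmp C S \<psi> \<phi> = (case (\<psi>, \<phi>) of ((b', c, G), (a, b, F)) \<Rightarrow>
     (a, c, \<Union>{roof_class C S a c (s \<cdot>\<^bsub>C\<^esub> u, g \<cdot>\<^bsub>C\<^esub> h) | s f t g u h d.
        (s, f) \<in> F \<and> (t, g) \<in> G \<and>
        u \<in> cone_in C S \<and> u \<in> Hom C d (Dom C s) \<and> h \<in> Hom C d (Dom C t) \<and>
        f \<cdot>\<^bsub>C\<^esub> u = t \<cdot>\<^bsub>C\<^esub> h}))"

definition quot_Add ::
  "('o, 'm, 'z) tri_cat_scheme \<Rightarrow> 'o set \<Rightarrow>
   ('o, 'm) fraction \<Rightarrow> ('o, 'm) fraction \<Rightarrow> ('o, 'm) fraction" where
  "quot_Add C S \<phi> \<psi> = (case (\<phi>, \<psi>) of ((a, b, F), (a', b', G)) \<Rightarrow>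
     (a, b, \<Union>{roof_class C S a b (s, Add C f g) | s f g. (s, f) \<in> F \<and> (s, g) \<in> G}))"

definition quot_ShA ::
  "('o, 'm, 'z) tri_cat_scheme \<Rightarrow> 'o set \<Rightarrow> ('o, 'm) fraction \<Rightarrow> ('o, 'm) fraction" where
  "quot_ShA C S \<phi> = (case \<phi> of (a, b, F) \<Rightarrow>
     (ShO C a, ShO C b,
      \<Union>{roof_class C S (ShO C a) (ShO C b) (ShA C s, ShA C f) | s f. (s, f) \<in> F}))"

definition verdier_pre ::
  "('o, 'm, 'z) tri_cat_scheme \<Rightarrow> 'o set \<Rightarrow> ('o, ('o, 'm) fraction) tri_cat" where
  "verdier_pre C S = \<lparr>
     Obj = Obj C,
     Arr = {(a, b, roof_class C S a b r) | a b r. a \<in> Obj C \<and> b \<in> Obj C \<and> r \<in> roofs C S a b},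
     Dom = fst,
     Cod = fst \<circ> snd,
     Ide = (\<lambda>a. quot_arr C S (Ide C a)),
     Cmp = quot_Cmp C S,
     Add = quot_Add C S,
     Zer = (\<lambda>a b. quot_arr C S (Zer C a b)),
     ShO = ShO C,
     ShA = quot_ShA C S,
     Tri = {}\<rparr>"

text \<open>The distinguished triangles of the quotient are the triangles isomorphic, in the quotient, to
  the image of a distinguished triangle of \<open>C\<close>.\<close>

definition verdier_quotient ::
  "('o, 'm, 'z) tri_cat_scheme \<Rightarrow> 'o set \<Rightarrow> ('o, ('o, 'm) fraction) tri_cat" where
  "verdier_quotient C S = (verdier_pre C S)\<lparr>
     Tri := {t. \<exists>(f, g, h) \<in> Tri C.
       triangle_iso (verdier_pre C S) (quot_arr C S f, quot_arr C S g, quot_arr C S h) t}\<rparr>"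

end

(* Idea. Since S = X * Y, an arrow of T whose cone lies in S becomes invertible after two steps: the
   coreflection of T into the left perpendicular of Y (the torsion pair with torsion-free part Y) and
   the reflection into the right perpendicular of X (the torsion pair with torsion part X). So every
   object t has a resolution t <- w -> z with z in Z and cones in Y and in X; it is functorial, and by
   the five lemma it turns triangles into triangles. This gives an exact functor F from T to Z which is
   the identity on Z, and a roof (s, f) is determined up to equivalence by F(f) F(s)^-1. Hence the
   Hom-sets of T/S are those of Z, and T/S inherits its triangulated structure from Z instead of
   having it constructed by a calculus of fractions. *)

theory Submission
  imports Defs
begin

section \<open>Generalities on categories\<close>

text \<open>The operations of the quotient collect results over all representatives, so nothing
  about them is known beforehand, not even associativity. Each is therefore computed only through
  the value F(f) F(s)^-1, and an axiom of T/S is checked by applying the resulting bijection of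
  Hom-sets. Two obstacles shape the rest. The shift is only an autoequivalence: objects cannot be
  shifted back on the nose, and the resolution chosen for t[1] need not be the shift of the one
  chosen for t. A comparison isomorphism \<open>\<kappa>\<close> therefore accompanies every third
  arrow of a triangle. And a map of triangles produced by TR3 comes without control of its cone;
  cones in Y and in X are hence characterised by bijectivity of Hom out of the left perpendicular of
  Y and of Hom into the right perpendicular of X. This works because Y and X are in turn recovered
  as perpendiculars. Finally, only X[1] = X is given; Y is thick as the intersection of S with the
  right perpendicular of X, so Y[1] may be replaced by Y in the definition of Z.\<close>

lemma Hom_iff: "f \<in> Hom C a b \<longleftrightarrow> f \<in> Arr C \<and> Dom C f = a \<and> Cod C f = b"
  by (simp add: Hom_def)

context category
begin

lemma Cmp_simps [simp]:
  assumes "f \<in> Arr C" "g \<in> Arr C" "Dom C g = Cod C f"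
  shows "g \<cdot> f \<in> Arr C" "Dom C (g \<cdot> f) = Dom C f" "Cod C (g \<cdot> f) = Cod C g"
  using Cmp_Hom[of f "Dom C f" "Cod C f" g "Cod C g"] assms by (auto simp: Hom_iff)

lemma Ide_simps [simp]:
  assumes "a \<in> Obj C"
  shows "Ide C a \<in> Arr C" "Dom C (Ide C a) = a" "Cod C (Ide C a) = a"
  using Ide_Hom[OF assms] by (auto simp: Hom_iff)

lemma Cmp_Ide [simp]:
  "f \<in> Arr C \<Longrightarrow> Dom C f = a \<Longrightarrow> f \<cdot> Ide C a = f"
  "f \<in> Arr C \<Longrightarrow> Cod C f = b \<Longrightarrow> Ide C b \<cdot> f = f"
  using Cmp_Ide_right Cmp_Ide_left by (auto simp: Hom_iff)

lemma assoc [simp]: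
  assumes "f \<in> Arr C" "g \<in> Arr C" "h \<in> Arr C" "Dom C g = Cod C f" "Dom C h = Cod C g"
  shows "(h \<cdot> g) \<cdot> f = h \<cdot> (g \<cdot> f)"
  by (rule Cmp_assoc[of f "Dom C f" "Cod C f" g "Cod C g" h "Cod C h"]) (use assms in \<open>auto simp: Hom_iff\<close>)

text \<open>Composites are normalised to right-nested form by \<open>assoc\<close>, so an equation
  \<open>g \<cdot> f = k\<close> no longer matches inside a longer composite.
  \<open>reassoc[OF eq]\<close> is the same equation with an arbitrary tail \<open>x\<close>, ready
  for rewriting.\<close>

lemma reassoc:
  assumes "g \<cdot> f = k" "f \<in> Arr C" "g \<in> Arr C" "Dom C g = Cod C f"
    and "x \<in> Arr C" "Dom C f = Cod C x"
  shows "g \<cdot> (f \<cdot> x) = k \<cdot> x"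
  using assms by (simp flip: assoc)

lemma Hom_Obj: "f \<in> Hom C a b \<Longrightarrow> a \<in> Obj C" "f \<in> Hom C a b \<Longrightarrow> b \<in> Obj C"
  using Dom_Obj Cod_Obj by (auto simp: Hom_iff)

lemma iso_arrI:
  assumes "f \<in> Hom C a b" "g \<in> Hom C b a" "g \<cdot> f = Ide C a" "f \<cdot> g = Ide C b"
  shows "iso_arr C f"
  using assms by (auto simp: iso_arr_def Hom_iff)

lemma iso_arr_inverse:
  assumes "iso_arr C f" "f \<in> Hom C a b"
  obtains g where "g \<in> Hom C b a" "g \<cdot> f = Ide C a" "f \<cdot> g = Ide C b" "iso_arr C g"
proof -
  from assms obtain g where g: "g \<in> Hom C b a" "g \<cdot> f = Ide C a" "f \<cdot> g = Ide C b"
    by (auto simp: iso_arr_def Hom_iff)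
  moreover have "iso_arr C g"
    by (rule iso_arrI[of g b a f]) (use g assms in auto)
  ultimately show thesis by (rule that)
qed

lemma iso_arr_Ide: "a \<in> Obj C \<Longrightarrow> iso_arr C (Ide C a)"
  by (rule iso_arrI[of _ a a "Ide C a"]) (auto simp: Hom_iff)

lemma iso_arr_Cmp:
  assumes "iso_arr C f" "iso_arr C g" "f \<in> Hom C a b" "g \<in> Hom C b c"
  shows "iso_arr C (g \<cdot> f)"
proof -
  from assms obtain f' where f': "f' \<in> Hom C b a" "f' \<cdot> f = Ide C a" "f \<cdot> f' = Ide C b"
    by (meson iso_arr_inverse)
  from assms obtain g' where g': "g' \<in> Hom C c b" "g' \<cdot> g = Ide C b" "g \<cdot> g' = Ide C c"
    by (meson iso_arr_inverse)
  show ?thesis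
    by (rule iso_arrI[of _ a c "f' \<cdot> g'"])
      (use assms(3,4) f' g' in \<open>auto simp: Hom_iff reassoc[OF f'(3)] reassoc[OF g'(2)]\<close>)
qed

lemma isomorphic_refl: "a \<in> Obj C \<Longrightarrow> isomorphic C a a"
  unfolding isomorphic_def using iso_arr_Ide Ide_Hom by blast

lemma isomorphic_sym: "isomorphic C a b \<Longrightarrow> isomorphic C b a"
  unfolding isomorphic_def by (meson iso_arr_inverse)

lemma isomorphic_trans: "isomorphic C a b \<Longrightarrow> isomorphic C b c \<Longrightarrow> isomorphic C a c"
  unfolding isomorphic_def by (meson iso_arr_Cmp Cmp_Hom)

lemma iso_arr_cancel_left:
  assumes "iso_arr C m" "m \<in> Hom C b c" "f \<in> Hom C a b" "g \<in> Hom C a b" "m \<cdot> f = m \<cdot> g"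
  shows "f = g"
proof -
  obtain m' where m': "m' \<in> Hom C c b" "m' \<cdot> m = Ide C b"
    using assms(1,2) by (meson iso_arr_inverse)
  have "m' \<cdot> (m \<cdot> f) = m' \<cdot> (m \<cdot> g)" using assms(5) by simp
  then show ?thesis using m' assms(2-4) by (simp add: Hom_iff reassoc[OF m'(2)])
qed

lemma iso_arr_cancel_right:
  assumes "iso_arr C m" "m \<in> Hom C a b" "f \<in> Hom C b c" "g \<in> Hom C b c" "f \<cdot> m = g \<cdot> m"
  shows "f = g"
proof -
  obtain m' where m': "m' \<in> Hom C b a" "m \<cdot> m' = Ide C b"
    using assms(1,2) by (meson iso_arr_inverse)
  have "(f \<cdot> m) \<cdot> m' = (g \<cdot> m) \<cdot> m'" using assms(5) by simp
  then show ?thesis using m' assms(2-4) by (simp add: Hom_iff)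
qed

end

section \<open>Functors and a criterion for equivalences\<close>

context cat_functor
begin

lemma F1_simps [simp]:
  assumes "f \<in> Arr C"
  shows "F1 f \<in> Arr D" "Dom D (F1 f) = F0 (Dom C f)" "Cod D (F1 f) = F0 (Cod C f)"
  using F1_Hom[of f "Dom C f" "Cod C f"] assms by (auto simp: Hom_iff)

lemma F1_Cmp': "\<lbrakk>f \<in> Arr C; g \<in> Arr C; Dom C g = Cod C f\<rbrakk>
      \<Longrightarrow> F1 (g \<cdot>\<^bsub>C\<^esub> f) = F1 g \<cdot>\<^bsub>D\<^esub> F1 f"
  using F1_Cmp[of f "Dom C f" "Cod C f" g "Cod C g"] by (auto simp: Hom_iff)

lemma F1_iso_arr:
  assumes "iso_arr C f"
  shows "iso_arr D (F1 f)"
proof -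
  have f: "f \<in> Hom C (Dom C f) (Cod C f)" using assms by (simp add: iso_arr_def Hom_iff)
  obtain g where g: "g \<in> Hom C (Cod C f) (Dom C f)"
    "g \<cdot>\<^bsub>C\<^esub> f = Ide C (Dom C f)" "f \<cdot>\<^bsub>C\<^esub> g = Ide C (Cod C f)"
    using assms f by (meson C.iso_arr_inverse)
  show ?thesis
    by (rule D.iso_arrI[OF F1_Hom[OF f] F1_Hom[OF g(1)]])
      (use f g C.Hom_Obj[OF f] in \<open>simp_all add: F1_Ide flip: F1_Cmp\<close>)
qed

lemma F0_isomorphic: "isomorphic C a b \<Longrightarrow> isomorphic D (F0 a) (F0 b)"
  unfolding isomorphic_def using F1_iso_arr F1_Hom by blast

text \<open>The inverse of \<open>F1 f\<close> is lifted by surjectivity on Hom-sets; injectivity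
  then lifts the two inverse laws.\<close>

lemma fully_faithful_reflects_iso:
  assumes bij: "\<And>a b. a \<in> Obj C \<Longrightarrow> b \<in> Obj C \<Longrightarrow> bij_betw F1 (Hom C a b) (Hom D (F0 a) (F0 b))"
    and f: "f \<in> Hom C a b" "iso_arr D (F1 f)"
  shows "iso_arr C f"
proof -
  have ab: "a \<in> Obj C" "b \<in> Obj C" using f C.Hom_Obj by auto
  obtain g where g: "g \<in> Hom D (F0 b) (F0 a)" "g \<cdot>\<^bsub>D\<^esub> F1 f = Ide D (F0 a)" "F1 f \<cdot>\<^bsub>D\<^esub> g = Ide D (F0 b)"
    using D.iso_arr_inverse[OF f(2) F1_Hom[OF f(1)]] by metis
  have "g \<in> F1 ` Hom C b a" using bij[OF ab(2,1)] g(1) by (simp add: bij_betw_def)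
  then obtain k where k: "k \<in> Hom C b a" "F1 k = g" by blast
  have inj: "\<And>x y. x \<in> Obj C \<Longrightarrow> y \<in> Obj C \<Longrightarrow> inj_on F1 (Hom C x y)"
    using bij by (auto simp: bij_betw_def)
  have "k \<cdot>\<^bsub>C\<^esub> f = Ide C a"
    by (rule inj_onD[OF inj[OF ab(1) ab(1)]])
      (use f k g ab in \<open>simp_all add: F1_Ide F1_Cmp[OF f(1) k(1)] C.Ide_Hom C.Cmp_Hom[OF f(1) k(1)]\<close>)
  moreover have "f \<cdot>\<^bsub>C\<^esub> k = Ide C b"
    by (rule inj_onD[OF inj[OF ab(2) ab(2)]])
      (use f k g ab in \<open>simp_all add: F1_Ide F1_Cmp[OF k(1) f(1)] C.Ide_Hom C.Cmp_Hom[OF k(1) f(1)]\<close>)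
  ultimately show ?thesis using C.iso_arrI f(1) k(1) by blast
qed

text \<open>The quasi-inverse is chosen objectwise: \<open>e d\<close> and \<open>k d\<close> are
  mutually inverse arrows between \<open>F0 (G0 d)\<close> and \<open>d\<close>. Conjugation with
  them takes an arrow of \<open>D\<close> into the image of \<open>F1\<close>, and functoriality of
  its preimage follows from faithfulness.\<close>

lemma equivalence_functorI:
  assumes bij: "\<And>a b. a \<in> Obj C \<Longrightarrow> b \<in> Obj C \<Longrightarrow> bij_betw F1 (Hom C a b) (Hom D (F0 a) (F0 b))"
    and surj: "\<And>d. d \<in> Obj D \<Longrightarrow> \<exists>c \<in> Obj C. isomorphic D (F0 c) d"
  shows "equivalence_functor C D F0 F1"
proof -
  have "\<forall>d\<in>Obj D. \<exists>c e k. c \<in> Obj C \<and> e \<in> Hom D (F0 c) d \<and> k \<in> Hom D d (F0 c) \<and>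
     k \<cdot>\<^bsub>D\<^esub> e = Ide D (F0 c) \<and> e \<cdot>\<^bsub>D\<^esub> k = Ide D d"
    using surj unfolding isomorphic_def by (meson D.iso_arr_inverse)
  then obtain G0 e k where G: "\<And>d. d \<in> Obj D \<Longrightarrow> G0 d \<in> Obj C \<and> e d \<in> Hom D (F0 (G0 d)) d \<and>
     k d \<in> Hom D d (F0 (G0 d)) \<and> k d \<cdot>\<^bsub>D\<^esub> e d = Ide D (F0 (G0 d)) \<and> e d \<cdot>\<^bsub>D\<^esub> k d = Ide D d"
    by metis
  note G0 = G[THEN conjunct1]
  have e: "e d \<in> Arr D" "Dom D (e d) = F0 (G0 d)" "Cod D (e d) = d" if "d \<in> Obj D" for d
    using G[OF that] by (auto simp: Hom_iff)
  have k: "k d \<in> Arr D" "Cod D (k d) = F0 (G0 d)" "Dom D (k d) = d" if "d \<in> Obj D" for d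
    using G[OF that] by (auto simp: Hom_iff)
  have ke: "k d \<cdot>\<^bsub>D\<^esub> e d = Ide D (F0 (G0 d))" "e d \<cdot>\<^bsub>D\<^esub> k d = Ide D d" if "d \<in> Obj D" for d
    using G[OF that] by auto
  define L where "L a b = the_inv_into (Hom C a b) F1" for a b
  have L: "L a b h \<in> Hom C a b" "F1 (L a b h) = h"
    if "a \<in> Obj C" "b \<in> Obj C" "h \<in> Hom D (F0 a) (F0 b)" for a b h
    using bij[OF that(1,2)] that(3) unfolding bij_betw_def L_def
    by (auto intro: the_inv_into_into f_the_inv_into_f)
  have inj: "f = g" if "f \<in> Hom C a b" "g \<in> Hom C a b" "F1 f = F1 g" for f g a b
    using bij[of a b] that C.Hom_Obj[OF that(1)] by (auto simp: bij_betw_def inj_on_def)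
  define G1 where "G1 g = L (G0 (Dom D g)) (G0 (Cod D g)) (k (Cod D g) \<cdot>\<^bsub>D\<^esub> (g \<cdot>\<^bsub>D\<^esub> e (Dom D g)))" for g
  note Hom_iff [simp] D.Dom_Obj [simp] D.Cod_Obj [simp] C.Dom_Obj [simp] C.Cod_Obj [simp] F0_Obj [simp] G0 [simp] e [simp] k [simp]
  have G1: "G1 g \<in> Hom C (G0 (Dom D g)) (G0 (Cod D g)) \<and> F1 (G1 g) = k (Cod D g) \<cdot>\<^bsub>D\<^esub> (g \<cdot>\<^bsub>D\<^esub> e (Dom D g))"
    if "g \<in> Arr D" for g
    using that L[of "G0 (Dom D g)" "G0 (Cod D g)" "k (Cod D g) \<cdot>\<^bsub>D\<^esub> (g \<cdot>\<^bsub>D\<^esub> e (Dom D g))"]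
    unfolding G1_def by simp
  have G_functor: "cat_functor D C G0 G1"
  proof unfold_locales
    show "G1 f \<in> Hom C (G0 a) (G0 b)" if "f \<in> Hom D a b" for f a b
      using that G1[of f] by auto
    show "G1 (Ide D a) = Ide C (G0 a)" if "a \<in> Obj D" for a
      by (rule inj[of _ "G0 a" "G0 a"]) (use that G1[of "Ide D a"] ke in \<open>simp_all add: F1_Ide\<close>)
    show "G1 (g \<cdot>\<^bsub>D\<^esub> f) = G1 g \<cdot>\<^bsub>C\<^esub> G1 f" if "f \<in> Hom D a b" "g \<in> Hom D b c" for f g a b c
      by (rule inj[of _ "G0 a" "G0 c"])
        (use that G1[of f] G1[of g] G1[of "g \<cdot>\<^bsub>D\<^esub> f"] in
          \<open>auto simp: F1_Cmp' D.reassoc[OF ke(2)]\<close>)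
  qed (simp_all)
  \<comment> \<open>The unit at \<open>a\<close> is the preimage of \<open>k (F0 a)\<close>; it is
    invertible because a fully faithful functor reflects isomorphisms.\<close>
  define \<eta> where "\<eta> a = L a (G0 (F0 a)) (k (F0 a))" for a
  have \<eta>: "\<eta> a \<in> Hom C a (G0 (F0 a)) \<and> F1 (\<eta> a) = k (F0 a)" if "a \<in> Obj C" for a
    using that L[of a "G0 (F0 a)" "k (F0 a)"] unfolding \<eta>_def by simp
  have iso_k: "iso_arr D (k d)" "iso_arr D (e d)" if "d \<in> Obj D" for d
    by (rule D.iso_arrI; use that G[of d] in blast)+
  have nat1: "natural_iso C C (\<lambda>a. a) (\<lambda>f. f) (G0 \<circ> F0) (G1 \<circ> F1) \<eta>"
    unfolding natural_iso_def
  proof (intro conjI ballI)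
    fix a assume a: "a \<in> Obj C"
    show "\<eta> a \<in> Hom C a ((G0 \<circ> F0) a)" using \<eta>[OF a] by simp
    show "iso_arr C (\<eta> a)"
      by (rule fully_faithful_reflects_iso[OF bij, of _ a "G0 (F0 a)"]) (use a \<eta>[OF a] iso_k in auto)
  next
    fix f assume f: "f \<in> Arr C"
    show "(G1 \<circ> F1) f \<cdot>\<^bsub>C\<^esub> \<eta> (Dom C f) = \<eta> (Cod C f) \<cdot>\<^bsub>C\<^esub> f"
      by (rule inj[of _ "Dom C f" "G0 (F0 (Cod C f))"])
        (use f \<eta>[of "Dom C f"] \<eta>[of "Cod C f"] G1[of "F1 f"] ke in \<open>auto simp: F1_Cmp'\<close>)
  qed
  have nat2: "natural_iso D D (F0 \<circ> G0) (F1 \<circ> G1) (\<lambda>a. a) (\<lambda>f. f) e"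
    unfolding natural_iso_def
  proof (intro conjI ballI)
    fix f assume f: "f \<in> Arr D"
    show "f \<cdot>\<^bsub>D\<^esub> e (Dom D f) = e (Cod D f) \<cdot>\<^bsub>D\<^esub> (F1 \<circ> G1) f"
      using f G1[of f] by (auto simp: D.reassoc[OF ke(2)])
  qed (use iso_k in auto)
  show ?thesis
    by unfold_locales (use G_functor nat1 nat2 in blast)
qed

end

text \<open>Naturality reads \<open>\<eta> b \<cdot> f = G1 (F1 f) \<cdot> \<eta> a\<close>, so the
  invertible \<open>\<eta> b\<close> lets \<open>f\<close> be recovered from
  \<open>F1 f\<close>.\<close>

lemma (in cat_functor) natural_faithful:
  assumes \<eta>: "natural_iso C C (\<lambda>a. a) (\<lambda>f. f) (G0 \<circ> F0) (G1 \<circ> F1) \<eta>"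
    and "f \<in> Hom C a b" "g \<in> Hom C a b" "F1 f = F1 g"
  shows "f = g"
proof -
  have "b \<in> Obj C" using assms C.Hom_Obj by auto
  then have b: "\<eta> b \<in> Hom C b (G0 (F0 b))" "iso_arr C (\<eta> b)" using \<eta> by (auto simp: natural_iso_def)
  have "\<eta> b \<cdot>\<^bsub>C\<^esub> f = G1 (F1 f) \<cdot>\<^bsub>C\<^esub> \<eta> a" "\<eta> b \<cdot>\<^bsub>C\<^esub> g = G1 (F1 g) \<cdot>\<^bsub>C\<^esub> \<eta> a"
    using \<eta> assms(2,3) by (auto simp: natural_iso_def Hom_iff)
  then show ?thesis using C.iso_arr_cancel_left[OF b(2,1)] assms by auto
qed

text \<open>Faithfulness is deduced from a transformation out of the identity, while the counit of a
  quasi-inverse points into it. Inverting the counit componentwise makes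
  \<open>natural_faithful\<close> apply to the quasi-inverse as well.\<close>

lemma (in category) natural_iso_inverse:
  assumes F: "cat_functor C C F0 F1"
    and \<epsilon>: "natural_iso C C F0 F1 (\<lambda>a. a) (\<lambda>f. f) \<epsilon>"
  shows "\<exists>\<eta>. natural_iso C C (\<lambda>a. a) (\<lambda>f. f) F0 F1 \<eta>"
proof -
  interpret F: cat_functor C C F0 F1 by (rule F)
  have "\<forall>a\<in>Obj C. \<exists>k. k \<in> Hom C a (F0 a) \<and> iso_arr C k \<and>
      k \<cdot> \<epsilon> a = Ide C (F0 a) \<and> \<epsilon> a \<cdot> k = Ide C a"
    using \<epsilon> unfolding natural_iso_def by (meson iso_arr_inverse)
  then obtain \<eta> where \<eta>: "\<And>a. a \<in> Obj C \<Longrightarrow> \<eta> a \<in> Hom C a (F0 a) \<and> iso_arr C (\<eta> a) \<and>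
      \<eta> a \<cdot> \<epsilon> a = Ide C (F0 a) \<and> \<epsilon> a \<cdot> \<eta> a = Ide C a" by metis
  have "natural_iso C C (\<lambda>a. a) (\<lambda>f. f) F0 F1 \<eta>"
    unfolding natural_iso_def
  proof (intro conjI ballI)
    fix f assume f: "f \<in> Arr C"
    note d = \<eta>[OF Dom_Obj[OF f]] and c = \<eta>[OF Cod_Obj[OF f]]
    have e: "\<epsilon> (Dom C f) \<in> Hom C (F0 (Dom C f)) (Dom C f)" "\<epsilon> (Cod C f) \<in> Hom C (F0 (Cod C f)) (Cod C f)"
      and n: "f \<cdot> \<epsilon> (Dom C f) = \<epsilon> (Cod C f) \<cdot> F1 f"
      using \<epsilon> f Dom_Obj Cod_Obj by (auto simp: natural_iso_def)
    have ec: "\<eta> (Cod C f) \<cdot> \<epsilon> (Cod C f) = Ide C (F0 (Cod C f))" using c by blast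
    have "F1 f \<cdot> \<eta> (Dom C f) = \<eta> (Cod C f) \<cdot> (\<epsilon> (Cod C f) \<cdot> (F1 f \<cdot> \<eta> (Dom C f)))"
      using f d c e by (simp add: Hom_iff reassoc[OF ec])
    also have "\<epsilon> (Cod C f) \<cdot> (F1 f \<cdot> \<eta> (Dom C f)) = f \<cdot> (\<epsilon> (Dom C f) \<cdot> \<eta> (Dom C f))"
      using f d e by (simp add: Hom_iff reassoc[OF n[symmetric]])
    finally show "F1 f \<cdot> \<eta> (Dom C f) = \<eta> (Cod C f) \<cdot> f" using f d by (simp add: Hom_iff)
  qed (use \<eta> in auto)
  then show ?thesis by blast
qed

context equivalence_functor
begin

text \<open>Faithfulness of both functors comes from the unit and the inverted counit. For fullness,
  \<open>G1 g\<close> is conjugated by the unit to an arrow \<open>f\<close> with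
  \<open>G1 (F1 f) = G1 g\<close>; faithfulness of the quasi-inverse gives
  \<open>F1 f = g\<close>.\<close>

lemma fully_faithful:
  assumes ab: "a \<in> Obj C" "b \<in> Obj C"
  shows "bij_betw F1 (Hom C a b) (Hom D (F0 a) (F0 b))"
proof -
  obtain G0 G1 \<eta> \<epsilon> where G: "cat_functor D C G0 G1"
    and \<eta>: "natural_iso C C (\<lambda>a. a) (\<lambda>f. f) (G0 \<circ> F0) (G1 \<circ> F1) \<eta>"
    and \<epsilon>: "natural_iso D D (F0 \<circ> G0) (F1 \<circ> G1) (\<lambda>a. a) (\<lambda>f. f) \<epsilon>"
    using quasi_inverse by blast
  interpret G: cat_functor D C G0 G1 by (rule G)
  have FG: "cat_functor D D (F0 \<circ> G0) (F1 \<circ> G1)"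
    by unfold_locales (auto simp: F0_Obj G.F0_Obj F1_Ide G.F1_Ide G.F1_Cmp intro: F1_Hom G.F1_Hom F1_Cmp)
  obtain \<epsilon>' where \<epsilon>': "natural_iso D D (\<lambda>a. a) (\<lambda>f. f) (F0 \<circ> G0) (F1 \<circ> G1) \<epsilon>'"
    using D.natural_iso_inverse[OF FG \<epsilon>] by blast
  note faithful = natural_faithful[OF \<eta>] and G_faithful = G.natural_faithful[OF \<epsilon>']
  have "\<exists>f \<in> Hom C a b. F1 f = g" if g: "g \<in> Hom D (F0 a) (F0 b)" for g
  proof -
    have a: "\<eta> a \<in> Hom C a (G0 (F0 a))" "iso_arr C (\<eta> a)"
      and b: "\<eta> b \<in> Hom C b (G0 (F0 b))" "iso_arr C (\<eta> b)"
      using \<eta> ab by (auto simp: natural_iso_def)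
    obtain b' where b': "b' \<in> Hom C (G0 (F0 b)) b" "\<eta> b \<cdot>\<^bsub>C\<^esub> b' = Ide C (G0 (F0 b))"
      using C.iso_arr_inverse[OF b(2,1)] by metis
    define f where "f = b' \<cdot>\<^bsub>C\<^esub> (G1 g \<cdot>\<^bsub>C\<^esub> \<eta> a)"
    have Gg: "G1 g \<in> Hom C (G0 (F0 a)) (G0 (F0 b))" using g by (rule G.F1_Hom)
    have f: "f \<in> Hom C a b" using a b' Gg by (auto simp: f_def Hom_iff)
    have "G1 (F1 f) \<cdot>\<^bsub>C\<^esub> \<eta> a = \<eta> b \<cdot>\<^bsub>C\<^esub> f"
      using \<eta> f by (auto simp: natural_iso_def Hom_iff)
    also have "\<dots> = G1 g \<cdot>\<^bsub>C\<^esub> \<eta> a"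
      using a b b' Gg by (simp add: f_def Hom_iff C.reassoc[OF b'(2)])
    finally have "G1 (F1 f) = G1 g"
      using C.iso_arr_cancel_right[OF a(2,1)] Gg G.F1_Hom[OF F1_Hom[OF f]] by blast
    then have "F1 f = g" using G_faithful[OF F1_Hom[OF f] g] by blast
    then show ?thesis using f by blast
  qed
  moreover have "inj_on F1 (Hom C a b)" using faithful by (auto intro: inj_onI)
  ultimately show ?thesis unfolding bij_betw_def using F1_Hom by auto
qed

lemma essentially_surjective:
  assumes "d \<in> Obj D"
  shows "\<exists>c \<in> Obj C. isomorphic D (F0 c) d"
proof -
  obtain G0 G1 \<eta> \<epsilon> where G: "cat_functor D C G0 G1"
    and \<epsilon>: "natural_iso D D (F0 \<circ> G0) (F1 \<circ> G1) (\<lambda>a. a) (\<lambda>f. f) \<epsilon>"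
    using quasi_inverse by blast
  then show ?thesis
    using assms cat_functor.F0_Obj[OF G] unfolding natural_iso_def isomorphic_def by fastforce
qed

lemma reflects_iso: "f \<in> Hom C a b \<Longrightarrow> iso_arr D (F1 f) \<Longrightarrow> iso_arr C f"
  by (rule fully_faithful_reflects_iso[OF fully_faithful])

lemma faithful:
  assumes "f \<in> Hom C a b" "g \<in> Hom C a b" "F1 f = F1 g"
  shows "f = g"
  using fully_faithful[OF C.Hom_Obj[OF assms(1)]] assms by (simp add: bij_betw_def inj_on_def)

lemma full:
  assumes "g \<in> Hom D (F0 a) (F0 b)" "a \<in> Obj C" "b \<in> Obj C"
  obtains f where "f \<in> Hom C a b" "F1 f = g"
proof -
  have "g \<in> F1 ` Hom C a b" using fully_faithful[of a b] assms by (simp add: bij_betw_def)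
  then show thesis using that by blast
qed

end

section \<open>Additive categories\<close>

context additive_category
begin

lemma Add_Hom: "\<lbrakk>f \<in> Hom C a b; g \<in> Hom C a b\<rbrakk> \<Longrightarrow> Add C f g \<in> Hom C a b"
  and Zer_Hom: "\<lbrakk>a \<in> Obj C; b \<in> Obj C\<rbrakk> \<Longrightarrow> Zer C a b \<in> Hom C a b"
  and Neg_Hom: "f \<in> Hom C a b \<Longrightarrow> Neg C f \<in> Hom C a b"
  and Add_assoc: "\<lbrakk>f \<in> Hom C a b; g \<in> Hom C a b; h \<in> Hom C a b\<rbrakk>
    \<Longrightarrow> Add C (Add C f g) h = Add C f (Add C g h)"
  and Add_commute: "\<lbrakk>f \<in> Hom C a b; g \<in> Hom C a b\<rbrakk> \<Longrightarrow> Add C f g = Add C g f"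
  and Add_Zer_left: "f \<in> Hom C a b \<Longrightarrow> Add C (Zer C a b) f = f"
  and Add_Zer_right: "f \<in> Hom C a b \<Longrightarrow> Add C f (Zer C a b) = f"
  and Add_Neg_left: "f \<in> Hom C a b \<Longrightarrow> Add C (Neg C f) f = Zer C a b"
  and Add_Neg_right: "f \<in> Hom C a b \<Longrightarrow> Add C f (Neg C f) = Zer C a b"
proof -
  have G: "comm_group (hom_group C a b)" if "a \<in> Obj C" "b \<in> Obj C" for a b
    using Hom_comm_group that .
  have G': "comm_group (hom_group C a b)" if "f \<in> Hom C a b" for f a b
    using G Hom_Obj[OF that] by blast
  have N: "Neg C f = inv\<^bsub>hom_group C a b\<^esub> f" if "f \<in> Hom C a b" for f a b
    using that by (auto simp: Neg_def Hom_iff)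
  show "\<lbrakk>f \<in> Hom C a b; g \<in> Hom C a b\<rbrakk> \<Longrightarrow> Add C f g \<in> Hom C a b"
    using monoid.m_closed[OF comm_monoid.axioms(1)[OF comm_group.axioms(1)[OF G'[of f a b]]]]
    by (simp add: hom_group_def)
  show "\<lbrakk>a \<in> Obj C; b \<in> Obj C\<rbrakk> \<Longrightarrow> Zer C a b \<in> Hom C a b"
    using monoid.one_closed[OF comm_monoid.axioms(1)[OF comm_group.axioms(1)[OF G[of a b]]]]
    by (simp add: hom_group_def)
  show "f \<in> Hom C a b \<Longrightarrow> Neg C f \<in> Hom C a b"
    using group.inv_closed[OF comm_group.axioms(2)[OF G'[of f a b]], of f] N[of f a b]
    by (simp add: hom_group_def)
  show "\<lbrakk>f \<in> Hom C a b; g \<in> Hom C a b; h \<in> Hom C a b\<rbrakk>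
    \<Longrightarrow> Add C (Add C f g) h = Add C f (Add C g h)"
    using monoid.m_assoc[OF comm_monoid.axioms(1)[OF comm_group.axioms(1)[OF G'[of f a b]]]]
    by (simp add: hom_group_def)
  show "\<lbrakk>f \<in> Hom C a b; g \<in> Hom C a b\<rbrakk> \<Longrightarrow> Add C f g = Add C g f"
    using comm_monoid.m_comm[OF comm_group.axioms(1)[OF G'[of f a b]]]
    by (simp add: hom_group_def)
  show "f \<in> Hom C a b \<Longrightarrow> Add C (Zer C a b) f = f"
    using monoid.l_one[OF comm_monoid.axioms(1)[OF comm_group.axioms(1)[OF G'[of f a b]]]]
    by (simp add: hom_group_def)
  show "f \<in> Hom C a b \<Longrightarrow> Add C f (Zer C a b) = f"
    using monoid.r_one[OF comm_monoid.axioms(1)[OF comm_group.axioms(1)[OF G'[of f a b]]]]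
    by (simp add: hom_group_def)
  show "f \<in> Hom C a b \<Longrightarrow> Add C (Neg C f) f = Zer C a b"
    using group.l_inv[OF comm_group.axioms(2)[OF G'[of f a b]], of f] N[of f a b]
    by (simp add: hom_group_def)
  show "f \<in> Hom C a b \<Longrightarrow> Add C f (Neg C f) = Zer C a b"
    using group.r_inv[OF comm_group.axioms(2)[OF G'[of f a b]], of f] N[of f a b]
    by (simp add: hom_group_def)
qed

lemma Add_simps [simp]:
  assumes "f \<in> Arr C" "g \<in> Arr C" "Dom C f = Dom C g" "Cod C f = Cod C g"
  shows "Add C f g \<in> Arr C" "Dom C (Add C f g) = Dom C g" "Cod C (Add C f g) = Cod C g"
  using Add_Hom[of f "Dom C g" "Cod C g" g] assms by (auto simp: Hom_iff)

lemma Zer_simps [simp]: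
  assumes "a \<in> Obj C" "b \<in> Obj C"
  shows "Zer C a b \<in> Arr C" "Dom C (Zer C a b) = a" "Cod C (Zer C a b) = b"
  using Zer_Hom[OF assms] by (auto simp: Hom_iff)

lemma Neg_simps [simp]:
  assumes "f \<in> Arr C"
  shows "Neg C f \<in> Arr C" "Dom C (Neg C f) = Dom C f" "Cod C (Neg C f) = Cod C f"
  using Neg_Hom[of f "Dom C f" "Cod C f"] assms by (auto simp: Hom_iff)

text \<open>This is how an additive operation is seen to preserve zero: the image of
  \<open>0 = 0 + 0\<close> equals its own double.\<close>

lemma Add_self_eq_imp_Zer:
  assumes "f \<in> Hom C a b" "Add C f f = f"
  shows "f = Zer C a b"
proof -
  have "f = Add C (Add C f f) (Neg C f)"
    using assms(1) by (simp add: Add_assoc[OF assms(1) assms(1) Neg_Hom[OF assms(1)]] Add_Neg_right Add_Zer_right)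
  then show ?thesis using assms by (simp add: Add_Neg_right)
qed

lemma Neg_unique:
  assumes "f \<in> Hom C a b" "g \<in> Hom C a b" "Add C f g = Zer C a b"
  shows "Neg C f = g"
proof -
  have "Neg C f = Add C (Neg C f) (Add C f g)"
    using assms Neg_Hom[OF assms(1)] by (simp add: Add_Zer_right)
  also have "\<dots> = g"
    using assms Add_assoc[OF Neg_Hom[OF assms(1)] assms(1,2)] by (simp add: Add_Neg_left Add_Zer_left)
  finally show ?thesis .
qed

lemma Neg_Neg [simp]: "f \<in> Arr C \<Longrightarrow> Neg C (Neg C f) = f"
  by (rule Neg_unique[of _ "Dom C f" "Cod C f"]) (auto simp: Hom_iff intro!: Add_Neg_left)

lemma Cmp_Zer [simp]:
  "f \<in> Arr C \<Longrightarrow> Dom C f = b \<Longrightarrow> a \<in> Obj C \<Longrightarrow> f \<cdot> Zer C a b = Zer C a (Cod C f)"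
  "f \<in> Arr C \<Longrightarrow> Cod C f = b \<Longrightarrow> c \<in> Obj C \<Longrightarrow> Zer C b c \<cdot> f = Zer C (Dom C f) c"
proof -
  assume f: "f \<in> Arr C" "Dom C f = b" "a \<in> Obj C"
  then have b: "b \<in> Obj C" using Dom_Obj by auto
  note Z = Zer_Hom[OF f(3) b]
  have "f \<cdot> Add C (Zer C a b) (Zer C a b) = Add C (f \<cdot> Zer C a b) (f \<cdot> Zer C a b)"
    by (rule Cmp_Add_right[OF Z Z, of _ "Cod C f"]) (use f in \<open>simp add: Hom_iff\<close>)
  then have "Add C (f \<cdot> Zer C a b) (f \<cdot> Zer C a b) = f \<cdot> Zer C a b"
    by (simp add: Add_Zer_left[OF Z])
  then show "f \<cdot> Zer C a b = Zer C a (Cod C f)"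
    by (rule Add_self_eq_imp_Zer[rotated]) (use f b in \<open>simp add: Hom_iff\<close>)
next
  assume f: "f \<in> Arr C" "Cod C f = b" "c \<in> Obj C"
  then have b: "b \<in> Obj C" using Cod_Obj by auto
  note Z = Zer_Hom[OF b f(3)]
  have "Add C (Zer C b c) (Zer C b c) \<cdot> f = Add C (Zer C b c \<cdot> f) (Zer C b c \<cdot> f)"
    by (rule Cmp_Add_left[OF _ Z Z, of _ "Dom C f"]) (use f in \<open>simp add: Hom_iff\<close>)
  then have "Add C (Zer C b c \<cdot> f) (Zer C b c \<cdot> f) = Zer C b c \<cdot> f"
    by (simp add: Add_Zer_left[OF Z])
  then show "Zer C b c \<cdot> f = Zer C (Dom C f) c"
    by (rule Add_self_eq_imp_Zer[rotated]) (use f b in \<open>simp add: Hom_iff\<close>)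
qed

lemma Cmp_Neg:
  assumes "f \<in> Arr C" "g \<in> Arr C" "Dom C g = Cod C f"
  shows "g \<cdot> Neg C f = Neg C (g \<cdot> f)" "Neg C g \<cdot> f = Neg C (g \<cdot> f)"
proof -
  have f: "f \<in> Hom C (Dom C f) (Cod C f)" and g: "g \<in> Hom C (Cod C f) (Cod C g)"
    using assms by (auto simp: Hom_iff)
  note o = Dom_Obj[OF assms(1)] Cod_Obj[OF assms(2)] Cod_Obj[OF assms(1)]
  show "g \<cdot> Neg C f = Neg C (g \<cdot> f)"
    by (rule Neg_unique[symmetric, of _ "Dom C f" "Cod C g"])
      (use assms f o in \<open>simp_all add: Hom_iff flip: Cmp_Add_right[OF f Neg_Hom[OF f] g], simp add: Add_Neg_right[OF f]\<close>)
  show "Neg C g \<cdot> f = Neg C (g \<cdot> f)"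
    by (rule Neg_unique[symmetric, of _ "Dom C f" "Cod C g"])
      (use assms f o in \<open>simp_all add: Hom_iff flip: Cmp_Add_left[OF f g Neg_Hom[OF g]], simp add: Add_Neg_right[OF g]\<close>)
qed

lemma Neg_Zer [simp]: "a \<in> Obj C \<Longrightarrow> b \<in> Obj C \<Longrightarrow> Neg C (Zer C a b) = Zer C a b"
  by (rule Neg_unique[of _ a b]) (simp_all add: Zer_Hom Add_Zer_left)

text \<open>Equality of arrows is tested by the vanishing of their difference, the form in which
  exact sequences and kernels apply.\<close>

definition Sub where "Sub f g = Add C f (Neg C g)"

lemma Sub_simps [simp]:
  assumes "f \<in> Arr C" "g \<in> Arr C" "Dom C f = Dom C g" "Cod C f = Cod C g"
  shows "Sub f g \<in> Arr C" "Dom C (Sub f g) = Dom C g" "Cod C (Sub f g) = Cod C g"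
  using assms by (simp_all add: Sub_def)

lemma Sub_Hom: "f \<in> Hom C a b \<Longrightarrow> g \<in> Hom C a b \<Longrightarrow> Sub f g \<in> Hom C a b"
  by (simp add: Hom_iff)

lemma Sub_eq_Zer_iff:
  assumes "f \<in> Hom C a b" "g \<in> Hom C a b"
  shows "Sub f g = Zer C a b \<longleftrightarrow> f = g"
proof
  assume "Sub f g = Zer C a b"
  then have "Neg C f = Neg C g"
    unfolding Sub_def using assms by (intro Neg_unique[of f a b]) (auto intro: Neg_Hom)
  then have "Neg C (Neg C f) = Neg C (Neg C g)" by simp
  then show "f = g" using assms by (simp add: Hom_iff)
qed (use assms in \<open>simp add: Sub_def Add_Neg_right\<close>)

lemma Cmp_Sub:
  assumes "f \<in> Hom C a b" "f' \<in> Hom C a b" "g \<in> Hom C b c"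
  shows "g \<cdot> Sub f f' = Sub (g \<cdot> f) (g \<cdot> f')"
  using assms Cmp_Neg[of f' g] by (simp add: Sub_def Cmp_Add_right[OF assms(1) Neg_Hom[OF assms(2)] assms(3)] Hom_iff)

lemma Sub_Cmp:
  assumes "f \<in> Hom C a b" "g \<in> Hom C b c" "g' \<in> Hom C b c"
  shows "Sub g g' \<cdot> f = Sub (g \<cdot> f) (g' \<cdot> f)"
  using assms Cmp_Neg[of f g'] by (simp add: Sub_def Cmp_Add_left[OF assms(1,2) Neg_Hom[OF assms(3)]] Hom_iff)

lemma Add_Sub_cancel:
  assumes "f \<in> Hom C a b" "g \<in> Hom C a b"
  shows "Add C g (Sub f g) = f"
proof -
  have "Add C g (Sub f g) = Add C (Sub f g) g"
    using assms by (intro Add_commute) (auto intro: Sub_Hom)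
  also have "\<dots> = f"
    unfolding Sub_def using assms
    by (simp add: Add_assoc[OF assms(1) Neg_Hom[OF assms(2)] assms(2)] Add_Neg_left Add_Zer_right)
  finally show ?thesis .
qed

lemma Ide_Zer_Hom:
  assumes "z \<in> Obj C" "Ide C z = Zer C z z"
  shows "f \<in> Hom C a z \<Longrightarrow> f = Zer C a z" "f \<in> Hom C z a \<Longrightarrow> f = Zer C z a"
  using assms Cmp_Ide(2)[of f z] Cmp_Zer(2)[of f z z] Cmp_Ide(1)[of f z] Cmp_Zer(1)[of f z z]
  by (simp_all add: Hom_iff)

text \<open>An equation between two arrows is carried along by additive functors and read off in
  full subcategories, which the universal property does not allow directly.\<close>

lemma zero_object_iff: "zero_object C z \<longleftrightarrow> z \<in> Obj C \<and> Ide C z = Zer C z z"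
proof
  assume z: "zero_object C z"
  then have o: "z \<in> Obj C" and "\<exists>!f. f \<in> Hom C z z" by (simp_all add: zero_object_def)
  then obtain f where "\<forall>g. g \<in> Hom C z z \<longrightarrow> g = f" unfolding Ex1_def by (elim exE conjE) (rule that)
  from this[rule_format, OF Ide_Hom[OF o]] this[rule_format, OF Zer_Hom[OF o o]] o
  show "z \<in> Obj C \<and> Ide C z = Zer C z z" by simp
next
  assume z: "z \<in> Obj C \<and> Ide C z = Zer C z z"
  show "zero_object C z"
    unfolding zero_object_def
  proof (intro conjI ballI)
    fix a assume a: "a \<in> Obj C"
    show "\<exists>!f. f \<in> Hom C a z"
      by (rule ex1I[of _ "Zer C a z"], rule Zer_Hom, rule_tac [3] Ide_Zer_Hom(1)) (use a z in simp_all)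
    show "\<exists>!f. f \<in> Hom C z a"
      by (rule ex1I[of _ "Zer C z a"], rule Zer_Hom, rule_tac [3] Ide_Zer_Hom(2)) (use a z in simp_all)
  qed (use z in simp)
qed

lemma zero_object_Hom:
  assumes "zero_object C z"
  shows "f \<in> Hom C a z \<Longrightarrow> f = Zer C a z" "f \<in> Hom C z a \<Longrightarrow> f = Zer C z a"
  using assms Ide_Zer_Hom[of z f a] unfolding zero_object_iff by blast+

end

context additive_functor
begin

lemma F1_Zer:
  assumes "a \<in> Obj C" "b \<in> Obj C"
  shows "F1 (Zer C a b) = Zer D (F0 a) (F0 b)"
  by (rule D.Add_self_eq_imp_Zer[OF F1_Hom[OF C.Zer_Hom[OF assms]]])
    (simp add: C.Add_Zer_left[OF C.Zer_Hom[OF assms]] flip: F1_Add[OF C.Zer_Hom[OF assms] C.Zer_Hom[OF assms]])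

lemma F1_Neg:
  assumes "f \<in> Hom C a b"
  shows "F1 (Neg C f) = Neg D (F1 f)"
  by (rule D.Neg_unique[symmetric, OF F1_Hom[OF assms] F1_Hom[OF C.Neg_Hom[OF assms]]])
    (use assms C.Hom_Obj[OF assms] in \<open>simp add: F1_Zer C.Add_Neg_right flip: F1_Add[OF assms C.Neg_Hom[OF assms]]\<close>)

lemma F1_Sub:
  assumes "f \<in> Hom C a b" "g \<in> Hom C a b"
  shows "F1 (C.Sub f g) = D.Sub (F1 f) (F1 g)"
  using F1_Add[OF assms(1) C.Neg_Hom[OF assms(2)]] F1_Neg[OF assms(2)] by (simp add: C.Sub_def D.Sub_def)

lemma F0_zero_object: "zero_object C z \<Longrightarrow> zero_object D (F0 z)"
  by (auto simp: C.zero_object_iff D.zero_object_iff F0_Obj simp flip: F1_Zer F1_Ide)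

end

section \<open>Triangulated categories\<close>

text \<open>Bundles distinguishedness with explicit vertices, since \<open>Tri\<close> itself
  records only the three arrows.\<close>

definition tri :: "('o, 'm, 'z) tri_cat_scheme \<Rightarrow> 'm \<Rightarrow> 'm \<Rightarrow> 'm \<Rightarrow> 'o \<Rightarrow> 'o \<Rightarrow> 'o \<Rightarrow> bool" where
  "tri C f g h a b c \<longleftrightarrow> (f, g, h) \<in> Tri C \<and> is_triangle C f g h a b c"

lemma triD:
  assumes "tri C f g h a b c"
  shows "(f, g, h) \<in> Tri C" "is_triangle C f g h a b c"
    "f \<in> Hom C a b" "g \<in> Hom C b c" "h \<in> Hom C c (ShO C a)"
  using assms by (auto simp: tri_def is_triangle_def)

lemma triI:
  "\<lbrakk>(f, g, h) \<in> Tri C; f \<in> Hom C a b; g \<in> Hom C b c; h \<in> Hom C c (ShO C a)\<rbrakk> \<Longrightarrow> tri C f g h a b c"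
  by (simp add: tri_def is_triangle_def)

context triangulated_category
begin

lemma ShO_Obj [simp]: "a \<in> Obj C \<Longrightarrow> ShO C a \<in> Obj C"
  by (rule shift_equiv.F0_Obj)

lemmas ShA_simps [simp] = shift_equiv.F1_simps
lemmas ShA_Hom = shift_equiv.F1_Hom
lemmas ShA_Ide [simp] = shift_equiv.F1_Ide
lemmas ShA_Cmp = shift_equiv.F1_Cmp'

lemma ShA_Zer [simp]: "a \<in> Obj C \<Longrightarrow> b \<in> Obj C \<Longrightarrow> ShA C (Zer C a b) = Zer C (ShO C a) (ShO C b)"
  by (rule shift_add.F1_Zer)

lemma tri_Obj: "tri C f g h a b c \<Longrightarrow> a \<in> Obj C \<and> b \<in> Obj C \<and> c \<in> Obj C"
  by (intro conjI) (drule triD, erule Hom_Obj)+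

lemma tri_cone:
  assumes "f \<in> Hom C a b"
  obtains c g h where "tri C f g h a b c"
proof -
  obtain g h where t: "(f, g, h) \<in> Tri C" using TR1_cone[of f] assms by (auto simp: Hom_iff)
  then obtain a' b' c where "is_triangle C f g h a' b' c" using Tri_is_triangle by blast
  then have "tri C f g h a b c"
    using t assms by (auto simp: tri_def is_triangle_def Hom_iff)
  then show thesis by (rule that)
qed

lemma tri_rot_iff:
  assumes "f \<in> Hom C a b" "g \<in> Hom C b c" "h \<in> Hom C c (ShO C a)"
  shows "tri C g h (Neg C (ShA C f)) b c (ShO C a) \<longleftrightarrow> tri C f g h a b c"
proof -
  have "is_triangle C f g h a b c" using assms by (simp add: is_triangle_def)
  moreover have "is_triangle C g h (Neg C (ShA C f)) b c (ShO C a)"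
    using assms by (auto simp: is_triangle_def intro: Neg_Hom ShA_Hom)
  ultimately show ?thesis using TR2[of f g h a b c] by (simp add: tri_def)
qed

lemma tri_rot: "tri C f g h a b c \<Longrightarrow> tri C g h (Neg C (ShA C f)) b c (ShO C a)"
  by (simp add: tri_rot_iff triD(3-5))

lemma tri_iso:
  assumes "tri C f g h a b c"
    and "u \<in> Hom C a a'" "v \<in> Hom C b b'" "w \<in> Hom C c c'" "iso_arr C u" "iso_arr C v" "iso_arr C w"
    and "f' \<in> Hom C a' b'" "g' \<in> Hom C b' c'" "h' \<in> Hom C c' (ShO C a')"
    and "v \<cdot> f = f' \<cdot> u" "w \<cdot> g = g' \<cdot> v" "ShA C u \<cdot> h = h' \<cdot> w"
  shows "tri C f' g' h' a' b' c'"
proof -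
  have "is_triangle C f' g' h' a' b' c'" using assms(8-10) by (simp add: is_triangle_def)
  moreover from this have "triangle_iso C (f, g, h) (f', g', h')"
    unfolding triangle_iso_def prod.case using triD(2)[OF assms(1)] assms(2-7,11-13) by blast
  ultimately show ?thesis using TR1_iso triD(1)[OF assms(1)] by (auto simp: tri_def)
qed

lemma tri_Ide:
  assumes "a \<in> Obj C" "zero_object C z"
  shows "tri C (Ide C a) (Zer C a z) (Zer C z (ShO C a)) a a z"
  by (rule triI[OF TR1_Ide]) (use assms in \<open>simp_all add: Hom_iff zero_object_iff\<close>)

text \<open>The triangle on the identity, with \<open>ShO C z\<close> as zero object, is a rotation
  of the required one; \<open>tri_rot_iff\<close> rotates it back.\<close>

lemma tri_Zer_Ide:
  assumes "a \<in> Obj C" "zero_object C z"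
  shows "tri C (Zer C z a) (Ide C a) (Zer C a (ShO C z)) z a a"
  using tri_Ide[OF assms(1) shift_add.F0_zero_object[OF assms(2)]] assms
  by (subst tri_rot_iff[symmetric]) (auto simp: zero_object_iff Hom_iff)

section \<open>Exactness of Hom along a distinguished triangle\<close>

lemma tri_map:
  assumes "tri C f g h a b c" "tri C f' g' h' a' b' c'"
    and "u \<in> Hom C a a'" "v \<in> Hom C b b'" "v \<cdot> f = f' \<cdot> u"
  obtains w where "w \<in> Hom C c c'" "w \<cdot> g = g' \<cdot> v" "ShA C u \<cdot> h = h' \<cdot> w"
  using TR3[OF triD(1,2)[OF assms(1)] triD(1,2)[OF assms(2)] assms(3-5)] that by blast

text \<open>TR3 compares the given triangle with \<open>0 \<rightarrow> q \<rightarrow> q\<close>: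
  since \<open>u \<cdot> f\<close> is zero, \<open>u\<close> extends to a map of triangles whose
  last component is the factorisation through \<open>g\<close>.\<close>

lemma exact_right:
  assumes t: "tri C f g h a b c" and u: "u \<in> Hom C b q" "u \<cdot> f = Zer C a q"
  obtains v where "v \<in> Hom C c q" "v \<cdot> g = u"
proof -
  obtain z where z: "zero_object C z" using zero_object_exists by blast
  have o: "q \<in> Obj C" "a \<in> Obj C" "z \<in> Obj C" using Hom_Obj[OF u(1)] tri_Obj[OF t] z zero_object_iff by auto
  have "u \<cdot> f = Zer C z q \<cdot> Zer C a z" using u o by simp
  from tri_map[OF t tri_Zer_Ide[OF o(1) z] Zer_Hom[OF o(2,3)] u(1) this]
  obtain w where "w \<in> Hom C c q" "w \<cdot> g = Ide C q \<cdot> u" by blast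
  then show thesis using that[of w] u by (simp add: Hom_iff)
qed

text \<open>TR3 completes only the third component of a map of triangles. Both triangles are rotated
  so that the wanted arrow \<open>q \<rightarrow> a\<close> appears there as an arrow of the shifted
  objects; fullness of the shift takes it back.\<close>

lemma exact_left:
  assumes t: "tri C f g h a b c" and u: "u \<in> Hom C q b" "g \<cdot> u = Zer C q c"
  obtains v where "v \<in> Hom C q a" "f \<cdot> v = u"
proof -
  obtain z where z: "zero_object C z" using zero_object_exists by blast
  have o: "q \<in> Obj C" "a \<in> Obj C" "z \<in> Obj C" "c \<in> Obj C" using Hom_Obj[OF u(1)] tri_Obj[OF t] z zero_object_iff by auto
  have "Zer C z c \<cdot> Zer C q z = g \<cdot> u" using u o by simp
  from tri_map[OF tri_rot[OF tri_Ide[OF o(1) z]] tri_rot[OF t] u(1) Zer_Hom[OF o(3,4)] this]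
  obtain w where w: "w \<in> Hom C (ShO C q) (ShO C a)"
    "ShA C u \<cdot> Neg C (Ide C (ShO C q)) = Neg C (ShA C f) \<cdot> w"
    using o by auto
  obtain v where v: "v \<in> Hom C q a" "ShA C v = w"
    using shift_equiv.full[OF w(1) o(1,2)] by blast
  \<comment> \<open>Both sides carry the sign introduced by rotation; cancelling it and using
    faithfulness of the shift gives \<open>u = f \<cdot> v\<close>.\<close>
  have "Neg C (ShA C u) = Neg C (ShA C (f \<cdot> v))"
    using w u v triD(3)[OF t] o by (simp add: Hom_iff Cmp_Neg ShA_Cmp)
  then have "Neg C (Neg C (ShA C u)) = Neg C (Neg C (ShA C (f \<cdot> v)))" by (rule arg_cong)
  then have "ShA C u = ShA C (f \<cdot> v)" using u v triD(3)[OF t] by (simp add: Hom_iff)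
  then have "u = f \<cdot> v"
    by (rule shift_equiv.faithful[rotated 2]) (use u(1) v triD(3)[OF t] Cmp_Hom in auto)
  then show thesis using v that by blast
qed

lemma exact_left2:
  assumes "tri C f g h a b c" and "u \<in> Hom C q c" "h \<cdot> u = Zer C q (ShO C a)"
  obtains v where "v \<in> Hom C q b" "g \<cdot> v = u"
  using exact_left[OF tri_rot[OF assms(1)] assms(2,3)] .

text \<open>Rotating twice puts the negative of \<open>ShA C f\<close> after \<open>h\<close>, and
  an arrow and its negative annihilate the same \<open>u\<close>.\<close>

lemma exact_left3:
  assumes t: "tri C f g h a b c" and u: "u \<in> Hom C q (ShO C a)" "ShA C f \<cdot> u = Zer C q (ShO C b)"
  obtains v where "v \<in> Hom C q c" "h \<cdot> v = u"
proof -
  have "Neg C (ShA C f) \<cdot> u = Zer C q (ShO C b)"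
    using u triD(3)[OF t] tri_Obj[OF t] Hom_Obj[OF u(1)] by (simp add: Hom_iff Cmp_Neg)
  from exact_left[OF tri_rot[OF tri_rot[OF t]] u(1) this] show thesis using that by blast
qed

lemma exact_right2:
  assumes "tri C f g h a b c" and "u \<in> Hom C c q" "u \<cdot> g = Zer C b q"
  obtains v where "v \<in> Hom C (ShO C a) q" "v \<cdot> h = u"
  using exact_right[OF tri_rot[OF assms(1)] assms(2,3)] .

lemma exact_right3:
  assumes t: "tri C f g h a b c" and u: "u \<in> Hom C (ShO C a) q" "u \<cdot> h = Zer C c q"
  obtains v where "v \<in> Hom C (ShO C b) q" "v \<cdot> ShA C f = u"
proof -
  obtain v where v: "v \<in> Hom C (ShO C b) q" "v \<cdot> Neg C (ShA C f) = u"
    using exact_right[OF tri_rot[OF tri_rot[OF t]] u] .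
  show thesis
    by (rule that[OF Neg_Hom[OF v(1)]]) (use v triD(3)[OF t] in \<open>simp add: Hom_iff Cmp_Neg\<close>)
qed

text \<open>The identity triangle on \<open>a\<close> maps to the given one by \<open>f\<close>, so
  \<open>g \<cdot> f\<close> factors through a zero object; the other two vanishing composites come
  from rotations.\<close>

lemma tri_Cmp_Zer:
  assumes t: "tri C f g h a b c"
  shows "g \<cdot> f = Zer C a c" "h \<cdot> g = Zer C b (ShO C a)" "ShA C f \<cdot> h = Zer C c (ShO C b)"
proof -
  have *: "g \<cdot> f = Zer C a c" if t: "tri C f g h a b c" for f g h a b c
  proof -
    obtain z where z: "zero_object C z" using zero_object_exists by blast
    have o: "a \<in> Obj C" "z \<in> Obj C" using tri_Obj[OF t] z zero_object_iff by auto
    note f = triD(3)[OF t]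
    obtain w where w: "w \<in> Hom C z c" "w \<cdot> Zer C a z = g \<cdot> f"
      using tri_map[OF tri_Ide[OF o(1) z] t Ide_Hom[OF o(1)] f refl] .
    then show ?thesis using o by (simp add: Hom_iff)
  qed
  show "g \<cdot> f = Zer C a c" "h \<cdot> g = Zer C b (ShO C a)" using *[OF t] *[OF tri_rot[OF t]] by auto
  have "Neg C (ShA C f) \<cdot> h = Zer C c (ShO C b)" using *[OF tri_rot[OF tri_rot[OF t]]] .
  then have "Neg C (Neg C (ShA C f \<cdot> h)) = Neg C (Zer C c (ShO C b))"
    using triD(3,5)[OF t] by (simp add: Hom_iff Cmp_Neg)
  then show "ShA C f \<cdot> h = Zer C c (ShO C b)" using triD(3,5)[OF t] tri_Obj[OF t] by (simp add: Hom_iff)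
qed

lemma iso_arr_Neg_Ide: "a \<in> Obj C \<Longrightarrow> iso_arr C (Neg C (Ide C a))"
  by (rule iso_arrI[of _ a a "Neg C (Ide C a)"]) (simp_all add: Hom_iff Cmp_Neg)

text \<open>Three rotations give the shifted triangle with all signs negative. Negating the middle
  vertex cancels the signs of the first two arrows and leaves that of the third.\<close>

lemma tri_ShA:
  assumes t: "tri C f g h a b c"
  shows "tri C (ShA C f) (ShA C g) (Neg C (ShA C h)) (ShO C a) (ShO C b) (ShO C c)"
proof (rule tri_iso[OF tri_rot[OF tri_rot[OF tri_rot[OF t]]],
      of "Ide C (ShO C a)" _ "Neg C (Ide C (ShO C b))" _ "Ide C (ShO C c)"])
qed (use tri_Obj[OF t] triD(3-5)[OF t] in \<open>auto simp: Hom_iff Cmp_Neg intro: iso_arr_Ide iso_arr_Neg_Ide\<close>)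

text \<open>The shift is not assumed bijective on objects, so the cone \<open>d\<close> of
  \<open>g\<close> is first replaced by an isomorphic \<open>ShO C a\<close>. The arrow
  \<open>f\<close> is the preimage under the shift of the negated connecting arrow, so that one
  rotation of the result returns the cone triangle of \<open>g\<close>.\<close>

lemma tri_fibre:
  assumes g: "g \<in> Hom C b c"
  obtains a f h where "tri C f g h a b c"
proof -
  obtain d h k where t: "tri C g h k b c d" using tri_cone[OF g] .
  have d: "d \<in> Obj C" using tri_Obj[OF t] by simp
  from shift_equiv.essentially_surjective[OF d]
  obtain a i where a: "a \<in> Obj C" and i: "i \<in> Hom C (ShO C a) d" "iso_arr C i"
    by (auto simp: isomorphic_def)
  from iso_arr_inverse[OF i(2,1)] obtain j where j: "j \<in> Hom C d (ShO C a)"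
    "j \<cdot> i = Ide C (ShO C a)" "i \<cdot> j = Ide C d" "iso_arr C j" .
  have bc: "b \<in> Obj C" "c \<in> Obj C" using Hom_Obj[OF g] by auto
  have "k \<cdot> i \<in> Hom C (ShO C a) (ShO C b)" using triD(5)[OF t] i Cmp_Hom by blast
  then obtain f where f: "f \<in> Hom C a b" "ShA C f = Neg C (k \<cdot> i)"
    using shift_equiv.full[OF Neg_Hom a bc(1)] by blast
  have "tri C g (j \<cdot> h) (Neg C (ShA C f)) b c (ShO C a)"
    by (rule tri_iso[OF t Ide_Hom[OF bc(1)] Ide_Hom[OF bc(2)] j(1) iso_arr_Ide[OF bc(1)] iso_arr_Ide[OF bc(2)] j(4)])
      (use g f bc i j triD(3-5)[OF t] in \<open>auto simp: Hom_iff\<close>)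
  then have "tri C f g (j \<cdot> h) a b c"
    by (subst tri_rot_iff[symmetric]) (use g f j triD(4)[OF t] Cmp_Hom in auto)
  then show thesis by (rule that)
qed

text \<open>Vanishing of \<open>g\<close> lifts the identity of \<open>b\<close> to a right inverse
  \<open>v\<close>. The difference of \<open>v \<cdot> f\<close> and the identity is killed by
  \<open>f\<close>, so its shift factors through the zero object \<open>c\<close> and it
  vanishes.\<close>

lemma iso_of_zero_cone:
  assumes t: "tri C f g h a b c" and c: "zero_object C c"
  shows "iso_arr C f"
proof -
  note f = triD(3)[OF t] and o = tri_Obj[OF t]
  have "g \<cdot> Ide C b = Zer C b c" using zero_object_Hom(1)[OF c triD(4)[OF t]] o by simp
  from exact_left[OF t Ide_Hom this] o obtain v where v: "v \<in> Hom C b a" "f \<cdot> v = Ide C b" by blast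
  have vf: "v \<cdot> f \<in> Hom C a a" using v f Cmp_Hom by blast
  define d where "d = Sub (v \<cdot> f) (Ide C a)"
  have d: "d \<in> Hom C a a" unfolding d_def using vf o by (auto intro: Sub_Hom Ide_Hom)
  have "f \<cdot> d = Sub (f \<cdot> (v \<cdot> f)) (f \<cdot> Ide C a)"
    unfolding d_def by (rule Cmp_Sub[OF vf _ f]) (use o Ide_Hom in auto)
  also have "\<dots> = Sub f f" using f v o by (simp add: Hom_iff reassoc[OF v(2)])
  also have "\<dots> = Zer C a b" using Sub_eq_Zer_iff[OF f f] by simp
  finally have "ShA C f \<cdot> ShA C d = Zer C (ShO C a) (ShO C b)"
    using d f o by (simp add: Hom_iff flip: ShA_Cmp)
  from exact_left3[OF t ShA_Hom[OF d] this]
  obtain k where k: "k \<in> Hom C (ShO C a) c" "h \<cdot> k = ShA C d" by blast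
  have "ShA C d = ShA C (Zer C a a)"
    using k zero_object_Hom(1)[OF c k(1)] triD(5)[OF t] o by (simp add: Hom_iff)
  then have "d = Zer C a a" using shift_equiv.faithful[OF d Zer_Hom] o by blast
  then have "v \<cdot> f = Ide C a" using Sub_eq_Zer_iff[OF vf Ide_Hom] o by (simp add: d_def)
  then show ?thesis using iso_arrI[OF f v(1)] v(2) by blast
qed

end

section \<open>Thick subcategories and perpendicular categories\<close>

lemma cone_in_iff: "s \<in> cone_in C S \<longleftrightarrow> (\<exists>g h a b c. c \<in> S \<and> tri C s g h a b c)"
  unfolding cone_in_def tri_def by blast

lemma cone_inI: "tri C s g h a b c \<Longrightarrow> c \<in> S \<Longrightarrow> s \<in> cone_in C S"
  unfolding cone_in_iff by blast

lemma cone_inE: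
  assumes "s \<in> cone_in C S" "s \<in> Hom C a b"
  obtains g h c where "c \<in> S" "tri C s g h a b c"
  using assms unfolding cone_in_iff tri_def is_triangle_def Hom_def by auto

lemma cone_in_mono: "s \<in> cone_in C S \<Longrightarrow> S \<subseteq> S' \<Longrightarrow> s \<in> cone_in C S'"
  unfolding cone_in_iff by blast

lemma cone_in_Arr: "s \<in> cone_in C S \<Longrightarrow> s \<in> Arr C"
  unfolding cone_in_iff tri_def is_triangle_def Hom_def by auto

text \<open>The condition on \<open>X\<close> under which its perpendiculars are shown to be thick;
  it can be verified for \<open>X\<close> before \<open>X\<close> itself is known to be thick.
  Closure under isomorphism makes up for a shift that is only essentially surjective.\<close>

definition shift_closed :: "('o, 'm, 'z) tri_cat_scheme \<Rightarrow> 'o set \<Rightarrow> bool" where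
  "shift_closed C X \<longleftrightarrow> X \<subseteq> Obj C \<and> (\<forall>a\<in>Obj C. ShO C a \<in> X \<longleftrightarrow> a \<in> X) \<and>
     (\<forall>a\<in>X. \<forall>b. isomorphic C a b \<longrightarrow> b \<in> X)"

lemma thickD:
  assumes "thick C S"
  shows "S \<subseteq> Obj C" "S \<noteq> {}" "a \<in> Obj C \<Longrightarrow> ShO C a \<in> S \<longleftrightarrow> a \<in> S"
    "tri C f g h a b c \<Longrightarrow> a \<in> S \<Longrightarrow> b \<in> S \<Longrightarrow> c \<in> S"
    "p \<in> S \<Longrightarrow> a \<in> Obj C \<Longrightarrow> b \<in> Obj C \<Longrightarrow> biproduct C a b p i j q r \<Longrightarrow> a \<in> S"
  using assms unfolding thick_def tri_def by blast+

lemma thick_Int: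
  assumes "thick C S" "thick C S'" "S \<inter> S' \<noteq> {}"
  shows "thick C (S \<inter> S')"
  unfolding thick_def
proof (intro conjI ballI allI impI)
  fix f g h a b c
  assume "(f, g, h) \<in> Tri C" "is_triangle C f g h a b c" and ab: "a \<in> S \<inter> S'" "b \<in> S \<inter> S'"
  then have "tri C f g h a b c" by (simp add: tri_def)
  then show "c \<in> S \<inter> S'" using thickD(4)[OF assms(1)] thickD(4)[OF assms(2)] ab by blast
next
  fix p a b i j q r
  assume "p \<in> S \<inter> S'" "a \<in> Obj C" "b \<in> Obj C" "biproduct C a b p i j q r"
  then show "a \<in> S \<inter> S'" using thickD(5)[OF assms(1)] thickD(5)[OF assms(2)] by blast
qed (use thickD(1)[OF assms(1)] thickD(3)[OF assms(1)] thickD(3)[OF assms(2)] assms(3) in blast)+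

context triangulated_category
begin

lemma thick_zero:
  assumes "thick C S" "zero_object C z"
  shows "z \<in> S"
proof -
  obtain p where p: "p \<in> S" "p \<in> Obj C" using thickD(1,2)[OF assms(1)] by blast
  show ?thesis using thickD(4)[OF assms(1) tri_Ide[OF p(2) assms(2)] p(1) p(1)] .
qed

lemma thick_iso:
  assumes S: "thick C S" and p: "p \<in> S" "isomorphic C p b"
  shows "b \<in> S"
proof -
  obtain z where z: "zero_object C z" using zero_object_exists by blast
  obtain q where q: "q \<in> Hom C p b" "iso_arr C q" using p by (auto simp: isomorphic_def)
  from iso_arr_inverse[OF q(2,1)] obtain i where i: "i \<in> Hom C b p" "i \<cdot> q = Ide C p" "q \<cdot> i = Ide C b" .
  have o: "p \<in> Obj C" "b \<in> Obj C" "z \<in> Obj C" using Hom_Obj[OF q(1)] z by (auto simp: zero_object_iff)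
  have "biproduct C b z p i (Zer C z p) q (Zer C p z)"
    using i q o z unfolding biproduct_def by (simp add: Hom_iff zero_object_iff Add_Zer_right[OF Ide_Hom])
  then show ?thesis using thickD(5)[OF S p(1) o(2,3)] by blast
qed

lemma thick_shift_closed: "thick C S \<Longrightarrow> shift_closed C S"
  unfolding shift_closed_def using thick_iso by (simp add: thickD(1,3))

lemma thick_tri:
  assumes S: "thick C S" and t: "tri C f g h a b c"
  shows "a \<in> S \<Longrightarrow> b \<in> S \<Longrightarrow> c \<in> S" "b \<in> S \<Longrightarrow> c \<in> S \<Longrightarrow> a \<in> S" "a \<in> S \<Longrightarrow> c \<in> S \<Longrightarrow> b \<in> S"
  using thickD(4)[OF S t] thickD(4)[OF S tri_rot[OF t]] thickD(4)[OF S tri_rot[OF tri_rot[OF t]]]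
    thickD(3)[OF S] tri_Obj[OF t] by blast+

section \<open>Arrows with cone in a thick subcategory\<close>

lemma cone_in_Ide: "thick C S \<Longrightarrow> a \<in> Obj C \<Longrightarrow> Ide C a \<in> cone_in C S"
  using zero_object_exists thick_zero cone_inI[OF tri_Ide] by blast

text \<open>The octahedral axiom places the cone of the composite in a triangle between the cones of
  \<open>f\<close> and of \<open>g\<close>.\<close>

lemma cone_in_Cmp:
  assumes S: "thick C S" and f: "f \<in> cone_in C S" "f \<in> Hom C a b" and g: "g \<in> cone_in C S" "g \<in> Hom C b c"
  shows "g \<cdot> f \<in> cone_in C S"
proof -
  obtain f1 f2 x where x: "x \<in> S" "tri C f f1 f2 a b x" using cone_inE[OF f] .
  obtain g1 g2 y where y: "y \<in> S" "tri C g g1 g2 b c y" using cone_inE[OF g] .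
  obtain h1 h2 z where z: "tri C (g \<cdot> f) h1 h2 a c z" using tri_cone[OF Cmp_Hom[OF f(2) g(2)]] .
  obtain u v where "u \<in> Hom C x z" "v \<in> Hom C z y" "(u, v, ShA C f1 \<cdot> g2) \<in> Tri C"
    using TR4[OF triD(1,2)[OF x(2)] triD(1,2)[OF y(2)] triD(1,2)[OF z]] by blast
  moreover have "ShA C f1 \<cdot> g2 \<in> Hom C y (ShO C x)"
    using triD(5)[OF y(2)] triD(4)[OF x(2)] ShA_Hom Cmp_Hom by blast
  ultimately have "tri C u v (ShA C f1 \<cdot> g2) x z y" by (intro triI)
  then have "z \<in> S" using thick_tri(3)[OF S] x y by blast
  then show ?thesis by (rule cone_inI[OF z])
qed

lemma cone_in_ShA:
  assumes "thick C S" "s \<in> cone_in C S"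
  shows "ShA C s \<in> cone_in C S"
proof -
  obtain g h a b c where c: "c \<in> S" and t: "tri C s g h a b c" using assms(2) unfolding cone_in_iff by blast
  then show ?thesis using cone_inI[OF tri_ShA[OF t]] thickD(3)[OF assms(1)] tri_Obj[OF t] by blast
qed

text \<open>\<open>u\<close> is the fibre of the composite of \<open>f\<close> with the map from
  \<open>b\<close> to the cone \<open>c\<close> of \<open>t\<close>, so it has that same cone
  \<open>c\<close>. By construction \<open>f \<cdot> u\<close> dies in \<open>c\<close> and hence
  factors through \<open>t\<close>.\<close>

lemma Ore:
  assumes "t \<in> cone_in C S" "t \<in> Hom C b' b" "f \<in> Hom C a b"
  obtains d u k where "u \<in> cone_in C S" "u \<in> Hom C d a" "k \<in> Hom C d b'" "f \<cdot> u = t \<cdot> k"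
proof -
  obtain g h c where c: "c \<in> S" and t: "tri C t g h b' b c" using cone_inE[OF assms(1,2)] .
  have gf: "g \<cdot> f \<in> Hom C a c" using triD(4)[OF t] assms(3) Cmp_Hom by blast
  obtain d u k where u: "tri C u (g \<cdot> f) k d a c" using tri_fibre[OF gf] .
  have fu: "f \<cdot> u \<in> Hom C d b" using triD(3)[OF u] assms(3) Cmp_Hom by blast
  have "g \<cdot> (f \<cdot> u) = Zer C d c"
    using tri_Cmp_Zer(1)[OF u] triD(4)[OF t] triD(3)[OF u] assms(3) by (simp add: Hom_iff)
  from exact_left[OF t fu this] obtain k' where "k' \<in> Hom C d b'" "t \<cdot> k' = f \<cdot> u" .
  then show thesis using that[of u d k'] cone_inI[OF u c] triD(3)[OF u] by simp
qed

section \<open>Perpendicular categories are thick\<close>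

lemma right_perp_iff:
  assumes "X \<subseteq> Obj C"
  shows "t \<in> right_perp C X \<longleftrightarrow> t \<in> Obj C \<and> (\<forall>x\<in>X. \<forall>f\<in>Hom C x t. f = Zer C x t)"
  unfolding right_perp_def hom_vanish_def using Zer_Hom assms by blast

lemma left_perp_iff:
  assumes "X \<subseteq> Obj C"
  shows "t \<in> left_perp C X \<longleftrightarrow> t \<in> Obj C \<and> (\<forall>x\<in>X. \<forall>f\<in>Hom C t x. f = Zer C t x)"
  unfolding left_perp_def hom_vanish_def using Zer_Hom assms by blast

lemma shift_closedD:
  assumes "shift_closed C X"
  shows "X \<subseteq> Obj C" "a \<in> Obj C \<Longrightarrow> ShO C a \<in> X \<longleftrightarrow> a \<in> X" "a \<in> X \<Longrightarrow> isomorphic C a b \<Longrightarrow> b \<in> X"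
  using assms unfolding shift_closed_def by blast+

text \<open>Stand-in for the inverse shift: an object of \<open>X\<close> is exhibited, with
  explicit inverse arrows, as a shift of another object of \<open>X\<close>.\<close>

lemma shift_closed_unshift:
  assumes "shift_closed C X" "x \<in> X"
  obtains y i j where "y \<in> X" "i \<in> Hom C (ShO C y) x" "j \<in> Hom C x (ShO C y)"
    "i \<cdot> j = Ide C x" "j \<cdot> i = Ide C (ShO C y)"
proof -
  have x: "x \<in> Obj C" using shift_closedD(1)[OF assms(1)] assms(2) by blast
  obtain y where y: "y \<in> Obj C" "isomorphic C (ShO C y) x"
    using shift_equiv.essentially_surjective[OF x] by blast
  then have "y \<in> X" using shift_closedD(2,3)[OF assms(1)] isomorphic_sym assms(2) by blast
  moreover obtain i where i: "i \<in> Hom C (ShO C y) x" "iso_arr C i" using y by (auto simp: isomorphic_def)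
  ultimately show thesis using iso_arr_inverse[OF i(2,1)] that i by metis
qed

text \<open>Full faithfulness of the shift identifies arrows \<open>x \<rightarrow> t\<close> with
  arrows between the shifts; an arrow from \<open>x\<close> to \<open>ShO C t\<close> is first
  precomposed with an isomorphism from the shift of some \<open>y\<close> in
  \<open>X\<close>.\<close>

lemma right_perp_shift:
  assumes X: "shift_closed C X" and t: "t \<in> Obj C"
  shows "ShO C t \<in> right_perp C X \<longleftrightarrow> t \<in> right_perp C X"
proof
  note P = right_perp_iff[OF shift_closedD(1)[OF X]]
  have XO: "x \<in> Obj C" if "x \<in> X" for x using that shift_closedD(1)[OF X] by blast
  assume s: "ShO C t \<in> right_perp C X"
  show "t \<in> right_perp C X"
    unfolding P
  proof (intro conjI ballI t)
    fix x f assume x: "x \<in> X" and f: "f \<in> Hom C x t"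
    have "ShA C f = Zer C (ShO C x) (ShO C t)"
      using s[unfolded P] ShA_Hom[OF f] shift_closedD(2)[OF X XO[OF x]] x by blast
    then have "ShA C f = ShA C (Zer C x t)" using XO[OF x] t by simp
    then show "f = Zer C x t" using shift_equiv.faithful[OF f Zer_Hom[OF XO[OF x] t]] by blast
  qed
next
  note P = right_perp_iff[OF shift_closedD(1)[OF X]]
  have XO: "x \<in> Obj C" if "x \<in> X" for x using that shift_closedD(1)[OF X] by blast
  assume s: "t \<in> right_perp C X"
  show "ShO C t \<in> right_perp C X"
    unfolding P
  proof (intro conjI ballI)
    fix x f assume x: "x \<in> X" and f: "f \<in> Hom C x (ShO C t)"
    obtain y i j where y: "y \<in> X" and i: "i \<in> Hom C (ShO C y) x" "j \<in> Hom C x (ShO C y)" "i \<cdot> j = Ide C x"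
      using shift_closed_unshift[OF X x] .
    obtain k where k: "k \<in> Hom C y t" "ShA C k = f \<cdot> i"
      using shift_equiv.full[OF Cmp_Hom[OF i(1) f] XO[OF y] t] .
    have "k = Zer C y t" using s[unfolded P] k(1) y by blast
    then have "f \<cdot> i = Zer C (ShO C y) (ShO C t)" using k XO[OF y] t by simp
    then have "(f \<cdot> i) \<cdot> j = Zer C (ShO C y) (ShO C t) \<cdot> j" by simp
    then show "f = Zer C x (ShO C t)" using f i XO[OF x] t by (simp add: Hom_iff)
  qed (use t in simp)
qed

text \<open>Dual to the right-hand case: the isomorphism with a shift is now composed at the
  target.\<close>

lemma left_perp_shift:
  assumes X: "shift_closed C X" and t: "t \<in> Obj C"
  shows "ShO C t \<in> left_perp C X \<longleftrightarrow> t \<in> left_perp C X"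
proof
  note P = left_perp_iff[OF shift_closedD(1)[OF X]]
  have XO: "x \<in> Obj C" if "x \<in> X" for x using that shift_closedD(1)[OF X] by blast
  assume s: "ShO C t \<in> left_perp C X"
  show "t \<in> left_perp C X"
    unfolding P
  proof (intro conjI ballI t)
    fix x f assume x: "x \<in> X" and f: "f \<in> Hom C t x"
    have "ShA C f = Zer C (ShO C t) (ShO C x)"
      using s[unfolded P] ShA_Hom[OF f] shift_closedD(2)[OF X XO[OF x]] x by blast
    then have "ShA C f = ShA C (Zer C t x)" using XO[OF x] t by simp
    then show "f = Zer C t x" using shift_equiv.faithful[OF f Zer_Hom[OF t XO[OF x]]] by blast
  qed
next
  note P = left_perp_iff[OF shift_closedD(1)[OF X]]
  have XO: "x \<in> Obj C" if "x \<in> X" for x using that shift_closedD(1)[OF X] by blast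
  assume s: "t \<in> left_perp C X"
  show "ShO C t \<in> left_perp C X"
    unfolding P
  proof (intro conjI ballI)
    fix x f assume x: "x \<in> X" and f: "f \<in> Hom C (ShO C t) x"
    obtain y i j where y: "y \<in> X" and i: "i \<in> Hom C (ShO C y) x" "j \<in> Hom C x (ShO C y)" "i \<cdot> j = Ide C x"
      using shift_closed_unshift[OF X x] .
    obtain k where k: "k \<in> Hom C t y" "ShA C k = j \<cdot> f"
      using shift_equiv.full[OF Cmp_Hom[OF f i(2)] t XO[OF y]] .
    have "k = Zer C t y" using s[unfolded P] k(1) y by blast
    then have "j \<cdot> f = Zer C (ShO C t) (ShO C y)" using k XO[OF y] t by simp
    then have "i \<cdot> (j \<cdot> f) = i \<cdot> Zer C (ShO C t) (ShO C y)" by simp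
    then show "f = Zer C (ShO C t) x" using f i XO[OF x] t by (simp add: Hom_iff reassoc[OF i(3)])
  qed (use t in simp)
qed

text \<open>For a triangle with \<open>a\<close> and \<open>b\<close> in the perpendicular, an arrow
  from \<open>X\<close> to \<open>c\<close> dies in \<open>ShO C a\<close>, hence lifts to
  \<open>b\<close>, where it is zero. A summand is a retract, so its arrows from \<open>X\<close>
  embed into those of \<open>p\<close>.\<close>

lemma right_perp_thick:
  assumes X: "shift_closed C X"
  shows "thick C (right_perp C X)"
  unfolding thick_def
proof (intro conjI ballI allI impI)
  note P = right_perp_iff[OF shift_closedD(1)[OF X]]
  have XO: "x \<in> Obj C" if "x \<in> X" for x using that shift_closedD(1)[OF X] by blast
  show "right_perp C X \<subseteq> Obj C" unfolding right_perp_def by blast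
  obtain z where z: "zero_object C z" using zero_object_exists by blast
  then have "z \<in> right_perp C X" unfolding P using zero_object_Hom(1)[OF z] by (simp add: zero_object_iff)
  then show "right_perp C X \<noteq> {}" by blast
  show "ShO C a \<in> right_perp C X \<longleftrightarrow> a \<in> right_perp C X" if "a \<in> Obj C" for a
    using right_perp_shift[OF X that] .
  fix f g h a b c
  assume t: "(f, g, h) \<in> Tri C" "is_triangle C f g h a b c"
    and a: "a \<in> right_perp C X" and b: "b \<in> right_perp C X"
  then have t: "tri C f g h a b c" by (simp add: tri_def)
  note o = tri_Obj[OF t]
  have a': "ShO C a \<in> right_perp C X" using right_perp_shift[OF X] a o by blast
  show "c \<in> right_perp C X"
    unfolding P
  proof (intro conjI ballI)
    fix x u assume x: "x \<in> X" and u: "u \<in> Hom C x c"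
    have "h \<cdot> u = Zer C x (ShO C a)" using a'[unfolded P] x Cmp_Hom[OF u triD(5)[OF t]] by blast
    from exact_left2[OF t u this] obtain v where v: "v \<in> Hom C x b" "g \<cdot> v = u" .
    have "v = Zer C x b" using b[unfolded P] x v(1) by blast
    then show "u = Zer C x c" using v(2) triD(4)[OF t] XO[OF x] by (auto simp: Hom_iff)
  qed (use o in blast)
next
  note P = right_perp_iff[OF shift_closedD(1)[OF X]]
  have XO: "x \<in> Obj C" if "x \<in> X" for x using that shift_closedD(1)[OF X] by blast
  fix p a b i j q r
  assume p: "p \<in> right_perp C X" and o: "a \<in> Obj C" "b \<in> Obj C" and bi: "biproduct C a b p i j q r"
  then have i: "i \<in> Hom C a p" "q \<in> Hom C p a" "q \<cdot> i = Ide C a" by (auto simp: biproduct_def)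
  show "a \<in> right_perp C X"
    unfolding P
  proof (intro conjI ballI o(1))
    fix x u assume x: "x \<in> X" and u: "u \<in> Hom C x a"
    have "i \<cdot> u = Zer C x p" using p[unfolded P] x Cmp_Hom[OF u i(1)] by blast
    then have "q \<cdot> (i \<cdot> u) = q \<cdot> Zer C x p" by simp
    then show "u = Zer C x a" using u i XO[OF x] by (simp add: Hom_iff reassoc[OF i(3)])
  qed
qed

text \<open>Here an arrow \<open>c \<rightarrow> x\<close> restricts to zero on \<open>b\<close>,
  hence factors through the connecting arrow and an arrow out of \<open>ShO C a\<close>, which is
  zero because the perpendicular is closed under the shift.\<close>

lemma left_perp_thick:
  assumes X: "shift_closed C X"
  shows "thick C (left_perp C X)"
  unfolding thick_def
proof (intro conjI ballI allI impI)
  note P = left_perp_iff[OF shift_closedD(1)[OF X]]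
  have XO: "x \<in> Obj C" if "x \<in> X" for x using that shift_closedD(1)[OF X] by blast
  show "left_perp C X \<subseteq> Obj C" unfolding left_perp_def by blast
  obtain z where z: "zero_object C z" using zero_object_exists by blast
  then have "z \<in> left_perp C X" unfolding P using zero_object_Hom(2)[OF z] by (simp add: zero_object_iff)
  then show "left_perp C X \<noteq> {}" by blast
  show "ShO C a \<in> left_perp C X \<longleftrightarrow> a \<in> left_perp C X" if "a \<in> Obj C" for a
    using left_perp_shift[OF X that] .
  fix f g h a b c
  assume t: "(f, g, h) \<in> Tri C" "is_triangle C f g h a b c"
    and a: "a \<in> left_perp C X" and b: "b \<in> left_perp C X"
  then have t: "tri C f g h a b c" by (simp add: tri_def)
  note o = tri_Obj[OF t]
  have a': "ShO C a \<in> left_perp C X" using left_perp_shift[OF X] a o by blast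
  show "c \<in> left_perp C X"
    unfolding P
  proof (intro conjI ballI)
    fix x u assume x: "x \<in> X" and u: "u \<in> Hom C c x"
    have "u \<cdot> g = Zer C b x" using b[unfolded P] x Cmp_Hom[OF triD(4)[OF t] u] by blast
    from exact_right2[OF t u this] obtain v where v: "v \<in> Hom C (ShO C a) x" "v \<cdot> h = u" .
    have "v = Zer C (ShO C a) x" using a'[unfolded P] x v(1) by blast
    then show "u = Zer C c x" using v(2) triD(5)[OF t] XO[OF x] by (auto simp: Hom_iff)
  qed (use o in blast)
next
  note P = left_perp_iff[OF shift_closedD(1)[OF X]]
  have XO: "x \<in> Obj C" if "x \<in> X" for x using that shift_closedD(1)[OF X] by blast
  fix p a b i j q r
  assume p: "p \<in> left_perp C X" and o: "a \<in> Obj C" "b \<in> Obj C" and bi: "biproduct C a b p i j q r"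
  then have i: "i \<in> Hom C a p" "q \<in> Hom C p a" "q \<cdot> i = Ide C a" by (auto simp: biproduct_def)
  show "a \<in> left_perp C X"
    unfolding P
  proof (intro conjI ballI o(1))
    fix x u assume x: "x \<in> X" and u: "u \<in> Hom C a x"
    have "u \<cdot> q = Zer C p x" using p[unfolded P] x Cmp_Hom[OF i(2) u] by blast
    then have "(u \<cdot> q) \<cdot> i = Zer C p x \<cdot> i" by simp
    then show "u = Zer C a x" using u i XO[OF x] by (simp add: Hom_iff)
  qed
qed

end

section \<open>Local and colocal arrows\<close>

text \<open>Bijectivity of \<open>Hom(w, s)\<close> and of \<open>Hom(s, z)\<close>, with injectivity expressed by the kernel.\<close>

definition colocal :: "('o, 'm, 'z) tri_cat_scheme \<Rightarrow> 'o set \<Rightarrow> 'm \<Rightarrow> bool" where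
  "colocal C V s \<longleftrightarrow> s \<in> Arr C \<and>
     (\<forall>w\<in>V. \<forall>k \<in> Hom C w (Dom C s). s \<cdot>\<^bsub>C\<^esub> k = Zer C w (Cod C s) \<longrightarrow> k = Zer C w (Dom C s)) \<and>
     (\<forall>w\<in>V. \<forall>u \<in> Hom C w (Cod C s). \<exists>k \<in> Hom C w (Dom C s). s \<cdot>\<^bsub>C\<^esub> k = u)"

definition local :: "('o, 'm, 'z) tri_cat_scheme \<Rightarrow> 'o set \<Rightarrow> 'm \<Rightarrow> bool" where
  "local C W s \<longleftrightarrow> s \<in> Arr C \<and>
     (\<forall>z\<in>W. \<forall>k \<in> Hom C (Cod C s) z. k \<cdot>\<^bsub>C\<^esub> s = Zer C (Dom C s) z \<longrightarrow> k = Zer C (Cod C s) z) \<and>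
     (\<forall>z\<in>W. \<forall>u \<in> Hom C (Dom C s) z. \<exists>k \<in> Hom C (Cod C s) z. k \<cdot>\<^bsub>C\<^esub> s = u)"

context triangulated_category
begin

lemma colocal_zero:
  assumes "colocal C V s" "s \<in> Hom C b c" "w \<in> V" "k \<in> Hom C w b" "s \<cdot> k = Zer C w c"
  shows "k = Zer C w b"
  using assms by (auto simp: colocal_def Hom_iff)

lemma colocal_surj:
  assumes "colocal C V s" "s \<in> Hom C b c" "w \<in> V" "u \<in> Hom C w c"
  obtains k where "k \<in> Hom C w b" "s \<cdot> k = u"
proof -
  have "Dom C s = b" "Cod C s = c" using assms(2) by (auto simp: Hom_iff)
  then have "\<exists>k \<in> Hom C w b. s \<cdot> k = u" using assms(1,3,4) unfolding colocal_def by metis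
  then show thesis using that by blast
qed

text \<open>The definition mentions only the kernel; passing to the difference of \<open>k\<close>
  and \<open>k'\<close> upgrades it to injectivity.\<close>

lemma colocal_inj:
  assumes s: "colocal C V s" "s \<in> Hom C b c" "w \<in> V" and k: "k \<in> Hom C w b" "k' \<in> Hom C w b" "s \<cdot> k = s \<cdot> k'"
  shows "k = k'"
proof -
  have "s \<cdot> Sub k k' = Sub (s \<cdot> k) (s \<cdot> k')" by (rule Cmp_Sub[OF k(1,2) s(2)])
  also have "\<dots> = Zer C w c" using Sub_eq_Zer_iff Cmp_Hom[OF k(1) s(2)] Cmp_Hom[OF k(2) s(2)] k(3) by simp
  finally have "Sub k k' = Zer C w b" by (rule colocal_zero[OF s Sub_Hom[OF k(1,2)]])
  then show ?thesis using Sub_eq_Zer_iff[OF k(1,2)] by simp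
qed

lemma local_zero:
  assumes "local C W s" "s \<in> Hom C b c" "z \<in> W" "k \<in> Hom C c z" "k \<cdot> s = Zer C b z"
  shows "k = Zer C c z"
  using assms by (auto simp: local_def Hom_iff)

lemma local_surj:
  assumes "local C W s" "s \<in> Hom C b c" "z \<in> W" "u \<in> Hom C b z"
  obtains k where "k \<in> Hom C c z" "k \<cdot> s = u"
proof -
  have "Dom C s = b" "Cod C s = c" using assms(2) by (auto simp: Hom_iff)
  then have "\<exists>k \<in> Hom C c z. k \<cdot> s = u" using assms(1,3,4) unfolding local_def by metis
  then show thesis using that by blast
qed

lemma local_inj:
  assumes s: "local C W s" "s \<in> Hom C b c" "z \<in> W" and k: "k \<in> Hom C c z" "k' \<in> Hom C c z" "k \<cdot> s = k' \<cdot> s"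
  shows "k = k'"
proof -
  have "Sub k k' \<cdot> s = Sub (k \<cdot> s) (k' \<cdot> s)" by (rule Sub_Cmp[OF s(2) k(1,2)])
  also have "\<dots> = Zer C b z" using Sub_eq_Zer_iff Cmp_Hom[OF s(2) k(1)] Cmp_Hom[OF s(2) k(2)] k(3) by simp
  finally have "Sub k k' = Zer C c z" by (rule local_zero[OF s Sub_Hom[OF k(1,2)]])
  then show ?thesis using Sub_eq_Zer_iff[OF k(1,2)] by simp
qed

lemma colocalI:
  assumes "s \<in> Hom C b c"
    and "\<And>w k. w \<in> V \<Longrightarrow> k \<in> Hom C w b \<Longrightarrow> s \<cdot> k = Zer C w c \<Longrightarrow> k = Zer C w b"
    and "\<And>w u. w \<in> V \<Longrightarrow> u \<in> Hom C w c \<Longrightarrow> \<exists>k \<in> Hom C w b. s \<cdot> k = u"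
  shows "colocal C V s"
  using assms(1) assms(2,3)[rule_format] unfolding colocal_def Hom_iff[of s] by blast

lemma localI:
  assumes "s \<in> Hom C b c"
    and "\<And>z k. z \<in> W \<Longrightarrow> k \<in> Hom C c z \<Longrightarrow> k \<cdot> s = Zer C b z \<Longrightarrow> k = Zer C c z"
    and "\<And>z u. z \<in> W \<Longrightarrow> u \<in> Hom C b z \<Longrightarrow> \<exists>k \<in> Hom C c z. k \<cdot> s = u"
  shows "local C W s"
  using assms(1) assms(2,3)[rule_format] unfolding local_def Hom_iff[of s] by blast

text \<open>The long exact sequence of Hom from \<open>w\<close> encloses the map induced by
  \<open>s\<close> between Hom into \<open>d\<close> and Hom into the inverse shift of
  \<open>d\<close>. The latter is expressed, without an inverse shift, as Hom from
  \<open>ShO C w\<close> into \<open>d\<close>, and \<open>ShO C w\<close> also lies in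
  \<open>V\<close>.\<close>

lemma colocal_of_cone:
  assumes V: "shift_closed C V" and t: "tri C s g h b c d" and d: "d \<in> right_perp C V"
  shows "colocal C V s"
proof (rule colocalI[OF triD(3)[OF t]])
  note P = right_perp_iff[OF shift_closedD(1)[OF V]] and s = triD(3)[OF t] and o = tri_Obj[OF t]
  have VO: "w \<in> Obj C" if "w \<in> V" for w using that shift_closedD(1)[OF V] by blast
  fix w k assume w: "w \<in> V" and k: "k \<in> Hom C w b" "s \<cdot> k = Zer C w c"
  have "ShA C s \<cdot> ShA C k = Zer C (ShO C w) (ShO C c)"
    using k s VO[OF w] o by (simp add: Hom_iff flip: ShA_Cmp)
  from exact_left3[OF t ShA_Hom[OF k(1)] this] obtain m where m: "m \<in> Hom C (ShO C w) d" "h \<cdot> m = ShA C k" .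
  have "m = Zer C (ShO C w) d" using d[unfolded P] m(1) shift_closedD(2)[OF V VO[OF w]] w by blast
  then have "ShA C k = ShA C (Zer C w b)" using m(2) triD(5)[OF t] VO[OF w] o by (simp add: Hom_iff)
  then show "k = Zer C w b" using shift_equiv.faithful[OF k(1) Zer_Hom] VO[OF w] o by blast
next
  note P = right_perp_iff[OF shift_closedD(1)[OF V]]
  fix w u assume w: "w \<in> V" and u: "u \<in> Hom C w c"
  have "g \<cdot> u = Zer C w d" using d[unfolded P] w Cmp_Hom[OF u triD(4)[OF t]] by blast
  then show "\<exists>k\<in>Hom C w b. s \<cdot> k = u" using exact_left[OF t u] by metis
qed

text \<open>Injectivity uses that Hom from \<open>d\<close> into \<open>z\<close> vanishes;
  surjectivity uses the same for \<open>ShO C z\<close>, which again lies in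
  \<open>W\<close>.\<close>

lemma local_of_cone:
  assumes W: "shift_closed C W" and t: "tri C s g h b c d" and d: "d \<in> left_perp C W"
  shows "local C W s"
proof (rule localI[OF triD(3)[OF t]])
  note P = left_perp_iff[OF shift_closedD(1)[OF W]] and s = triD(3)[OF t] and o = tri_Obj[OF t]
  fix z k assume z: "z \<in> W" and k: "k \<in> Hom C c z" "k \<cdot> s = Zer C b z"
  have zO: "z \<in> Obj C" using z shift_closedD(1)[OF W] by blast
  from exact_right[OF t k] obtain m where m: "m \<in> Hom C d z" "m \<cdot> g = k" .
  have "m = Zer C d z" using d[unfolded P] m(1) z by blast
  then show "k = Zer C c z" using m(2) triD(4)[OF t] zO o by (auto simp: Hom_iff)
next
  note P = left_perp_iff[OF shift_closedD(1)[OF W]] and s = triD(3)[OF t] and o = tri_Obj[OF t]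
  fix z u assume z: "z \<in> W" and u: "u \<in> Hom C b z"
  have zO: "z \<in> Obj C" using z shift_closedD(1)[OF W] by blast
  have "ShA C u \<cdot> h = Zer C d (ShO C z)"
    using d[unfolded P] z shift_closedD(2)[OF W zO] Cmp_Hom[OF triD(5)[OF t] ShA_Hom[OF u]] by blast
  from exact_right3[OF t ShA_Hom[OF u] this]
  obtain v where v: "v \<in> Hom C (ShO C c) (ShO C z)" "v \<cdot> ShA C s = ShA C u" .
  obtain k where k: "k \<in> Hom C c z" "ShA C k = v" using shift_equiv.full[OF v(1)] o zO by blast
  have "ShA C (k \<cdot> s) = ShA C u" using k v s by (simp add: Hom_iff ShA_Cmp)
  then have "k \<cdot> s = u" using shift_equiv.faithful[OF Cmp_Hom[OF s k(1)] u] by blast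
  then show "\<exists>k\<in>Hom C c z. k \<cdot> s = u" using k(1) by blast
qed

text \<open>An object of \<open>V\<close> is replaced by the shift of some \<open>y\<close> in
  \<open>V\<close>, where full faithfulness reduces the claim to \<open>s\<close> tested on
  \<open>y\<close>.\<close>

lemma colocal_ShA:
  assumes V: "shift_closed C V" and s: "colocal C V s" "s \<in> Hom C b c"
  shows "colocal C V (ShA C s)"
proof (rule colocalI[OF ShA_Hom[OF s(2)]])
  have VO: "w \<in> Obj C" if "w \<in> V" for w using that shift_closedD(1)[OF V] by blast
  have o: "b \<in> Obj C" "c \<in> Obj C" using Hom_Obj[OF s(2)] by auto
  fix w k assume w: "w \<in> V" and k: "k \<in> Hom C w (ShO C b)" "ShA C s \<cdot> k = Zer C w (ShO C c)"
  obtain y i j where y: "y \<in> V" and i: "i \<in> Hom C (ShO C y) w" "j \<in> Hom C w (ShO C y)" "i \<cdot> j = Ide C w"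
    using shift_closed_unshift[OF V w] .
  obtain l where l: "l \<in> Hom C y b" "ShA C l = k \<cdot> i"
    using shift_equiv.full[OF Cmp_Hom[OF i(1) k(1)] VO[OF y] o(1)] .
  have "ShA C (s \<cdot> l) = ShA C (Zer C y c)"
    using s l k i VO[OF y] o by (simp add: Hom_iff ShA_Cmp reassoc[OF k(2)])
  then have "s \<cdot> l = Zer C y c"
    using shift_equiv.faithful[OF Cmp_Hom[OF l(1) s(2)] Zer_Hom[OF VO[OF y] o(2)]] by blast
  then have "l = Zer C y b" by (rule colocal_zero[OF s y l(1)])
  then have "k \<cdot> i = Zer C (ShO C y) (ShO C b)" using l(2) VO[OF y] o by simp
  then have "(k \<cdot> i) \<cdot> j = Zer C (ShO C y) (ShO C b) \<cdot> j" by simp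
  then show "k = Zer C w (ShO C b)" using k i o by (simp add: Hom_iff)
next
  have VO: "w \<in> Obj C" if "w \<in> V" for w using that shift_closedD(1)[OF V] by blast
  have o: "b \<in> Obj C" "c \<in> Obj C" using Hom_Obj[OF s(2)] by auto
  fix w u assume w: "w \<in> V" and u: "u \<in> Hom C w (ShO C c)"
  obtain y i j where y: "y \<in> V" and i: "i \<in> Hom C (ShO C y) w" "j \<in> Hom C w (ShO C y)" "i \<cdot> j = Ide C w"
    using shift_closed_unshift[OF V w] .
  obtain l where l: "l \<in> Hom C y c" "ShA C l = u \<cdot> i"
    using shift_equiv.full[OF Cmp_Hom[OF i(1) u] VO[OF y] o(2)] .
  obtain m where m: "m \<in> Hom C y b" "s \<cdot> m = l" using colocal_surj[OF s y l(1)] .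
  have e: "ShA C s \<cdot> ShA C m = u \<cdot> i" using m l s by (simp add: Hom_iff flip: ShA_Cmp)
  have "ShA C s \<cdot> (ShA C m \<cdot> j) = u" using m s i u by (simp add: Hom_iff reassoc[OF e])
  then show "\<exists>k\<in>Hom C w (ShO C b). ShA C s \<cdot> k = u" using Cmp_Hom[OF i(2) ShA_Hom[OF m(1)]] by blast
qed

lemma local_ShA:
  assumes W: "shift_closed C W" and s: "local C W s" "s \<in> Hom C b c"
  shows "local C W (ShA C s)"
proof (rule localI[OF ShA_Hom[OF s(2)]])
  have WO: "z \<in> Obj C" if "z \<in> W" for z using that shift_closedD(1)[OF W] by blast
  have o: "b \<in> Obj C" "c \<in> Obj C" using Hom_Obj[OF s(2)] by auto
  fix z k assume z: "z \<in> W" and k: "k \<in> Hom C (ShO C c) z" "k \<cdot> ShA C s = Zer C (ShO C b) z"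
  obtain y i j where y: "y \<in> W" and i: "i \<in> Hom C (ShO C y) z" "j \<in> Hom C z (ShO C y)" "i \<cdot> j = Ide C z"
    using shift_closed_unshift[OF W z] .
  obtain l where l: "l \<in> Hom C c y" "ShA C l = j \<cdot> k"
    using shift_equiv.full[OF Cmp_Hom[OF k(1) i(2)] o(2) WO[OF y]] .
  have "ShA C (l \<cdot> s) = ShA C (Zer C b y)"
    using s l k i WO[OF y] o by (simp add: Hom_iff ShA_Cmp)
  then have "l \<cdot> s = Zer C b y"
    using shift_equiv.faithful[OF Cmp_Hom[OF s(2) l(1)] Zer_Hom[OF o(1) WO[OF y]]] by blast
  then have "l = Zer C c y" by (rule local_zero[OF s y l(1)])
  then have "j \<cdot> k = Zer C (ShO C c) (ShO C y)" using l(2) WO[OF y] o by simp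
  then have "i \<cdot> (j \<cdot> k) = i \<cdot> Zer C (ShO C c) (ShO C y)" by simp
  then show "k = Zer C (ShO C c) z" using k i o by (simp add: Hom_iff reassoc[OF i(3)])
next
  have WO: "z \<in> Obj C" if "z \<in> W" for z using that shift_closedD(1)[OF W] by blast
  have o: "b \<in> Obj C" "c \<in> Obj C" using Hom_Obj[OF s(2)] by auto
  fix z u assume z: "z \<in> W" and u: "u \<in> Hom C (ShO C b) z"
  obtain y i j where y: "y \<in> W" and i: "i \<in> Hom C (ShO C y) z" "j \<in> Hom C z (ShO C y)" "i \<cdot> j = Ide C z"
    using shift_closed_unshift[OF W z] .
  obtain l where l: "l \<in> Hom C b y" "ShA C l = j \<cdot> u"
    using shift_equiv.full[OF Cmp_Hom[OF u i(2)] o(1) WO[OF y]] .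
  obtain m where m: "m \<in> Hom C c y" "m \<cdot> s = l" using local_surj[OF s y l(1)] .
  have e: "ShA C m \<cdot> ShA C s = j \<cdot> u" using m l s by (simp add: Hom_iff flip: ShA_Cmp)
  have "(i \<cdot> ShA C m) \<cdot> ShA C s = u" using m s i u e by (simp add: Hom_iff reassoc[OF i(3)])
  then show "\<exists>k\<in>Hom C (ShO C c) z. k \<cdot> ShA C s = u" using Cmp_Hom[OF ShA_Hom[OF m(1)] i(1)] by blast
qed

text \<open>Converse of \<open>colocal_of_cone\<close>. Colocality of \<open>ShA C s\<close> forces
  \<open>h \<cdot> u\<close> to vanish; then \<open>u\<close> lifts to \<open>c\<close>, the lift
  factors through \<open>s\<close>, and \<open>g \<cdot> s\<close> is zero.\<close>

lemma cone_of_colocal: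
  assumes V: "shift_closed C V" and t: "tri C s g h b c d" and s: "colocal C V s"
  shows "d \<in> right_perp C V"
  unfolding right_perp_iff[OF shift_closedD(1)[OF V]]
proof (intro conjI ballI)
  note sH = triD(3)[OF t] and gH = triD(4)[OF t] and hH = triD(5)[OF t] and o = tri_Obj[OF t]
  show "d \<in> Obj C" using o by blast
  fix w u assume w: "w \<in> V" and u: "u \<in> Hom C w d"
  have wO: "w \<in> Obj C" using w shift_closedD(1)[OF V] by blast
  have "ShA C s \<cdot> (h \<cdot> u) = Zer C w (ShO C c)"
    using sH hH u o by (simp add: Hom_iff reassoc[OF tri_Cmp_Zer(3)[OF t]])
  then have "h \<cdot> u = Zer C w (ShO C b)"
    by (rule colocal_zero[OF colocal_ShA[OF V s sH] ShA_Hom[OF sH] w Cmp_Hom[OF u hH]])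
  from exact_left2[OF t u this] obtain v where v: "v \<in> Hom C w c" "g \<cdot> v = u" .
  obtain k where k: "k \<in> Hom C w b" "s \<cdot> k = v" using colocal_surj[OF s sH w v(1)] .
  have "u = g \<cdot> (s \<cdot> k)" using k v by simp
  also have "\<dots> = Zer C w d" using k(1) sH gH o by (simp add: Hom_iff reassoc[OF tri_Cmp_Zer(1)[OF t]])
  finally show "u = Zer C w d" .
qed

text \<open>Here \<open>u \<cdot> g\<close> vanishes by locality of \<open>s\<close>, so
  \<open>u\<close> factors through \<open>h\<close>; locality of \<open>ShA C s\<close> factors it
  further through \<open>ShA C s \<cdot> h\<close>, which is zero.\<close>

lemma cone_of_local:
  assumes W: "shift_closed C W" and t: "tri C s g h b c d" and s: "local C W s"
  shows "d \<in> left_perp C W"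
  unfolding left_perp_iff[OF shift_closedD(1)[OF W]]
proof (intro conjI ballI)
  note sH = triD(3)[OF t] and gH = triD(4)[OF t] and hH = triD(5)[OF t] and o = tri_Obj[OF t]
  show "d \<in> Obj C" using o by blast
  fix z u assume z: "z \<in> W" and u: "u \<in> Hom C d z"
  have zO: "z \<in> Obj C" using z shift_closedD(1)[OF W] by blast
  have "(u \<cdot> g) \<cdot> s = Zer C b z"
    using sH gH u zO o tri_Cmp_Zer(1)[OF t] by (simp add: Hom_iff)
  then have "u \<cdot> g = Zer C c z"
    by (rule local_zero[OF s sH z Cmp_Hom[OF gH u]])
  from exact_right2[OF t u this] obtain v where v: "v \<in> Hom C (ShO C b) z" "v \<cdot> h = u" .
  obtain k where k: "k \<in> Hom C (ShO C c) z" "k \<cdot> ShA C s = v"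
    using local_surj[OF local_ShA[OF W s sH] ShA_Hom[OF sH] z v(1)] .
  have "u = (k \<cdot> ShA C s) \<cdot> h" using k v by simp
  also have "\<dots> = Zer C d z" using k(1) sH hH o zO tri_Cmp_Zer(3)[OF t] by (simp add: Hom_iff)
  finally show "u = Zer C d z" .
qed

text \<open>Diagram chase of the five lemma for Hom out of \<open>q\<close> in \<open>V\<close>. The
  arrow \<open>w\<close> may be any completion supplied by TR3, so colocality, and with it the
  location of the cone, passes to completions without a three-by-three diagram.\<close>

lemma colocal_five:
  assumes V: "shift_closed C V"
    and t: "tri C f g h a b c" and t': "tri C f' g' h' a' b' c'"
    and u: "u \<in> Hom C a' a" and v: "v \<in> Hom C b' b" and w: "w \<in> Hom C c' c"
    and lu: "colocal C V u" and lv: "colocal C V v"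
    and uv: "v \<cdot> f' = f \<cdot> u" and vw: "w \<cdot> g' = g \<cdot> v" and wu: "ShA C u \<cdot> h' = h \<cdot> w"
  shows "colocal C V w"
proof (rule colocalI[OF w])
  note H = triD(3-5)[OF t] triD(3-5)[OF t'] u v w
  note o = tri_Obj[OF t] tri_Obj[OF t']
  fix q k assume q: "q \<in> V" and k: "k \<in> Hom C q c'" "w \<cdot> k = Zer C q c"
  have qO: "q \<in> Obj C" using q shift_closedD(1)[OF V] by blast
  have "ShA C u \<cdot> (h' \<cdot> k) = Zer C q (ShO C a)"
    using H k o qO by (simp add: Hom_iff reassoc[OF wu])
  then have "h' \<cdot> k = Zer C q (ShO C a')"
    by (rule colocal_zero[OF colocal_ShA[OF V lu u] ShA_Hom[OF u] q Cmp_Hom[OF k(1) triD(5)[OF t']]])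
  from exact_left2[OF t' k(1) this] obtain n where n: "n \<in> Hom C q b'" "g' \<cdot> n = k" .
  have "g \<cdot> (v \<cdot> n) = Zer C q c"
    using H n k qO o by (simp add: Hom_iff reassoc[OF vw[symmetric]])
  from exact_left[OF t Cmp_Hom[OF n(1) v] this] obtain l where l: "l \<in> Hom C q a" "f \<cdot> l = v \<cdot> n" .
  obtain l' where l': "l' \<in> Hom C q a'" "u \<cdot> l' = l" using colocal_surj[OF lu u q l(1)] .
  have "v \<cdot> (f' \<cdot> l') = v \<cdot> n"
    using H l l' qO o by (simp add: Hom_iff reassoc[OF uv])
  then have "f' \<cdot> l' = n"
    by (rule colocal_inj[OF lv v q Cmp_Hom[OF l'(1) triD(3)[OF t']] n(1)])
  then have "k = g' \<cdot> (f' \<cdot> l')" using n by simp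
  also have "\<dots> = Zer C q c'" using H l' o by (simp add: Hom_iff reassoc[OF tri_Cmp_Zer(1)[OF t']])
  finally show "k = Zer C q c'" .
next
  note H = triD(3-5)[OF t] triD(3-5)[OF t'] u v w
  note o = tri_Obj[OF t] tri_Obj[OF t']
  fix q k assume q: "q \<in> V" and k: "k \<in> Hom C q c"
  have qO: "q \<in> Obj C" using q shift_closedD(1)[OF V] by blast
  obtain l where l: "l \<in> Hom C q (ShO C a')" "ShA C u \<cdot> l = h \<cdot> k"
    using colocal_surj[OF colocal_ShA[OF V lu u] ShA_Hom[OF u] q Cmp_Hom[OF k triD(5)[OF t]]] .
  have uv': "ShA C v \<cdot> ShA C f' = ShA C f \<cdot> ShA C u"
    using uv H by (simp add: Hom_iff flip: ShA_Cmp)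
  have "ShA C v \<cdot> (ShA C f' \<cdot> l) = ShA C f \<cdot> (h \<cdot> k)"
    using H l k by (simp add: Hom_iff reassoc[OF uv'])
  also have "\<dots> = Zer C q (ShO C b)"
    using H k o by (simp add: Hom_iff reassoc[OF tri_Cmp_Zer(3)[OF t]])
  finally have "ShA C f' \<cdot> l = Zer C q (ShO C b')"
    by (rule colocal_zero[OF colocal_ShA[OF V lv v] ShA_Hom[OF v] q
          Cmp_Hom[OF l(1) ShA_Hom[OF triD(3)[OF t']]]])
  from exact_left3[OF t' l(1) this] obtain m where m: "m \<in> Hom C q c'" "h' \<cdot> m = l" .
  note wm = Cmp_Hom[OF m(1) w]
  \<comment> \<open>\<open>k\<close> and \<open>w \<cdot> m\<close> agree in \<open>ShO C a\<close>,
    so their difference comes from \<open>b\<close>; a lift of it through \<open>v\<close> corrects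
    \<open>m\<close>.\<close>
  have "h \<cdot> Sub k (w \<cdot> m) = Sub (h \<cdot> k) (h \<cdot> (w \<cdot> m))"
    by (rule Cmp_Sub[OF k wm triD(5)[OF t]])
  also have "h \<cdot> (w \<cdot> m) = h \<cdot> k"
    using H m l k by (simp add: Hom_iff reassoc[OF wu[symmetric]])
  also have "Sub (h \<cdot> k) (h \<cdot> k) = Zer C q (ShO C a)"
    using Sub_eq_Zer_iff Cmp_Hom[OF k triD(5)[OF t]] by blast
  finally have "h \<cdot> Sub k (w \<cdot> m) = Zer C q (ShO C a)" .
  from exact_left2[OF t Sub_Hom[OF k wm] this]
  obtain n where n: "n \<in> Hom C q b" "g \<cdot> n = Sub k (w \<cdot> m)" .
  obtain n' where n': "n' \<in> Hom C q b'" "v \<cdot> n' = n" using colocal_surj[OF lv v q n(1)] .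
  note gn = Cmp_Hom[OF n'(1) triD(4)[OF t']]
  have "w \<cdot> Add C m (g' \<cdot> n') = Add C (w \<cdot> m) (w \<cdot> (g' \<cdot> n'))"
    by (rule Cmp_Add_right[OF m(1) gn w])
  also have "w \<cdot> (g' \<cdot> n') = Sub k (w \<cdot> m)"
    using H n n' by (simp add: Hom_iff reassoc[OF vw])
  also have "Add C (w \<cdot> m) (Sub k (w \<cdot> m)) = k" by (rule Add_Sub_cancel[OF k wm])
  finally show "\<exists>k'\<in>Hom C q c'. w \<cdot> k' = k" using Add_Hom[OF m(1) gn] by blast
qed

text \<open>Dual chase for Hom into \<open>q\<close>: lifts become extensions, and the shifted
  arrows \<open>ShA C u\<close> and \<open>ShA C v\<close> take over at the far end of the
  sequence.\<close>

lemma local_five: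
  assumes W: "shift_closed C W"
    and t: "tri C f g h a b c" and t': "tri C f' g' h' a' b' c'"
    and u: "u \<in> Hom C a' a" and v: "v \<in> Hom C b' b" and w: "w \<in> Hom C c' c"
    and lu: "local C W u" and lv: "local C W v"
    and uv: "v \<cdot> f' = f \<cdot> u" and vw: "w \<cdot> g' = g \<cdot> v" and wu: "ShA C u \<cdot> h' = h \<cdot> w"
  shows "local C W w"
proof (rule localI[OF w])
  note H = triD(3-5)[OF t] triD(3-5)[OF t'] u v w
  note o = tri_Obj[OF t] tri_Obj[OF t']
  have uv': "ShA C v \<cdot> ShA C f' = ShA C f \<cdot> ShA C u"
    using uv H by (simp add: Hom_iff flip: ShA_Cmp)
  fix q m assume q: "q \<in> W" and m: "m \<in> Hom C c q" "m \<cdot> w = Zer C c' q"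
  have qO: "q \<in> Obj C" using q shift_closedD(1)[OF W] by blast
  have "(m \<cdot> g) \<cdot> v = m \<cdot> (w \<cdot> g')" using H m by (simp add: Hom_iff vw)
  also have "\<dots> = Zer C b' q" using H m qO o by (simp add: Hom_iff reassoc[OF m(2)])
  finally have "m \<cdot> g = Zer C b q"
    by (rule local_zero[OF lv v q Cmp_Hom[OF triD(4)[OF t] m(1)]])
  from exact_right2[OF t m(1) this] obtain n where n: "n \<in> Hom C (ShO C a) q" "n \<cdot> h = m" .
  have "(n \<cdot> ShA C u) \<cdot> h' = n \<cdot> (h \<cdot> w)" using H n by (simp add: Hom_iff wu)
  also have "\<dots> = Zer C c' q" using H n m by (simp add: Hom_iff reassoc[OF n(2)])
  finally have "(n \<cdot> ShA C u) \<cdot> h' = Zer C c' q" .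
  from exact_right3[OF t' Cmp_Hom[OF ShA_Hom[OF u] n(1)] this]
  obtain l where l: "l \<in> Hom C (ShO C b') q" "l \<cdot> ShA C f' = n \<cdot> ShA C u" .
  obtain l' where l': "l' \<in> Hom C (ShO C b) q" "l' \<cdot> ShA C v = l"
    using local_surj[OF local_ShA[OF W lv v] ShA_Hom[OF v] q l(1)] .
  have "(l' \<cdot> ShA C f) \<cdot> ShA C u = l' \<cdot> (ShA C v \<cdot> ShA C f')"
    using H l' by (simp add: Hom_iff uv')
  also have "\<dots> = n \<cdot> ShA C u" using H l' l by (simp add: Hom_iff reassoc[OF l'(2)])
  finally have "l' \<cdot> ShA C f = n"
    by (rule local_inj[OF local_ShA[OF W lu u] ShA_Hom[OF u] q
          Cmp_Hom[OF ShA_Hom[OF triD(3)[OF t]] l'(1)] n(1)])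
  then have "m = (l' \<cdot> ShA C f) \<cdot> h" using n by simp
  also have "\<dots> = Zer C c q" using H l' o qO tri_Cmp_Zer(3)[OF t] by (simp add: Hom_iff)
  finally show "m = Zer C c q" .
next
  note H = triD(3-5)[OF t] triD(3-5)[OF t'] u v w
  note o = tri_Obj[OF t] tri_Obj[OF t']
  fix q k assume q: "q \<in> W" and k: "k \<in> Hom C c' q"
  have qO: "q \<in> Obj C" using q shift_closedD(1)[OF W] by blast
  obtain l where l: "l \<in> Hom C b q" "l \<cdot> v = k \<cdot> g'"
    using local_surj[OF lv v q Cmp_Hom[OF triD(4)[OF t'] k]] .
  have "(l \<cdot> f) \<cdot> u = l \<cdot> (v \<cdot> f')" using H l by (simp add: Hom_iff uv)
  also have "\<dots> = k \<cdot> (g' \<cdot> f')" using H l k by (simp add: Hom_iff reassoc[OF l(2)])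
  also have "\<dots> = Zer C a' q" using H k o qO by (simp add: Hom_iff tri_Cmp_Zer(1)[OF t'])
  finally have "l \<cdot> f = Zer C a q"
    by (rule local_zero[OF lu u q Cmp_Hom[OF triD(3)[OF t] l(1)]])
  from exact_right[OF t l(1) this] obtain m where m: "m \<in> Hom C c q" "m \<cdot> g = l" .
  note mw = Cmp_Hom[OF w m(1)]
  \<comment> \<open>\<open>k\<close> and \<open>m \<cdot> w\<close> agree on \<open>b'\<close>;
    their difference factors through \<open>h'\<close> and, by locality of \<open>ShA C u\<close>,
    extends to an arrow from \<open>ShO C a\<close>, which supplies the correction of
    \<open>m\<close>.\<close>
  have "Sub k (m \<cdot> w) \<cdot> g' = Sub (k \<cdot> g') ((m \<cdot> w) \<cdot> g')"
    by (rule Sub_Cmp[OF triD(4)[OF t'] k mw])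
  also have "(m \<cdot> w) \<cdot> g' = (m \<cdot> g) \<cdot> v" using H m(1) by (simp add: Hom_iff vw)
  also have "\<dots> = k \<cdot> g'" using m l by simp
  also have "Sub (k \<cdot> g') (k \<cdot> g') = Zer C b' q"
    using Sub_eq_Zer_iff Cmp_Hom[OF triD(4)[OF t'] k] by blast
  finally have "Sub k (m \<cdot> w) \<cdot> g' = Zer C b' q" .
  from exact_right2[OF t' Sub_Hom[OF k mw] this]
  obtain n where n: "n \<in> Hom C (ShO C a') q" "n \<cdot> h' = Sub k (m \<cdot> w)" .
  obtain n' where n': "n' \<in> Hom C (ShO C a) q" "n' \<cdot> ShA C u = n"
    using local_surj[OF local_ShA[OF W lu u] ShA_Hom[OF u] q n(1)] .
  note nh = Cmp_Hom[OF triD(5)[OF t] n'(1)]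
  have "Add C m (n' \<cdot> h) \<cdot> w = Add C (m \<cdot> w) ((n' \<cdot> h) \<cdot> w)"
    by (rule Cmp_Add_left[OF w m(1) nh])
  also have "(n' \<cdot> h) \<cdot> w = (n' \<cdot> ShA C u) \<cdot> h'" using H n'(1) by (simp add: Hom_iff wu)
  also have "\<dots> = Sub k (m \<cdot> w)" using n n' by simp
  also have "Add C (m \<cdot> w) (Sub k (m \<cdot> w)) = k" by (rule Add_Sub_cancel[OF k mw])
  finally show "\<exists>k'\<in>Hom C c q. k' \<cdot> w = k" using Add_Hom[OF m(1) nh] by blast
qed

end

section \<open>Thick subcategories as triangulated categories\<close>

lemma full_sub_simps [simp]:
  "Obj (full_sub C X) = X" "Dom (full_sub C X) = Dom C" "Cod (full_sub C X) = Cod C"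
  "Ide (full_sub C X) = Ide C" "Cmp (full_sub C X) = Cmp C" "Add (full_sub C X) = Add C"
  "Zer (full_sub C X) = Zer C" "ShO (full_sub C X) = ShO C" "ShA (full_sub C X) = ShA C"
  by (simp_all add: full_sub_def)

lemma full_sub_Arr: "f \<in> Arr (full_sub C X) \<longleftrightarrow> f \<in> Arr C \<and> Dom C f \<in> X \<and> Cod C f \<in> X"
  by (simp add: full_sub_def)

lemma full_sub_Hom: "f \<in> Hom (full_sub C X) a b \<longleftrightarrow> f \<in> Hom C a b \<and> a \<in> X \<and> b \<in> X"
  by (auto simp: Hom_iff full_sub_Arr)

lemma full_sub_Hom_eq: "a \<in> X \<Longrightarrow> b \<in> X \<Longrightarrow> Hom (full_sub C X) a b = Hom C a b"
  by (auto simp: full_sub_Hom)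

lemma full_sub_hom_group: "a \<in> X \<Longrightarrow> b \<in> X \<Longrightarrow> hom_group (full_sub C X) a b = hom_group C a b"
  by (simp add: hom_group_def full_sub_Hom_eq)

lemma full_sub_iso_arr: "iso_arr (full_sub C X) f \<longleftrightarrow> iso_arr C f \<and> Dom C f \<in> X \<and> Cod C f \<in> X"
  by (auto simp: iso_arr_def full_sub_Arr full_sub_Hom)

lemma full_sub_isomorphic: "isomorphic (full_sub C X) a b \<longleftrightarrow> isomorphic C a b \<and> a \<in> X \<and> b \<in> X"
  unfolding isomorphic_def Bex_def full_sub_iso_arr full_sub_Hom by (auto simp: Hom_iff)

lemma full_sub_is_triangle:
  assumes "\<forall>x\<in>X. ShO C x \<in> X"
  shows "is_triangle (full_sub C X) f g h a b c \<longleftrightarrow> is_triangle C f g h a b c \<and> a \<in> X \<and> b \<in> X \<and> c \<in> X"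
  using assms by (auto simp: is_triangle_def full_sub_Hom)

lemma full_sub_Tri: "(f, g, h) \<in> Tri (full_sub C X) \<longleftrightarrow>
   (\<exists>a\<in>X. \<exists>b\<in>X. \<exists>c\<in>X. tri C f g h a b c)"
  by (auto simp: full_sub_def tri_def)

lemma full_sub_tri:
  assumes "\<forall>x\<in>X. ShO C x \<in> X"
  shows "tri (full_sub C X) f g h a b c \<longleftrightarrow> tri C f g h a b c \<and> a \<in> X \<and> b \<in> X \<and> c \<in> X"
  using assms by (auto simp: tri_def full_sub_Tri full_sub_is_triangle)

lemma full_sub_Neg: "f \<in> Arr (full_sub C X) \<Longrightarrow> Neg (full_sub C X) f = Neg C f"
  by (simp add: Neg_def full_sub_hom_group full_sub_Arr)

lemma full_sub_biproduct:
  "biproduct (full_sub C X) a b p i j q r \<longleftrightarrow> biproduct C a b p i j q r \<and> a \<in> X \<and> b \<in> X \<and> p \<in> X"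
  by (auto simp: biproduct_def full_sub_Hom)

context triangulated_category
begin

text \<open>\<open>thick\<close> asks for closure under summands, not under sums. In the triangle on
  the inclusion \<open>i\<close> the connecting map vanishes because \<open>i\<close> is split, and
  \<open>r\<close> induces an isomorphism from the cone to \<open>b\<close>; two out of three then
  gives \<open>p\<close>.\<close>

lemma thick_biproduct:
  assumes S: "thick C S" and ab: "a \<in> S" "b \<in> S" and bi: "biproduct C a b p i j q r"
  shows "p \<in> S"
proof -
  have H: "i \<in> Hom C a p" "j \<in> Hom C b p" "q \<in> Hom C p a" "r \<in> Hom C p b"
    and e: "q \<cdot> i = Ide C a" "r \<cdot> j = Ide C b" "r \<cdot> i = Zer C a b"
    and s: "Add C (i \<cdot> q) (j \<cdot> r) = Ide C p"
    using bi by (auto simp: biproduct_def)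
  obtain c g h where t: "tri C i g h a p c" using tri_cone[OF H(1)] .
  note o = tri_Obj[OF t] Hom_Obj[OF H(2)] and T = triD(4,5)[OF t]
  obtain m where m: "m \<in> Hom C c b" "m \<cdot> g = r" using exact_right[OF t H(4) e(3)] .
  have gj: "g \<cdot> j \<in> Hom C b c" using H(2) T(1) by (rule Cmp_Hom)
  have 1: "m \<cdot> (g \<cdot> j) = Ide C b" using m H T e(2) by (simp add: Hom_iff reassoc[OF m(2)])
  \<comment> \<open>Since \<open>q \<cdot> i\<close> is the identity, \<open>h\<close> is determined
    by \<open>ShA C i \<cdot> h\<close>, which is zero.\<close>
  have "ShA C q \<cdot> (ShA C i \<cdot> h) = h"
    using H T e o by (simp add: Hom_iff flip: ShA_Cmp assoc)
  then have h: "h = Zer C c (ShO C a)" using H o by (simp add: Hom_iff tri_Cmp_Zer(3)[OF t])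
  have c: "(g \<cdot> j) \<cdot> m \<in> Hom C c c" using m(1) gj by (rule Cmp_Hom)
  \<comment> \<open>The identity of \<open>p\<close> is a sum of two projections, and
    \<open>g\<close> kills the one through \<open>a\<close>; hence
    \<open>(g \<cdot> j) \<cdot> m\<close> fixes \<open>g\<close>.\<close>
  have "g = g \<cdot> Add C (i \<cdot> q) (j \<cdot> r)" using T o by (simp add: s Hom_iff)
  also have "\<dots> = Add C (g \<cdot> (i \<cdot> q)) (g \<cdot> (j \<cdot> r))"
    by (rule Cmp_Add_right[OF Cmp_Hom[OF H(3,1)] Cmp_Hom[OF H(4,2)] T(1)])
  also have "g \<cdot> (i \<cdot> q) = Zer C p c"
    using H T o by (simp add: Hom_iff reassoc[OF tri_Cmp_Zer(1)[OF t]])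
  also have "Add C (Zer C p c) (g \<cdot> (j \<cdot> r)) = g \<cdot> (j \<cdot> r)"
    by (rule Add_Zer_left[OF Cmp_Hom[OF Cmp_Hom[OF H(4,2)] T(1)]])
  finally have g: "g \<cdot> (j \<cdot> r) = g" by simp
  have "Sub ((g \<cdot> j) \<cdot> m) (Ide C c) \<cdot> g = Sub (((g \<cdot> j) \<cdot> m) \<cdot> g) (Ide C c \<cdot> g)"
    by (rule Sub_Cmp[OF T(1) c]) (use o Ide_Hom in auto)
  also have "((g \<cdot> j) \<cdot> m) \<cdot> g = g" using T H m g by (simp add: Hom_iff)
  also have "Sub g (Ide C c \<cdot> g) = Zer C p c" using T Sub_eq_Zer_iff[OF T(1) T(1)] by (simp add: Hom_iff)
  finally have "Sub ((g \<cdot> j) \<cdot> m) (Ide C c) \<cdot> g = Zer C p c" .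
  from exact_right2[OF t Sub_Hom[OF c Ide_Hom] this] o
  obtain n where n: "n \<in> Hom C (ShO C a) c" "n \<cdot> h = Sub ((g \<cdot> j) \<cdot> m) (Ide C c)" by blast
  then have "Sub ((g \<cdot> j) \<cdot> m) (Ide C c) = Zer C c c" using h o by (auto simp: Hom_iff)
  then have "(g \<cdot> j) \<cdot> m = Ide C c" using Sub_eq_Zer_iff[OF c Ide_Hom] o by blast
  then have "iso_arr C (g \<cdot> j)" using iso_arrI[OF gj m(1) 1] by blast
  then have "c \<in> S" using thick_iso[OF S ab(2)] gj by (auto simp: isomorphic_def)
  then show ?thesis using thick_tri(3)[OF S t ab(1)] by blast
qed

context
  fixes Z
  assumes Z: "thick C Z"
begin

lemma thick_Obj [simp]: "z \<in> Z \<Longrightarrow> z \<in> Obj C" using thickD(1)[OF Z] by blast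
lemma thick_ShO_ball: "\<forall>z\<in>Z. ShO C z \<in> Z" using thickD(3)[OF Z] by simp
lemmas thick_ShO = thick_ShO_ball[rule_format]

lemma full_sub_category: "category (full_sub C Z)"
proof
  fix f g h a b c d
  assume "f \<in> Hom (full_sub C Z) a b" "g \<in> Hom (full_sub C Z) b c" "h \<in> Hom (full_sub C Z) c d"
  then show "h \<cdot>\<^bsub>full_sub C Z\<^esub> g \<cdot>\<^bsub>full_sub C Z\<^esub> f = h \<cdot>\<^bsub>full_sub C Z\<^esub> (g \<cdot>\<^bsub>full_sub C Z\<^esub> f)"
    by (simp add: full_sub_Arr Hom_iff)
qed (auto simp: full_sub_Hom full_sub_Arr Hom_iff)

lemma full_sub_additive: "additive_category (full_sub C Z)"
proof (intro additive_category.intro full_sub_category additive_category_axioms.intro)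
  show "comm_group (hom_group (full_sub C Z) a b)"
    if "a \<in> Obj (full_sub C Z)" "b \<in> Obj (full_sub C Z)" for a b
    using that Hom_comm_group by (simp add: full_sub_hom_group)
  obtain z where z: "zero_object C z" using zero_object_exists by blast
  then have "zero_object (full_sub C Z) z"
    using thick_zero[OF Z z] by (simp add: zero_object_def full_sub_Hom)
  then show "\<exists>z. zero_object (full_sub C Z) z" by blast
  show "\<exists>p\<in>Obj (full_sub C Z). \<exists>i j q r. biproduct (full_sub C Z) a b p i j q r"
    if "a \<in> Obj (full_sub C Z)" "b \<in> Obj (full_sub C Z)" for a b
  proof -
    have ab: "a \<in> Z" "b \<in> Z" using that by auto
    obtain p i j q r where "biproduct C a b p i j q r"
      using biproduct_exists[of a b] ab by auto
    then show ?thesis using thick_biproduct[OF Z ab] ab unfolding full_sub_biproduct full_sub_simps by blast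
  qed
qed (auto simp: full_sub_Hom intro: Cmp_Add_right Cmp_Add_left)

lemma full_sub_shift: "cat_functor (full_sub C Z) (full_sub C Z) (ShO C) (ShA C)"
  by (intro cat_functor.intro cat_functor_axioms.intro full_sub_category)
    (auto simp: full_sub_Hom thick_ShO intro: ShA_Hom shift_equiv.F1_Cmp)

text \<open>Axioms that only produce arrows or compare triangles are inherited with the full
  Hom-sets. Beyond closure under the shift, thickness enters where an object is produced: the cone
  of an arrow, and a preimage under the shift up to isomorphism.\<close>

lemma full_sub_triangulated: "triangulated_category (full_sub C Z)"
proof (intro triangulated_category.intro triangulated_category_axioms.intro full_sub_additive)
  let ?D = "full_sub C Z"
  interpret D: additive_category ?D by (rule full_sub_additive)
  show "equivalence_functor ?D ?D (ShO ?D) (ShA ?D)"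
    unfolding full_sub_simps
  proof (rule cat_functor.equivalence_functorI[OF full_sub_shift])
    show "bij_betw (ShA C) (Hom ?D a b) (Hom ?D (ShO C a) (ShO C b))"
      if "a \<in> Obj ?D" "b \<in> Obj ?D" for a b
      using that shift_equiv.fully_faithful[of a b] by (simp add: full_sub_Hom_eq thick_ShO)
    show "\<exists>c\<in>Obj ?D. isomorphic ?D (ShO C c) d" if "d \<in> Obj ?D" for d
    proof -
      obtain c where c: "c \<in> Obj C" "isomorphic C (ShO C c) d"
        using shift_equiv.essentially_surjective[of d] \<open>d \<in> Obj ?D\<close> by auto
      then have "ShO C c \<in> Z" using thick_iso[OF Z _ isomorphic_sym] that by simp
      then show ?thesis using c thickD(3)[OF Z] that by (auto simp: full_sub_isomorphic)
    qed
  qed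
  show "additive_functor ?D ?D (ShO ?D) (ShA ?D)"
    unfolding full_sub_simps
    by (intro additive_functor.intro additive_functor_axioms.intro full_sub_additive full_sub_shift)
      (auto simp: full_sub_Hom intro: shift_add.F1_Add)
  note tr = full_sub_is_triangle[OF thick_ShO_ball]
  show "\<exists>a b c. is_triangle ?D f g h a b c" if "(f, g, h) \<in> Tri ?D" for f g h
    using that unfolding full_sub_Tri tri_def tr by blast
  show "t' \<in> Tri ?D" if t: "t \<in> Tri ?D" "triangle_iso ?D t t'" for t t'
  proof -
    obtain f g h f' g' h' where e: "t = (f, g, h)" "t' = (f', g', h')" by (metis prod_cases3)
    from t(2) obtain a b c a' b' c' u v w where
      i: "is_triangle ?D f g h a b c" "is_triangle ?D f' g' h' a' b' c'"
        "u \<in> Hom ?D a a'" "v \<in> Hom ?D b b'" "w \<in> Hom ?D c c'"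
        "iso_arr ?D u" "iso_arr ?D v" "iso_arr ?D w"
        "v \<cdot> f = f' \<cdot> u" "w \<cdot> g = g' \<cdot> v" "ShA C u \<cdot> h = h' \<cdot> w"
      unfolding e triangle_iso_def prod.case full_sub_simps by blast
    have "triangle_iso C t t'"
      unfolding e triangle_iso_def prod.case
      using i unfolding tr full_sub_Hom full_sub_iso_arr by blast
    moreover have "t \<in> Tri C" using t(1) e by (auto simp: full_sub_Tri tri_def)
    ultimately have "t' \<in> Tri C" by (rule TR1_iso[rotated])
    then show ?thesis using i(2) unfolding e tr full_sub_Tri tri_def by blast
  qed
  show "(Ide ?D a, Zer ?D a z, Zer ?D z (ShO ?D a)) \<in> Tri ?D"
    if "a \<in> Obj ?D" "zero_object ?D z" for a z
  proof -
    have "zero_object C z" "z \<in> Z" "a \<in> Z" using that D.zero_object_iff zero_object_iff by auto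
    then show ?thesis using tri_Ide[of a z] unfolding full_sub_Tri full_sub_simps by auto
  qed
  show "\<exists>g h. (f, g, h) \<in> Tri ?D" if "f \<in> Arr ?D" for f
  proof -
    have f: "f \<in> Hom C (Dom C f) (Cod C f)" "Dom C f \<in> Z" "Cod C f \<in> Z"
      using that by (auto simp: full_sub_Arr Hom_iff)
    obtain c g h where t: "tri C f g h (Dom C f) (Cod C f) c" using tri_cone[OF f(1)] .
    then show ?thesis using thick_tri(1)[OF Z t] f unfolding full_sub_Tri by blast
  qed
  show "(f, g, h) \<in> Tri ?D \<longleftrightarrow> (g, h, Neg ?D (ShA ?D f)) \<in> Tri ?D"
    if i: "is_triangle ?D f g h a b c" for f g h a b c
  proof -
    have i': "f \<in> Hom C a b" "g \<in> Hom C b c" "h \<in> Hom C c (ShO C a)" and z: "a \<in> Z" "b \<in> Z" "c \<in> Z"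
      using i unfolding tr by (auto simp: is_triangle_def)
    have N: "Neg ?D (ShA C f) = Neg C (ShA C f)"
      by (rule full_sub_Neg) (use i' z thick_ShO in \<open>auto simp: full_sub_Arr Hom_iff\<close>)
    have "(f, g, h) \<in> Tri ?D \<longleftrightarrow> tri C f g h a b c"
      using i' z by (auto simp: full_sub_Tri tri_def is_triangle_def)
    moreover have "(g, h, Neg C (ShA C f)) \<in> Tri ?D \<longleftrightarrow> tri C g h (Neg C (ShA C f)) b c (ShO C a)"
      using i' z thick_ShO[OF z(1)] by (auto simp: full_sub_Tri tri_def is_triangle_def Hom_iff)
    ultimately show ?thesis using tri_rot_iff[OF i'] N by simp
  qed
  show "\<exists>w\<in>Hom ?D c c'. w \<cdot>\<^bsub>?D\<^esub> g = g' \<cdot>\<^bsub>?D\<^esub> v \<and> ShA ?D u \<cdot>\<^bsub>?D\<^esub> h = h' \<cdot>\<^bsub>?D\<^esub> w"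
    if "(f, g, h) \<in> Tri ?D" "is_triangle ?D f g h a b c"
      "(f', g', h') \<in> Tri ?D" "is_triangle ?D f' g' h' a' b' c'"
      "u \<in> Hom ?D a a'" "v \<in> Hom ?D b b'" "v \<cdot>\<^bsub>?D\<^esub> f = f' \<cdot>\<^bsub>?D\<^esub> u"
    for f g h a b c f' g' h' a' b' c' u v
  proof -
    have "(f, g, h) \<in> Tri C" "(f', g', h') \<in> Tri C" using that by (auto simp: full_sub_Tri tri_def)
    then show ?thesis
      using TR3[of f g h a b c f' g' h' a' b' c' u v] that unfolding tr full_sub_simps full_sub_Hom Bex_def by simp
  qed
  show "\<exists>u\<in>Hom ?D z' y'. \<exists>v\<in>Hom ?D y' x'.
           (u, v, ShA ?D f1 \<cdot>\<^bsub>?D\<^esub> g2) \<in> Tri ?D \<and>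
           u \<cdot>\<^bsub>?D\<^esub> f1 = h1 \<cdot>\<^bsub>?D\<^esub> g \<and> h2 \<cdot>\<^bsub>?D\<^esub> u = f2 \<and> v \<cdot>\<^bsub>?D\<^esub> h1 = g1 \<and> g2 \<cdot>\<^bsub>?D\<^esub> v = ShA ?D f \<cdot>\<^bsub>?D\<^esub> h2"
    if t: "(f, f1, f2) \<in> Tri ?D" "is_triangle ?D f f1 f2 x y z'"
      "(g, g1, g2) \<in> Tri ?D" "is_triangle ?D g g1 g2 y z x'"
      "(g \<cdot>\<^bsub>?D\<^esub> f, h1, h2) \<in> Tri ?D" "is_triangle ?D (g \<cdot>\<^bsub>?D\<^esub> f) h1 h2 x z y'"
    for f f1 f2 x y z' g g1 g2 z x' h1 h2 y'
  proof -
    have "(f, f1, f2) \<in> Tri C" "(g, g1, g2) \<in> Tri C" "(g \<cdot> f, h1, h2) \<in> Tri C"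
      using t by (auto simp: full_sub_Tri tri_def)
    moreover have i: "is_triangle C f f1 f2 x y z'" "is_triangle C g g1 g2 y z x'"
      "is_triangle C (g \<cdot> f) h1 h2 x z y'" and o: "x \<in> Z" "y \<in> Z" "z \<in> Z" "x' \<in> Z" "y' \<in> Z" "z' \<in> Z"
      using t unfolding tr by auto
    ultimately obtain u v where uv: "u \<in> Hom C z' y'" "v \<in> Hom C y' x'"
      "(u, v, ShA C f1 \<cdot> g2) \<in> Tri C" "u \<cdot> f1 = h1 \<cdot> g" "h2 \<cdot> u = f2" "v \<cdot> h1 = g1" "g2 \<cdot> v = ShA C f \<cdot> h2"
      using TR4[of f f1 f2 x y z' g g1 g2 z x' h1 h2 y'] by blast
    \<comment> \<open>The octahedron adds a triangle on vertices that are already present, so it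
      lies in the subcategory.\<close>
    have "tri C u v (ShA C f1 \<cdot> g2) z' y' x'"
      by (rule triI[OF uv(3,1,2)]) (use i in \<open>auto simp: is_triangle_def Hom_iff\<close>)
    then have "(u, v, ShA C f1 \<cdot> g2) \<in> Tri ?D" using o unfolding full_sub_Tri by blast
    then show ?thesis using uv o unfolding full_sub_simps Bex_def full_sub_Hom by blast
  qed
qed

end

end

section \<open>Resolutions by objects of \<open>Z\<close>\<close>

text \<open>The stable t-structure and the two torsion pairs, unfolded into decompositions, double
  perpendiculars and thickness. Thickness of \<open>X\<close> and \<open>Y\<close> and the inclusion
  \<open>X \<subseteq> left_perp C Y\<close> are consequences, proved when the locale is
  instantiated.\<close>

locale torsion_setting = triangulated_category C
  for C :: "('o, 'm, 'z) tri_cat_scheme" (structure) +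
  fixes S X Y :: "'o set"
  assumes S_thick: "thick C S" and X_thick: "thick C X" and Y_thick: "thick C Y"
    and X_S: "X \<subseteq> S" and Y_S: "Y \<subseteq> S"
    and XY: "X \<subseteq> left_perp C Y"
    and X_eq: "left_perp C (right_perp C X) = X"
    and Y_eq: "right_perp C (left_perp C Y) = Y"
    and decomp_X: "t \<in> Obj C \<Longrightarrow> \<exists>f g h x z. x \<in> X \<and> z \<in> right_perp C X \<and> tri C f g h x t z"
    and decomp_Y: "t \<in> Obj C \<Longrightarrow> \<exists>f g h w y. w \<in> left_perp C Y \<and> y \<in> Y \<and> tri C f g h w t y"
    and decomp_S: "t \<in> S \<Longrightarrow> \<exists>f g h x y. x \<in> X \<and> y \<in> Y \<and> tri C f g h x t y"
begin

text \<open>\<open>V\<close> is where the torsion pair with torsion-free part \<open>Y\<close>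
  coreflects, \<open>W\<close> where the one with torsion part \<open>X\<close> reflects.\<close>

definition V where "V = left_perp C Y"
definition W where "W = right_perp C X"
text \<open>The perpendicular to \<open>Y\<close> stands for the one to its shift; they agree
  because \<open>Y\<close> is closed under the shift.\<close>

definition Z where "Z = V \<inter> W"

lemma V_thick: "thick C V" and W_thick: "thick C W"
  unfolding V_def W_def using left_perp_thick right_perp_thick thick_shift_closed X_thick Y_thick by blast+

lemmas V_shift = thick_shift_closed[OF V_thick] and W_shift = thick_shift_closed[OF W_thick]

lemma Z_thick: "thick C Z"
proof -
  obtain z where "zero_object C z" using zero_object_exists by blast
  then have "z \<in> V" "z \<in> W" using thick_zero V_thick W_thick by blast+
  then show ?thesis unfolding Z_def by (intro thick_Int V_thick W_thick) blast
qed

lemma Z_VW: "z \<in> Z \<Longrightarrow> z \<in> V" "z \<in> Z \<Longrightarrow> z \<in> W" by (auto simp: Z_def)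

lemma X_V: "x \<in> X \<Longrightarrow> x \<in> V" using XY unfolding V_def by blast

text \<open>By \<open>Y_eq\<close>, \<open>Y\<close> is the right perpendicular of \<open>V\<close>,
  so the two cone criteria combine to an equivalence.\<close>

lemma colocal_iff: "e \<in> Arr C \<Longrightarrow> colocal C V e \<longleftrightarrow> e \<in> cone_in C Y"
proof
  assume e: "e \<in> Arr C" "colocal C V e"
  then have "e \<in> Hom C (Dom C e) (Cod C e)" by (simp add: Hom_iff)
  from tri_cone[OF this] obtain c g h where t: "tri C e g h (Dom C e) (Cod C e) c" .
  from cone_of_colocal[OF V_shift t e(2)] have "c \<in> Y" unfolding V_def Y_eq .
  then show "e \<in> cone_in C Y" by (rule cone_inI[OF t])
next
  assume "e \<in> cone_in C Y"
  then obtain a b c g h where "tri C e g h a b c" "c \<in> right_perp C V"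
    unfolding cone_in_iff V_def Y_eq by blast
  then show "colocal C V e" by (rule colocal_of_cone[OF V_shift])
qed

text \<open>The same equivalence on the other side, with \<open>X\<close> the left perpendicular of
  \<open>W\<close>.\<close>

lemma local_iff: "p \<in> Arr C \<Longrightarrow> local C W p \<longleftrightarrow> p \<in> cone_in C X"
proof
  assume p: "p \<in> Arr C" "local C W p"
  then have "p \<in> Hom C (Dom C p) (Cod C p)" by (simp add: Hom_iff)
  from tri_cone[OF this] obtain c g h where t: "tri C p g h (Dom C p) (Cod C p) c" .
  from cone_of_local[OF W_shift t p(2)] have "c \<in> X" unfolding W_def X_eq .
  then show "p \<in> cone_in C X" by (rule cone_inI[OF t])
next
  assume "p \<in> cone_in C X"
  then obtain a b c g h where "tri C p g h a b c" "c \<in> left_perp C W"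
    unfolding cone_in_iff W_def X_eq by blast
  then show "local C W p" by (rule local_of_cone[OF W_shift])
qed

text \<open>Both legs of a resolution \<open>t \<leftarrow> w \<rightarrow> z\<close> become invertible modulo \<open>S\<close>; the first is the
  coreflection of \<open>t\<close> into \<open>V\<close>, the second the reflection of \<open>w\<close> into \<open>W\<close>.\<close>

definition res :: "'o \<Rightarrow> 'o \<Rightarrow> 'o \<Rightarrow> 'm \<Rightarrow> 'm \<Rightarrow> bool" where
  "res t w z e p \<longleftrightarrow> e \<in> Hom C w t \<and> p \<in> Hom C w z \<and> w \<in> V \<and> z \<in> Z \<and>
     e \<in> cone_in C Y \<and> p \<in> cone_in C X"

lemma resD:
  assumes "res t w z e p"
  shows "e \<in> Hom C w t" "p \<in> Hom C w z" "w \<in> V" "z \<in> Z" "e \<in> cone_in C Y" "p \<in> cone_in C X"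
    "colocal C V e" "local C W p" "t \<in> Obj C" "w \<in> Obj C" "z \<in> Obj C"
proof -
  show H: "e \<in> Hom C w t" "p \<in> Hom C w z" "w \<in> V" "z \<in> Z" "e \<in> cone_in C Y" "p \<in> cone_in C X"
    using assms by (auto simp: res_def)
  show "colocal C V e" "local C W p"
    using colocal_iff[OF cone_in_Arr[OF H(5)]] local_iff[OF cone_in_Arr[OF H(6)]] H by auto
  show "t \<in> Obj C" "w \<in> Obj C" "z \<in> Obj C" using Hom_Obj[OF H(1)] Hom_Obj[OF H(2)] by auto
qed

text \<open>Coreflect \<open>t\<close> into \<open>V\<close>, then reflect the result
  \<open>w\<close> into \<open>W\<close>. The reflection \<open>z\<close> stays in \<open>V\<close>
  because both \<open>w\<close> and its \<open>X\<close>-part lie in the thick subcategory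
  \<open>V\<close>.\<close>

lemma res_exists:
  assumes "t \<in> Obj C"
  obtains w z e p where "res t w z e p"
proof -
  obtain e g h w y where w: "w \<in> V" and y: "y \<in> Y" and t: "tri C e g h w t y"
    using decomp_Y[OF assms] unfolding V_def by blast
  have "w \<in> Obj C" using tri_Obj[OF t] by blast
  then obtain i p k x z where x: "x \<in> X" and z: "z \<in> W" and t2: "tri C i p k x w z"
    using decomp_X unfolding W_def by blast
  have "z \<in> V" using thick_tri(1)[OF V_thick t2 X_V[OF x] w] .
  \<comment> \<open>The cone of \<open>p\<close> is the shift of the \<open>X\<close>-part, not the
    \<open>X\<close>-part itself.\<close>
  moreover have "ShO C x \<in> X" using thickD(3)[OF X_thick] tri_Obj[OF t2] x by blast
  ultimately have "res t w z e p"
    unfolding res_def Z_def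
    using triD(3)[OF t] triD(4)[OF t2] w z cone_inI[OF t y] cone_inI[OF tri_rot[OF t2]] by blast
  then show thesis by (rule that)
qed

lemma res_Ide:
  assumes "z \<in> Z"
  shows "res z z z (Ide C z) (Ide C z)"
  unfolding res_def using assms thickD(1)[OF Z_thick] Z_VW cone_in_Ide[OF X_thick] cone_in_Ide[OF Y_thick]
  by (auto intro: Ide_Hom)

lemma res_ShA:
  assumes "res t w z e p"
  shows "res (ShO C t) (ShO C w) (ShO C z) (ShA C e) (ShA C p)"
  unfolding res_def
  using resD[OF assms] thickD(3)[OF Z_thick] thickD(3)[OF V_thick] cone_in_ShA[OF X_thick] cone_in_ShA[OF Y_thick]
  by (auto intro: ShA_Hom)

text \<open>Colocality of \<open>e'\<close> lifts \<open>f \<cdot> e\<close> to the middle objects,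
  as \<open>w\<close> lies in \<open>V\<close>; locality of \<open>p\<close> extends the lift to the
  ends, as \<open>z'\<close> lies in \<open>W\<close>.\<close>

lemma lift_exists:
  assumes r: "res a w z e p" and r': "res b w' z' e' p'" and f: "f \<in> Hom C a b"
  obtains k h where "k \<in> Hom C w w'" "h \<in> Hom C z z'" "e' \<cdot> k = f \<cdot> e" "p' \<cdot> k = h \<cdot> p"
proof -
  note H = resD[OF r] and H' = resD[OF r']
  obtain k where k: "k \<in> Hom C w w'" "e' \<cdot> k = f \<cdot> e"
    using colocal_surj[OF H'(7) H'(1) H(3) Cmp_Hom[OF H(1) f]] .
  obtain h where "h \<in> Hom C z z'" "h \<cdot> p = p' \<cdot> k"
    using local_surj[OF H(8,2) Z_VW(2)[OF H'(4)] Cmp_Hom[OF k(1) H'(2)]] .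
  then show thesis using that k by simp
qed

lemma lift_unique:
  assumes r: "res a w z e p" and r': "res b w' z' e' p'"
    and k: "k \<in> Hom C w w'" "h \<in> Hom C z z'" "e' \<cdot> k = f \<cdot> e" "p' \<cdot> k = h \<cdot> p"
    and k2: "k2 \<in> Hom C w w'" "h2 \<in> Hom C z z'" "e' \<cdot> k2 = f \<cdot> e" "p' \<cdot> k2 = h2 \<cdot> p"
  shows "h = h2"
proof -
  note H = resD[OF r] and H' = resD[OF r']
  have "k = k2" by (rule colocal_inj[OF H'(7,1) H(3) k(1) k2(1)]) (simp only: k(3) k2(3))
  then have "h \<cdot> p = h2 \<cdot> p" using k(4) k2(4) by simp
  then show ?thesis by (rule local_inj[OF H(8,2) Z_VW(2)[OF H'(4)] k(2) k2(2)])
qed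

text \<open>Indexed by the legs of two resolutions instead of by the objects \<open>a\<close> and
  \<open>b\<close>: shifted resolutions and resolutions built from cones also occur, and these need
  not be chosen ones. Existence and uniqueness of lifts justify the \<open>THE\<close>.\<close>

definition L :: "'m \<Rightarrow> 'm \<Rightarrow> 'm \<Rightarrow> 'm \<Rightarrow> 'm \<Rightarrow> 'm" where
  "L e p e' p' f = (THE h. h \<in> Hom C (Cod C p) (Cod C p') \<and>
     (\<exists>k \<in> Hom C (Dom C e) (Dom C e'). e' \<cdot> k = f \<cdot> e \<and> p' \<cdot> k = h \<cdot> p))"

lemma L_eqI:
  assumes r: "res a w z e p" and r': "res b w' z' e' p'"
    and k: "k \<in> Hom C w w'" "h \<in> Hom C z z'" "e' \<cdot> k = f \<cdot> e" "p' \<cdot> k = h \<cdot> p"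
  shows "L e p e' p' f = h"
proof -
  have D: "Dom C e = w" "Dom C e' = w'" "Cod C p = z" "Cod C p' = z'"
    using resD(1,2)[OF r] resD(1,2)[OF r'] by (auto simp: Hom_iff)
  show ?thesis
    unfolding L_def D using k lift_unique[OF r r' _ _ _ _ k] by (intro the_equality) blast+
qed

lemma LE:
  assumes r: "res a w z e p" and r': "res b w' z' e' p'" and f: "f \<in> Hom C a b"
  obtains k where "k \<in> Hom C w w'" "L e p e' p' f \<in> Hom C z z'" "e' \<cdot> k = f \<cdot> e" "p' \<cdot> k = L e p e' p' f \<cdot> p"
proof -
  obtain k h where k: "k \<in> Hom C w w'" "h \<in> Hom C z z'" "e' \<cdot> k = f \<cdot> e" "p' \<cdot> k = h \<cdot> p"
    using lift_exists[OF assms] .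
  show thesis by (rule that[of k]) (use k L_eqI[OF r r' k] in simp_all)
qed

section \<open>Functoriality and exactness of the induced arrows\<close>

lemma L_Hom:
  assumes "res a w z e p" "res b w' z' e' p'" "f \<in> Hom C a b"
  shows "L e p e' p' f \<in> Hom C z z'"
  using LE[OF assms] by blast

lemma L_Ide:
  assumes r: "res a w z e p"
  shows "L e p e p (Ide C a) = Ide C z"
  using resD[OF r] by (intro L_eqI[OF r r Ide_Hom Ide_Hom]) (auto simp: Hom_iff)

lemma L_Ide_Z:
  assumes "f \<in> Hom C a b" "a \<in> Z" "b \<in> Z"
  shows "L (Ide C a) (Ide C a) (Ide C b) (Ide C b) f = f"
  by (rule L_eqI[OF res_Ide res_Ide assms(1,1)]) (use assms Hom_Obj[OF assms(1)] in \<open>simp_all add: Hom_iff\<close>)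

lemma L_Cmp:
  assumes r1: "res a1 w1 z1 e1 p1" and r2: "res a2 w2 z2 e2 p2" and r3: "res a3 w3 z3 e3 p3"
    and f: "f \<in> Hom C a1 a2" and g: "g \<in> Hom C a2 a3"
  shows "L e1 p1 e3 p3 (g \<cdot> f) = L e2 p2 e3 p3 g \<cdot> L e1 p1 e2 p2 f"
proof -
  obtain k where k: "k \<in> Hom C w1 w2" "L e1 p1 e2 p2 f \<in> Hom C z1 z2" "e2 \<cdot> k = f \<cdot> e1" "p2 \<cdot> k = L e1 p1 e2 p2 f \<cdot> p1"
    using LE[OF r1 r2 f] .
  obtain l where l: "l \<in> Hom C w2 w3" "L e2 p2 e3 p3 g \<in> Hom C z2 z3" "e3 \<cdot> l = g \<cdot> e2" "p3 \<cdot> l = L e2 p2 e3 p3 g \<cdot> p2"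
    using LE[OF r2 r3 g] .
  show ?thesis
    by (rule L_eqI[OF r1 r3 Cmp_Hom[OF k(1) l(1)] Cmp_Hom[OF k(2) l(2)]])
      (use resD(1,2)[OF r1] resD(1,2)[OF r2] resD(1,2)[OF r3] k l f g in
        \<open>simp_all add: Hom_iff reassoc[OF l(3)] reassoc[OF l(4)]\<close>)
qed

lemma L_Add:
  assumes r: "res a w z e p" and r': "res b w' z' e' p'" and f: "f \<in> Hom C a b" and g: "g \<in> Hom C a b"
  shows "L e p e' p' (Add C f g) = Add C (L e p e' p' f) (L e p e' p' g)"
proof -
  note H = resD[OF r] and H' = resD[OF r']
  obtain k where k: "k \<in> Hom C w w'" "L e p e' p' f \<in> Hom C z z'" "e' \<cdot> k = f \<cdot> e" "p' \<cdot> k = L e p e' p' f \<cdot> p"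
    using LE[OF r r' f] .
  obtain l where l: "l \<in> Hom C w w'" "L e p e' p' g \<in> Hom C z z'" "e' \<cdot> l = g \<cdot> e" "p' \<cdot> l = L e p e' p' g \<cdot> p"
    using LE[OF r r' g] .
  show ?thesis
    by (rule L_eqI[OF r r' Add_Hom[OF k(1) l(1)] Add_Hom[OF k(2) l(2)]])
      (simp_all add: Cmp_Add_right[OF k(1) l(1) H'(1)] Cmp_Add_right[OF k(1) l(1) H'(2)]
        Cmp_Add_left[OF H(1) f g] Cmp_Add_left[OF H(2) k(2) l(2)] k(3,4) l(3,4))
qed

lemma L_Zer:
  assumes r: "res a w z e p" and r': "res b w' z' e' p'"
  shows "L e p e' p' (Zer C a b) = Zer C z z'"
  by (rule L_eqI[OF r r' Zer_Hom Zer_Hom]) (use resD[OF r] resD[OF r'] in \<open>auto simp: Hom_iff\<close>)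

lemma L_ShA:
  assumes r: "res a w z e p" and r': "res b w' z' e' p'" and f: "f \<in> Hom C a b"
  shows "L (ShA C e) (ShA C p) (ShA C e') (ShA C p') (ShA C f) = ShA C (L e p e' p' f)"
proof -
  note H = resD[OF r] and H' = resD[OF r']
  obtain k where k: "k \<in> Hom C w w'" "L e p e' p' f \<in> Hom C z z'" "e' \<cdot> k = f \<cdot> e" "p' \<cdot> k = L e p e' p' f \<cdot> p"
    using LE[OF r r' f] .
  show ?thesis
    by (rule L_eqI[OF res_ShA[OF r] res_ShA[OF r'] ShA_Hom[OF k(1)] ShA_Hom[OF k(2)]])
      (use H H' k f in \<open>simp_all add: Hom_iff flip: ShA_Cmp\<close>)
qed

lemma L_iso:
  assumes r: "res a w z e p" and r': "res b w' z' e' p'" and f: "f \<in> Hom C a b" "iso_arr C f"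
  shows "iso_arr C (L e p e' p' f)"
proof -
  obtain g where g: "g \<in> Hom C b a" "g \<cdot> f = Ide C a" "f \<cdot> g = Ide C b" using iso_arr_inverse[OF f(2,1)] .
  show ?thesis
    by (rule iso_arrI[OF L_Hom[OF r r' f(1)] L_Hom[OF r' r g(1)]])
      (simp_all add: g L_Ide[OF r] L_Ide[OF r'] flip: L_Cmp[OF r r' r f(1) g(1)] L_Cmp[OF r' r r' g(1) f(1)])
qed

text \<open>A resolution of \<open>c\<close> is built from the cone of the lift \<open>k\<close> and
  the cone of the induced arrow; two TR3 completions are its legs, with cones in \<open>Y\<close>
  and \<open>X\<close> by the five lemma. For this resolution the claim is the cone triangle itself,
  and \<open>L_iso\<close> passes to the given one.\<close>

lemma L_tri:
  assumes r1: "res a w1 z1 e1 p1" and r2: "res b w2 z2 e2 p2" and r3: "res c w3 z3 e3 p3"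
    and t: "tri C f g h a b c"
  shows "tri C (L e1 p1 e2 p2 f) (L e2 p2 e3 p3 g) (L e3 p3 (ShA C e1) (ShA C p1) h) z1 z2 z3"
proof -
  note H1 = resD[OF r1] and H2 = resD[OF r2] and T = triD(3-5)[OF t]
  note r1' = res_ShA[OF r1]
  obtain k where k: "k \<in> Hom C w1 w2" "L e1 p1 e2 p2 f \<in> Hom C z1 z2" "e2 \<cdot> k = f \<cdot> e1" "p2 \<cdot> k = L e1 p1 e2 p2 f \<cdot> p1"
    using LE[OF r1 r2 T(1)] .
  obtain w g1 h1 where t1: "tri C k g1 h1 w1 w2 w" using tri_cone[OF k(1)] .
  obtain z g2 h2 where t2: "tri C (L e1 p1 e2 p2 f) g2 h2 z1 z2 z" using tri_cone[OF k(2)] .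
  obtain e where e: "e \<in> Hom C w c" "e \<cdot> g1 = g \<cdot> e2" "ShA C e1 \<cdot> h1 = h \<cdot> e"
    using tri_map[OF t1 t H1(1) H2(1) k(3)] .
  obtain p where p: "p \<in> Hom C w z" "p \<cdot> g1 = g2 \<cdot> p2" "ShA C p1 \<cdot> h1 = h2 \<cdot> p"
    using tri_map[OF t1 t2 H1(2) H2(2) k(4)] .
  have eY: "e \<in> cone_in C Y"
    using colocal_five[OF V_shift t t1 H1(1) H2(1) e(1) H1(7) H2(7) k(3) e(2,3)] colocal_iff e(1)
    by (simp add: Hom_iff)
  have pX: "p \<in> cone_in C X"
    using local_five[OF W_shift t2 t1 H1(2) H2(2) p(1) H1(8) H2(8) k(4) p(2,3)] local_iff p(1)
    by (simp add: Hom_iff)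
  have r: "res c w z e p"
    unfolding res_def
    using e(1) p(1) eY pX thick_tri(1)[OF V_thick t1 H1(3) H2(3)] thick_tri(1)[OF Z_thick t2 H1(4) H2(4)] by blast
  \<comment> \<open>The commuting squares of the completions say that \<open>g2\<close> and
    \<open>h2\<close> are themselves induced arrows.\<close>
  have g2: "L e2 p2 e p g = g2" using L_eqI[OF r2 r triD(4)[OF t1] triD(4)[OF t2] e(2) p(2)] .
  have h2: "L e p (ShA C e1) (ShA C p1) h = h2"
    using L_eqI[OF r r1' triD(5)[OF t1] triD(5)[OF t2] e(3) p(3)] .
  have c: "Ide C c \<in> Hom C c c" using Ide_Hom tri_Obj[OF t] by blast
  note i = L_Hom[OF r r3 c]
  show ?thesis
  proof (rule tri_iso[OF t2 Ide_Hom[OF H1(11)] Ide_Hom[OF H2(11)] i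
        iso_arr_Ide[OF H1(11)] iso_arr_Ide[OF H2(11)] L_iso[OF r r3 c]])
    show "iso_arr C (Ide C c)" using iso_arr_Ide tri_Obj[OF t] by blast
    show "L e p e3 p3 (Ide C c) \<cdot> g2 = L e2 p2 e3 p3 g \<cdot> Ide C z2"
      using L_Cmp[OF r2 r r3 T(2) c] T(2) L_Hom[OF r2 r3 T(2)] by (simp add: g2 Hom_iff)
    show "ShA C (Ide C z1) \<cdot> h2 = L e3 p3 (ShA C e1) (ShA C p1) h \<cdot> L e p e3 p3 (Ide C c)"
      using L_Cmp[OF r r3 r1' c T(3)] T(3) triD(5)[OF t2] H1(11) by (simp add: h2 Hom_iff)
  qed (use k(2) H1 H2 L_Hom[OF r2 r3 T(2)] L_Hom[OF r3 r1' T(3)] in \<open>simp_all add: Hom_iff\<close>)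
qed

text \<open>For \<open>s\<close> in \<open>S\<close> the arrow \<open>x \<rightarrow> s\<close> of
  its decomposition already serves as coreflection into \<open>V\<close>, since
  \<open>X \<subseteq> V\<close> and its cone is \<open>y\<close>; the reflection of
  \<open>x\<close> into \<open>W\<close> is zero.\<close>

lemma res_zero:
  assumes "s \<in> S"
  obtains w z e p where "res s w z e p" "zero_object C z"
proof -
  obtain e g h x y where x: "x \<in> X" and y: "y \<in> Y" and t: "tri C e g h x s y" using decomp_S[OF assms] by blast
  obtain z where z: "zero_object C z" using zero_object_exists by blast
  have o: "x \<in> Obj C" "z \<in> Obj C" using tri_Obj[OF t] z by (auto simp: zero_object_iff)
  have "Zer C x z \<in> cone_in C X"
    using cone_inI[OF tri_rot[OF tri_Ide[OF o(1) z]]] thickD(3)[OF X_thick o(1)] x by blast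
  then have "res s x z e (Zer C x z)"
    unfolding res_def
    using triD(3)[OF t] X_V[OF x] cone_inI[OF t y] Zer_Hom[OF o] thick_zero[OF Z_thick z] by blast
  then show thesis using that z by blast
qed

text \<open>The cone of \<open>s\<close> has a resolution ending in zero, so the image triangle has
  a zero cone.\<close>

lemma L_inverts:
  assumes r1: "res a w1 z1 e1 p1" and r2: "res b w2 z2 e2 p2" and s: "s \<in> Hom C a b" "s \<in> cone_in C S"
  shows "iso_arr C (L e1 p1 e2 p2 s)"
proof -
  obtain g h c where c: "c \<in> S" and t: "tri C s g h a b c" using cone_inE[OF s(2,1)] .
  obtain w z e p where r3: "res c w z e p" and z: "zero_object C z" using res_zero[OF c] .
  show ?thesis by (rule iso_of_zero_cone[OF L_tri[OF r1 r2 r3 t] z])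
qed

lemma cone_in_leg:
  assumes "res a w z e p"
  shows "e \<in> cone_in C S" "p \<in> cone_in C S"
  using cone_in_mono[OF resD(5)[OF assms] Y_S] cone_in_mono[OF resD(6)[OF assms] X_S] by blast+

text \<open>The lift \<open>k\<close> of \<open>f\<close> is killed by \<open>p2\<close>, so it
  factors as \<open>i \<cdot> q\<close> through the fibre \<open>x\<close> of \<open>p2\<close>,
  which lies in \<open>X\<close>. The fibre \<open>u\<close> of \<open>q\<close> has cone
  \<open>x\<close>, and \<open>f\<close> vanishes on \<open>e1 \<cdot> u\<close>. This is the
  faithfulness half of the comparison with the quotient.\<close>

lemma L_eq_Zer:
  assumes r1: "res a w1 z1 e1 p1" and r2: "res b w2 z2 e2 p2" and f: "f \<in> Hom C a b"
    and 0: "L e1 p1 e2 p2 f = Zer C z1 z2"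
  obtains d u where "u \<in> Hom C d a" "u \<in> cone_in C S" "f \<cdot> u = Zer C d b"
proof -
  note H1 = resD[OF r1] and H2 = resD[OF r2]
  obtain k where k: "k \<in> Hom C w1 w2" "e2 \<cdot> k = f \<cdot> e1" "p2 \<cdot> k = Zer C z1 z2 \<cdot> p1"
    using LE[OF r1 r2 f] unfolding 0 by blast
  obtain x i h where t: "tri C i p2 h x w2 z2" using tri_fibre[OF H2(2)] .
  have xX: "ShO C x \<in> X"
    using cone_of_local[OF W_shift tri_rot[OF t] H2(8)] unfolding W_def X_eq .
  have "p2 \<cdot> k = Zer C w1 z2" using k H1 H2 by (simp add: Hom_iff)
  from exact_left[OF t k(1) this] obtain q where q: "q \<in> Hom C w1 x" "i \<cdot> q = k" .
  obtain d u m where t': "tri C u q m d w1 x" using tri_fibre[OF q(1)] .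
  have "x \<in> S" using xX thickD(3)[OF X_thick] tri_Obj[OF t] X_S by blast
  then have u: "u \<in> cone_in C S" by (rule cone_inI[OF t'])
  note uH = triD(3)[OF t'] and iH = triD(3)[OF t]
  have o: "d \<in> Obj C" "x \<in> Obj C" "b \<in> Obj C" using tri_Obj[OF t'] Hom_Obj[OF f] by auto
  have "k \<cdot> u = i \<cdot> (q \<cdot> u)" using q(1) uH iH by (simp add: Hom_iff reassoc[OF q(2)])
  then have ku: "k \<cdot> u = Zer C d w2" using iH o by (simp add: Hom_iff tri_Cmp_Zer(1)[OF t'])
  have "f \<cdot> (e1 \<cdot> u) = e2 \<cdot> (k \<cdot> u)"
    using H1 H2 k(1) f uH by (simp add: Hom_iff reassoc[OF k(2)])
  also have "\<dots> = Zer C d b" using H2 o by (simp add: ku Hom_iff)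
  finally have "f \<cdot> (e1 \<cdot> u) = Zer C d b" .
  then show thesis
    using that[OF Cmp_Hom[OF uH H1(1)] cone_in_Cmp[OF S_thick u uH cone_in_leg(1)[OF r1] H1(1)]] by blast
qed

text \<open>The fullness half of the comparison: an Ore square on \<open>h \<cdot> p1\<close> and
  \<open>p2\<close> gives the roof with legs \<open>e1 \<cdot> u\<close> and
  \<open>e2 \<cdot> k\<close>. The equation is stated for every resolution of the apex
  \<open>d\<close>, since none is distinguished at this stage.\<close>

lemma L_roof:
  assumes r1: "res a w1 z1 e1 p1" and r2: "res b w2 z2 e2 p2" and h: "h \<in> Hom C z1 z2"
  obtains d s f where "s \<in> cone_in C S" "s \<in> Hom C d a" "f \<in> Hom C d b"
    "\<And>w z e p. res d w z e p \<Longrightarrow> h \<cdot> L e p e1 p1 s = L e p e2 p2 f"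
proof -
  note H1 = resD[OF r1] and H2 = resD[OF r2]
  obtain d u k where u: "u \<in> cone_in C S" "u \<in> Hom C d w1" and k: "k \<in> Hom C d w2" "(h \<cdot> p1) \<cdot> u = p2 \<cdot> k"
    using Ore[OF cone_in_leg(2)[OF r2] H2(2) Cmp_Hom[OF H1(2) h]] .
  note eu = Cmp_Hom[OF u(2) H1(1)] and ek = Cmp_Hom[OF k(1) H2(1)]
  show thesis
  proof (rule that[OF cone_in_Cmp[OF S_thick u cone_in_leg(1)[OF r1] H1(1)] eu ek])
    fix w z e p assume r: "res d w z e p"
    note H = resD[OF r]
    obtain l where l: "l \<in> Hom C w w1" "L e p e1 p1 (e1 \<cdot> u) \<in> Hom C z z1" "e1 \<cdot> l = (e1 \<cdot> u) \<cdot> e"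
       "p1 \<cdot> l = L e p e1 p1 (e1 \<cdot> u) \<cdot> p"
      using LE[OF r r1 eu] .
    \<comment> \<open>Both are lifts through \<open>e1\<close> of the same arrow, which makes the
      abstract lift explicit.\<close>
    have "l = u \<cdot> e"
      by (rule colocal_inj[OF H1(7,1) H(3) l(1) Cmp_Hom[OF H(1) u(2)]])
        (use l(3) H1 H u in \<open>simp add: Hom_iff\<close>)
    note l = l(2) l(4)[unfolded this]
    show "h \<cdot> L e p e1 p1 (e1 \<cdot> u) = L e p e2 p2 (e2 \<cdot> k)"
    proof (rule L_eqI[OF r r2 Cmp_Hom[OF H(1) k(1)] Cmp_Hom[OF l(1) h], symmetric])
      show "e2 \<cdot> (k \<cdot> e) = (e2 \<cdot> k) \<cdot> e" using H H2 k(1) by (simp add: Hom_iff)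
      have "p2 \<cdot> (k \<cdot> e) = ((h \<cdot> p1) \<cdot> u) \<cdot> e" using H H2 k(1) by (simp add: Hom_iff flip: k(2) assoc)
      also have "\<dots> = h \<cdot> (L e p e1 p1 (e1 \<cdot> u) \<cdot> p)" using H H1 u h by (simp add: Hom_iff flip: l(2))
      finally show "p2 \<cdot> (k \<cdot> e) = (h \<cdot> L e p e1 p1 (e1 \<cdot> u)) \<cdot> p" using H l(1) h by (simp add: Hom_iff)
    qed
  qed
qed

end

section \<open>Transport of a triangulated structure along an equivalence\<close>

text \<open>\<open>U\<close> is a bare record here. The bijections \<open>\<Phi>\<close> on
  Hom-sets, compatible with every operation, let each law be checked in \<open>D\<close>;
  \<open>\<kappa>\<close> records that \<open>R\<close> commutes with the shift only up to
  isomorphism. Triangles of \<open>U\<close> are left out, because identifying those of the quotient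
  already uses results of this locale.\<close>

locale shift_transport = D: triangulated_category D
  for D :: "('o, 'm, 'z) tri_cat_scheme" +
  fixes U :: "('p, 'n, 'w) tri_cat_scheme" and R :: "'p \<Rightarrow> 'o" and \<Phi> :: "'n \<Rightarrow> 'm" and \<kappa> :: "'p \<Rightarrow> 'm"
  assumes U_Obj: "f \<in> Arr U \<Longrightarrow> Dom U f \<in> Obj U \<and> Cod U f \<in> Obj U"
    and R_Obj: "a \<in> Obj U \<Longrightarrow> R a \<in> Obj D"
    and R_surj: "d \<in> Obj D \<Longrightarrow> \<exists>a\<in>Obj U. isomorphic D (R a) d"
    and \<Phi>_bij: "\<lbrakk>a \<in> Obj U; b \<in> Obj U\<rbrakk> \<Longrightarrow> bij_betw \<Phi> (Hom U a b) (Hom D (R a) (R b))"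
    and \<Phi>_Ide: "a \<in> Obj U \<Longrightarrow> Ide U a \<in> Hom U a a \<and> \<Phi> (Ide U a) = Ide D (R a)"
    and \<Phi>_Cmp: "\<lbrakk>f \<in> Hom U a b; g \<in> Hom U b c\<rbrakk>
      \<Longrightarrow> g \<cdot>\<^bsub>U\<^esub> f \<in> Hom U a c \<and> \<Phi> (g \<cdot>\<^bsub>U\<^esub> f) = \<Phi> g \<cdot>\<^bsub>D\<^esub> \<Phi> f"
    and \<Phi>_Add: "\<lbrakk>f \<in> Hom U a b; g \<in> Hom U a b\<rbrakk>
      \<Longrightarrow> Add U f g \<in> Hom U a b \<and> \<Phi> (Add U f g) = Add D (\<Phi> f) (\<Phi> g)"
    and \<Phi>_Zer: "\<lbrakk>a \<in> Obj U; b \<in> Obj U\<rbrakk> \<Longrightarrow> Zer U a b \<in> Hom U a b \<and> \<Phi> (Zer U a b) = Zer D (R a) (R b)"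
    and U_ShO: "a \<in> Obj U \<Longrightarrow> ShO U a \<in> Obj U"
    and \<kappa>_iso: "a \<in> Obj U \<Longrightarrow> \<kappa> a \<in> Hom D (R (ShO U a)) (ShO D (R a)) \<and> iso_arr D (\<kappa> a)"
    and \<Phi>_ShA: "f \<in> Hom U a b \<Longrightarrow> ShA U f \<in> Hom U (ShO U a) (ShO U b) \<and>
      \<kappa> b \<cdot>\<^bsub>D\<^esub> \<Phi> (ShA U f) = ShA D (\<Phi> f) \<cdot>\<^bsub>D\<^esub> \<kappa> a"
begin

lemma \<Phi>_Hom: "f \<in> Hom U a b \<Longrightarrow> \<Phi> f \<in> Hom D (R a) (R b)"
proof -
  assume f: "f \<in> Hom U a b"
  then have "a \<in> Obj U" "b \<in> Obj U" using U_Obj by (auto simp: Hom_iff)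
  then show ?thesis using \<Phi>_bij[of a b] f by (auto simp: bij_betw_def)
qed

lemma U_Hom_Obj: "f \<in> Hom U a b \<Longrightarrow> a \<in> Obj U \<and> b \<in> Obj U"
  using U_Obj by (auto simp: Hom_iff)

lemma \<Phi>_inj: "\<lbrakk>\<Phi> f = \<Phi> g; f \<in> Hom U a b; g \<in> Hom U a b\<rbrakk> \<Longrightarrow> f = g"
  using \<Phi>_bij[of a b] U_Hom_Obj[of f a b] by (simp add: bij_betw_def inj_on_def)

lemma \<Phi>_surj:
  assumes "h \<in> Hom D (R a) (R b)" "a \<in> Obj U" "b \<in> Obj U"
  obtains f where "f \<in> Hom U a b" "\<Phi> f = h"
proof -
  have "h \<in> \<Phi> ` Hom U a b" using \<Phi>_bij[of a b] assms by (simp add: bij_betw_def)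
  then show thesis using that by blast
qed

lemma U_category: "category U"
proof
  fix f g h a b c d
  assume f: "f \<in> Hom U a b"
  note o = U_Hom_Obj[OF f]
  note F = \<Phi>_Hom[OF f]
  have ia: "Ide U a \<in> Hom U a a" "\<Phi> (Ide U a) = Ide D (R a)"
    and ib: "Ide U b \<in> Hom U b b" "\<Phi> (Ide U b) = Ide D (R b)" using \<Phi>_Ide o by auto
  show "f \<cdot>\<^bsub>U\<^esub> Ide U a = f"
    by (rule \<Phi>_inj[OF _ _ f]) (use \<Phi>_Cmp[OF ia(1) f] ia(2) F in \<open>simp_all add: Hom_iff\<close>)
  show "Ide U b \<cdot>\<^bsub>U\<^esub> f = f"
    by (rule \<Phi>_inj[OF _ _ f]) (use \<Phi>_Cmp[OF f ib(1)] ib(2) F in \<open>simp_all add: Hom_iff\<close>)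
  assume g: "g \<in> Hom U b c"
  show "g \<cdot>\<^bsub>U\<^esub> f \<in> Hom U a c" using \<Phi>_Cmp[OF f g] by blast
  assume h: "h \<in> Hom U c d"
  note fg = \<Phi>_Cmp[OF f g] and gh = \<Phi>_Cmp[OF g h]
  have 1: "(h \<cdot>\<^bsub>U\<^esub> g) \<cdot>\<^bsub>U\<^esub> f \<in> Hom U a d" "\<Phi> ((h \<cdot>\<^bsub>U\<^esub> g) \<cdot>\<^bsub>U\<^esub> f) = (\<Phi> h \<cdot>\<^bsub>D\<^esub> \<Phi> g) \<cdot>\<^bsub>D\<^esub> \<Phi> f"
    using \<Phi>_Cmp[OF f conjunct1[OF gh]] gh by auto
  have 2: "h \<cdot>\<^bsub>U\<^esub> (g \<cdot>\<^bsub>U\<^esub> f) \<in> Hom U a d" "\<Phi> (h \<cdot>\<^bsub>U\<^esub> (g \<cdot>\<^bsub>U\<^esub> f)) = \<Phi> h \<cdot>\<^bsub>D\<^esub> (\<Phi> g \<cdot>\<^bsub>D\<^esub> \<Phi> f)"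
    using \<Phi>_Cmp[OF conjunct1[OF fg] h] fg by auto
  show "(h \<cdot>\<^bsub>U\<^esub> g) \<cdot>\<^bsub>U\<^esub> f = h \<cdot>\<^bsub>U\<^esub> (g \<cdot>\<^bsub>U\<^esub> f)"
    by (rule \<Phi>_inj[OF _ 1(1) 2(1)]) (simp add: 1(2) 2(2) D.Cmp_assoc[OF F \<Phi>_Hom[OF g] \<Phi>_Hom[OF h]])
qed (use U_Obj \<Phi>_Ide in auto)

sublocale U: category U by (rule U_category)

sublocale \<Phi>: cat_functor U D R \<Phi>
  by unfold_locales (use R_Obj \<Phi>_Hom \<Phi>_Ide \<Phi>_Cmp in auto)

lemma isomorphic_reflected:
  assumes "isomorphic D (R a) (R b)" "a \<in> Obj U" "b \<in> Obj U"
  shows "isomorphic U a b"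
proof -
  obtain h where h: "h \<in> Hom D (R a) (R b)" "iso_arr D h" using assms(1) by (auto simp: isomorphic_def)
  obtain f where f: "f \<in> Hom U a b" "\<Phi> f = h" using \<Phi>_surj[OF h(1) assms(2,3)] .
  then have "iso_arr U f" using \<Phi>.fully_faithful_reflects_iso[OF \<Phi>_bij f(1)] h by simp
  then show ?thesis using f by (auto simp: isomorphic_def)
qed

lemma \<Phi>_iso_arr_iff: "f \<in> Hom U a b \<Longrightarrow> iso_arr D (\<Phi> f) \<longleftrightarrow> iso_arr U f"
  using \<Phi>.fully_faithful_reflects_iso[OF \<Phi>_bij] \<Phi>.F1_iso_arr by blast

lemma zero_object_reflected:
  assumes "zero_object D (R a)" "a \<in> Obj U"
  shows "zero_object U a"
  unfolding zero_object_def
proof (intro conjI ballI assms(2))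
  fix b assume b: "b \<in> Obj U"
  note z1 = \<Phi>_Zer[OF b assms(2)] and z2 = \<Phi>_Zer[OF assms(2) b]
  show "\<exists>!f. f \<in> Hom U b a"
  proof (rule ex1I)
    show "Zer U b a \<in> Hom U b a" using z1 by blast
    show "f = Zer U b a" if "f \<in> Hom U b a" for f
      by (rule \<Phi>_inj[OF _ that]) (use z1 D.zero_object_Hom(1)[OF assms(1) \<Phi>_Hom[OF that]] in auto)
  qed
  show "\<exists>!f. f \<in> Hom U a b"
  proof (rule ex1I)
    show "Zer U a b \<in> Hom U a b" using z2 by blast
    show "f = Zer U a b" if "f \<in> Hom U a b" for f
      by (rule \<Phi>_inj[OF _ that]) (use z2 D.zero_object_Hom(2)[OF assms(1) \<Phi>_Hom[OF that]] in auto)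
  qed
qed

text \<open>Negatives are preimages under \<open>\<Phi>\<close> of negatives in \<open>D\<close>;
  the remaining laws are tested after \<open>\<Phi>\<close>.\<close>

lemma U_comm_group:
  assumes ab: "a \<in> Obj U" "b \<in> Obj U"
  shows "comm_group (hom_group U a b)"
proof (rule comm_groupI; simp add: hom_group_def)
  note z = \<Phi>_Zer[OF ab]
  note A = \<Phi>_Add[THEN conjunct1] and PA = \<Phi>_Add[THEN conjunct2]
  show "Zer U a b \<in> Hom U a b" using z by blast
  fix f assume f: "f \<in> Hom U a b"
  show "Add U (Zer U a b) f = f"
    by (rule \<Phi>_inj[OF _ A[OF _ f] f]) (use z in \<open>simp_all add: PA[OF _ f] D.Add_Zer_left[OF \<Phi>_Hom[OF f]]\<close>)
  obtain g where g: "g \<in> Hom U a b" "\<Phi> g = Neg D (\<Phi> f)" using \<Phi>_surj[OF D.Neg_Hom[OF \<Phi>_Hom[OF f]] ab] .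
  have "Add U g f = Zer U a b"
    by (rule \<Phi>_inj[OF _ A[OF g(1) f]]) (use z in \<open>simp_all add: PA[OF g(1) f] g(2) D.Add_Neg_left[OF \<Phi>_Hom[OF f]]\<close>)
  then show "\<exists>g\<in>Hom U a b. Add U g f = Zer U a b" using g by blast
  fix g assume g: "g \<in> Hom U a b"
  show "Add U f g \<in> Hom U a b" by (rule A[OF f g])
  show "Add U f g = Add U g f"
    by (rule \<Phi>_inj[OF _ A[OF f g] A[OF g f]])
      (simp add: PA[OF f g] PA[OF g f] D.Add_commute[OF \<Phi>_Hom[OF f] \<Phi>_Hom[OF g]])
  fix h assume h: "h \<in> Hom U a b"
  show "Add U (Add U f g) h = Add U f (Add U g h)"
    by (rule \<Phi>_inj[OF _ A[OF A[OF f g] h] A[OF f A[OF g h]]])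
      (simp add: PA[OF f g] PA[OF g h] PA[OF A[OF f g] h] PA[OF f A[OF g h]]
        D.Add_assoc[OF \<Phi>_Hom[OF f] \<Phi>_Hom[OF g] \<Phi>_Hom[OF h]])
qed

text \<open>The biproduct in \<open>D\<close> need not be of the form \<open>R p\<close>; its
  structure maps are conjugated by an isomorphism \<open>m\<close> from one that is, and then
  lifted.\<close>

lemma U_biproduct:
  assumes ab: "a \<in> Obj U" "b \<in> Obj U"
  shows "\<exists>p\<in>Obj U. \<exists>i j q r. biproduct U a b p i j q r"
proof -
  obtain p0 i0 j0 q0 r0 where p0: "p0 \<in> Obj D" and bi: "biproduct D (R a) (R b) p0 i0 j0 q0 r0"
    using D.biproduct_exists[OF R_Obj[OF ab(1)] R_Obj[OF ab(2)]] by blast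
  obtain p where p: "p \<in> Obj U" "isomorphic D (R p) p0" using R_surj[OF p0] by blast
  then obtain m where m: "m \<in> Hom D (R p) p0" "iso_arr D m" by (auto simp: isomorphic_def)
  obtain n where n: "n \<in> Hom D p0 (R p)" "n \<cdot>\<^bsub>D\<^esub> m = Ide D (R p)" "m \<cdot>\<^bsub>D\<^esub> n = Ide D p0"
    using D.iso_arr_inverse[OF m(2,1)] .
  have H: "i0 \<in> Hom D (R a) p0" "j0 \<in> Hom D (R b) p0" "q0 \<in> Hom D p0 (R a)" "r0 \<in> Hom D p0 (R b)"
    and E: "q0 \<cdot>\<^bsub>D\<^esub> i0 = Ide D (R a)" "r0 \<cdot>\<^bsub>D\<^esub> j0 = Ide D (R b)"
      "r0 \<cdot>\<^bsub>D\<^esub> i0 = Zer D (R a) (R b)" "q0 \<cdot>\<^bsub>D\<^esub> j0 = Zer D (R b) (R a)"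
    and A: "Add D (i0 \<cdot>\<^bsub>D\<^esub> q0) (j0 \<cdot>\<^bsub>D\<^esub> r0) = Ide D p0"
    using bi by (auto simp: biproduct_def)
  obtain i where i: "i \<in> Hom U a p" "\<Phi> i = n \<cdot>\<^bsub>D\<^esub> i0" using \<Phi>_surj[OF D.Cmp_Hom[OF H(1) n(1)] ab(1) p(1)] .
  obtain j where j: "j \<in> Hom U b p" "\<Phi> j = n \<cdot>\<^bsub>D\<^esub> j0" using \<Phi>_surj[OF D.Cmp_Hom[OF H(2) n(1)] ab(2) p(1)] .
  obtain q where q: "q \<in> Hom U p a" "\<Phi> q = q0 \<cdot>\<^bsub>D\<^esub> m" using \<Phi>_surj[OF D.Cmp_Hom[OF m(1) H(3)] p(1) ab(1)] .
  obtain r where r: "r \<in> Hom U p b" "\<Phi> r = r0 \<cdot>\<^bsub>D\<^esub> m" using \<Phi>_surj[OF D.Cmp_Hom[OF m(1) H(4)] p(1) ab(2)] .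
  note C = U.Cmp_Hom and PC = \<Phi>.F1_Cmp
  note a = \<Phi>_Ide[OF ab(1)] and b = \<Phi>_Ide[OF ab(2)] and ip = \<Phi>_Ide[OF p(1)]
  note z = \<Phi>_Zer[OF ab] \<Phi>_Zer[OF ab(2,1)]
  have "q \<cdot>\<^bsub>U\<^esub> i = Ide U a"
    by (rule \<Phi>_inj[OF _ C[OF i(1) q(1)]])
      (use a H m(1) n(1) E in \<open>simp_all add: PC[OF i(1) q(1)] i(2) q(2) Hom_iff D.reassoc[OF n(3)]\<close>)
  moreover have "r \<cdot>\<^bsub>U\<^esub> j = Ide U b"
    by (rule \<Phi>_inj[OF _ C[OF j(1) r(1)]])
      (use b H m(1) n(1) E in \<open>simp_all add: PC[OF j(1) r(1)] j(2) r(2) Hom_iff D.reassoc[OF n(3)]\<close>)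
  moreover have "r \<cdot>\<^bsub>U\<^esub> i = Zer U a b"
    by (rule \<Phi>_inj[OF _ C[OF i(1) r(1)]])
      (use z H m(1) n(1) E in \<open>simp_all add: PC[OF i(1) r(1)] i(2) r(2) Hom_iff D.reassoc[OF n(3)]\<close>)
  moreover have "q \<cdot>\<^bsub>U\<^esub> j = Zer U b a"
    by (rule \<Phi>_inj[OF _ C[OF j(1) q(1)]])
      (use z H m(1) n(1) E in \<open>simp_all add: PC[OF j(1) q(1)] j(2) q(2) Hom_iff D.reassoc[OF n(3)]\<close>)
  moreover have "Add U (i \<cdot>\<^bsub>U\<^esub> q) (j \<cdot>\<^bsub>U\<^esub> r) = Ide U p"
  proof (rule \<Phi>_inj)
    note iq = C[OF q(1) i(1)] and jr = C[OF r(1) j(1)]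
    note IQ = D.Cmp_Hom[OF H(3,1)] and JR = D.Cmp_Hom[OF H(4,2)]
    show "Add U (i \<cdot>\<^bsub>U\<^esub> q) (j \<cdot>\<^bsub>U\<^esub> r) \<in> Hom U p p" using \<Phi>_Add[OF iq jr] by blast
    show "Ide U p \<in> Hom U p p" using ip by blast
    have "n \<cdot>\<^bsub>D\<^esub> (Add D (i0 \<cdot>\<^bsub>D\<^esub> q0) (j0 \<cdot>\<^bsub>D\<^esub> r0) \<cdot>\<^bsub>D\<^esub> m) = Ide D (R p)"
      using m n by (simp add: A Hom_iff)
    also have "Add D (i0 \<cdot>\<^bsub>D\<^esub> q0) (j0 \<cdot>\<^bsub>D\<^esub> r0) \<cdot>\<^bsub>D\<^esub> m = Add D ((i0 \<cdot>\<^bsub>D\<^esub> q0) \<cdot>\<^bsub>D\<^esub> m) ((j0 \<cdot>\<^bsub>D\<^esub> r0) \<cdot>\<^bsub>D\<^esub> m)"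
      by (rule D.Cmp_Add_left[OF m(1) IQ JR])
    also have "n \<cdot>\<^bsub>D\<^esub> Add D ((i0 \<cdot>\<^bsub>D\<^esub> q0) \<cdot>\<^bsub>D\<^esub> m) ((j0 \<cdot>\<^bsub>D\<^esub> r0) \<cdot>\<^bsub>D\<^esub> m) =
        Add D (n \<cdot>\<^bsub>D\<^esub> ((i0 \<cdot>\<^bsub>D\<^esub> q0) \<cdot>\<^bsub>D\<^esub> m)) (n \<cdot>\<^bsub>D\<^esub> ((j0 \<cdot>\<^bsub>D\<^esub> r0) \<cdot>\<^bsub>D\<^esub> m))"
      by (rule D.Cmp_Add_right[OF D.Cmp_Hom[OF m(1) IQ] D.Cmp_Hom[OF m(1) JR] n(1)])
    finally show "\<Phi> (Add U (i \<cdot>\<^bsub>U\<^esub> q) (j \<cdot>\<^bsub>U\<^esub> r)) = \<Phi> (Ide U p)"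
      using \<Phi>_Add[OF iq jr] ip H m(1) n(1)
      by (simp add: PC[OF q(1) i(1)] PC[OF r(1) j(1)] i(2) j(2) q(2) r(2) Hom_iff)
  qed
  ultimately have "biproduct U a b p i j q r" using i j q r by (simp add: biproduct_def)
  then show ?thesis using p by blast
qed

lemma U_additive: "additive_category U"
proof (intro additive_category.intro U_category additive_category_axioms.intro U_comm_group U_biproduct)
  fix f f' g a b c assume f: "f \<in> Hom U a b" "f' \<in> Hom U a b" and g: "g \<in> Hom U b c"
  note A = \<Phi>_Add[OF f] \<Phi>_Add[OF U.Cmp_Hom[OF f(1) g] U.Cmp_Hom[OF f(2) g]]
  show "g \<cdot>\<^bsub>U\<^esub> Add U f f' = Add U (g \<cdot>\<^bsub>U\<^esub> f) (g \<cdot>\<^bsub>U\<^esub> f')"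
    by (rule \<Phi>_inj[OF _ U.Cmp_Hom[OF conjunct1[OF A(1)] g] conjunct1[OF A(2)]])
      (use A in \<open>simp add: \<Phi>.F1_Cmp[OF conjunct1[OF A(1)] g] \<Phi>.F1_Cmp[OF f(1) g] \<Phi>.F1_Cmp[OF f(2) g] D.Cmp_Add_right[OF \<Phi>_Hom[OF f(1)] \<Phi>_Hom[OF f(2)] \<Phi>_Hom[OF g]]\<close>)
next
  fix f g g' a b c assume f: "f \<in> Hom U a b" and g: "g \<in> Hom U b c" "g' \<in> Hom U b c"
  note A = \<Phi>_Add[OF g] \<Phi>_Add[OF U.Cmp_Hom[OF f g(1)] U.Cmp_Hom[OF f g(2)]]
  show "Add U g g' \<cdot>\<^bsub>U\<^esub> f = Add U (g \<cdot>\<^bsub>U\<^esub> f) (g' \<cdot>\<^bsub>U\<^esub> f)"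
    by (rule \<Phi>_inj[OF _ U.Cmp_Hom[OF f conjunct1[OF A(1)]] conjunct1[OF A(2)]])
      (use A in \<open>simp add: \<Phi>.F1_Cmp[OF f conjunct1[OF A(1)]] \<Phi>.F1_Cmp[OF f g(1)] \<Phi>.F1_Cmp[OF f g(2)] D.Cmp_Add_left[OF \<Phi>_Hom[OF f] \<Phi>_Hom[OF g(1)] \<Phi>_Hom[OF g(2)]]\<close>)
next
  \<comment> \<open>A zero object of \<open>D\<close> is only isomorphic to some \<open>R a\<close>;
    its vanishing identity is carried over to \<open>R a\<close>.\<close>
  obtain z where z: "zero_object D z" using D.zero_object_exists by blast
  then have zO: "z \<in> Obj D" "Ide D z = Zer D z z" using D.zero_object_iff by auto
  obtain a where a: "a \<in> Obj U" "isomorphic D (R a) z" using R_surj[OF zO(1)] by blast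
  then obtain m where m: "m \<in> Hom D (R a) z" "iso_arr D m" by (auto simp: isomorphic_def)
  obtain n where n: "n \<in> Hom D z (R a)" "n \<cdot>\<^bsub>D\<^esub> m = Ide D (R a)" "m \<cdot>\<^bsub>D\<^esub> n = Ide D z"
    using D.iso_arr_inverse[OF m(2,1)] .
  have "Ide D (R a) = Zer D (R a) (R a)"
    using n R_Obj[OF a(1)] D.zero_object_Hom(1)[OF z m(1)] by (auto simp: Hom_iff)
  then have "zero_object D (R a)" using R_Obj[OF a(1)] by (simp add: D.zero_object_iff)
  then show "\<exists>z. zero_object U z" using zero_object_reflected[OF _ a(1)] by blast
qed

sublocale U: additive_category U by (rule U_additive)

sublocale \<Phi>: additive_functor U D R \<Phi>
  by unfold_locales (use \<Phi>_Add in blast)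

section \<open>The shift of the transported category\<close>

lemma \<kappa>_Hom: "a \<in> Obj U \<Longrightarrow> \<kappa> a \<in> Hom D (R (ShO U a)) (ShO D (R a))"
  using \<kappa>_iso by blast

text \<open>The shift of an arrow is known only through the naturality square of
  \<open>\<kappa>\<close>, so arrows into a shifted object are compared after composing with
  it.\<close>

lemma \<kappa>_cancel:
  assumes "\<kappa> b \<cdot>\<^bsub>D\<^esub> \<Phi> f = \<kappa> b \<cdot>\<^bsub>D\<^esub> \<Phi> g" "f \<in> Hom U a (ShO U b)" "g \<in> Hom U a (ShO U b)" "b \<in> Obj U"
  shows "f = g"
  using \<kappa>_iso[OF assms(4)] D.iso_arr_cancel_left[of "\<kappa> b", OF _ _ \<Phi>_Hom[OF assms(2)] \<Phi>_Hom[OF assms(3)] assms(1)]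
  by (intro \<Phi>_inj[OF _ assms(2,3)]) blast

lemma U_shift: "cat_functor U U (ShO U) (ShA U)"
proof
  fix a assume a: "a \<in> Obj U"
  then have a': "ShO U a \<in> Obj U" by (rule U_ShO)
  note i = \<Phi>_Ide[OF a] and i' = \<Phi>_Ide[OF a']
  note s = \<Phi>_ShA[OF conjunct1[OF i]]
  show "ShA U (Ide U a) = Ide U (ShO U a)"
    by (rule \<kappa>_cancel[OF _ conjunct1[OF s] conjunct1[OF i'] a])
      (use s i i' \<kappa>_Hom[OF a] R_Obj[OF a] in \<open>simp add: Hom_iff\<close>)
next
  fix f g a b c assume f: "f \<in> Hom U a b" and g: "g \<in> Hom U b c"
  have o: "a \<in> Obj U" "b \<in> Obj U" "c \<in> Obj U" using U_Hom_Obj f g by blast+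
  note gf = U.Cmp_Hom[OF f g]
  note s = \<Phi>_ShA[OF f] \<Phi>_ShA[OF g] \<Phi>_ShA[OF gf]
  note S = s[THEN conjunct1] and K = s[THEN conjunct2]
  note H = \<Phi>_Hom[OF f] \<Phi>_Hom[OF g] \<kappa>_Hom[OF o(1)] \<kappa>_Hom[OF o(2)] \<kappa>_Hom[OF o(3)]
  show "ShA U (g \<cdot>\<^bsub>U\<^esub> f) = ShA U g \<cdot>\<^bsub>U\<^esub> ShA U f"
  proof (rule \<kappa>_cancel[OF _ S(3) U.Cmp_Hom[OF S(1,2)] o(3)])
    have "\<kappa> c \<cdot>\<^bsub>D\<^esub> \<Phi> (ShA U g \<cdot>\<^bsub>U\<^esub> ShA U f) = \<kappa> c \<cdot>\<^bsub>D\<^esub> (\<Phi> (ShA U g) \<cdot>\<^bsub>D\<^esub> \<Phi> (ShA U f))"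
      by (simp add: \<Phi>.F1_Cmp[OF S(1,2)])
    also have "\<dots> = ShA D (\<Phi> g) \<cdot>\<^bsub>D\<^esub> (\<kappa> b \<cdot>\<^bsub>D\<^esub> \<Phi> (ShA U f))"
      using H \<Phi>_Hom[OF S(1)] \<Phi>_Hom[OF S(2)] by (simp add: Hom_iff D.reassoc[OF K(2)])
    also have "\<dots> = ShA D (\<Phi> (g \<cdot>\<^bsub>U\<^esub> f)) \<cdot>\<^bsub>D\<^esub> \<kappa> a"
      using H by (simp add: K(1) \<Phi>.F1_Cmp[OF f g] Hom_iff D.ShA_Cmp)
    finally show "\<kappa> c \<cdot>\<^bsub>D\<^esub> \<Phi> (ShA U (g \<cdot>\<^bsub>U\<^esub> f)) = \<kappa> c \<cdot>\<^bsub>D\<^esub> \<Phi> (ShA U g \<cdot>\<^bsub>U\<^esub> ShA U f)"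
      using K(3) by simp
  qed
qed (use U_ShO \<Phi>_ShA in auto)

lemma U_shift_additive: "additive_functor U U (ShO U) (ShA U)"
proof (intro additive_functor.intro U_shift U_additive additive_functor_axioms.intro)
  fix f g a b assume f: "f \<in> Hom U a b" and g: "g \<in> Hom U a b"
  have o: "a \<in> Obj U" "b \<in> Obj U" using U_Hom_Obj f by blast+
  note fg = U.Add_Hom[OF f g]
  note s = \<Phi>_ShA[OF f] \<Phi>_ShA[OF g] \<Phi>_ShA[OF fg]
  note S = s[THEN conjunct1] and K = s[THEN conjunct2]
  note sH = D.ShA_Hom[OF \<Phi>_Hom[OF f]] D.ShA_Hom[OF \<Phi>_Hom[OF g]]
  show "ShA U (Add U f g) = Add U (ShA U f) (ShA U g)"
  proof (rule \<kappa>_cancel[OF _ S(3) U.Add_Hom[OF S(1,2)] o(2)])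
    have "\<kappa> b \<cdot>\<^bsub>D\<^esub> \<Phi> (Add U (ShA U f) (ShA U g)) = \<kappa> b \<cdot>\<^bsub>D\<^esub> Add D (\<Phi> (ShA U f)) (\<Phi> (ShA U g))"
      by (simp add: \<Phi>.F1_Add[OF S(1,2)])
    also have "\<dots> = Add D (ShA D (\<Phi> f) \<cdot>\<^bsub>D\<^esub> \<kappa> a) (ShA D (\<Phi> g) \<cdot>\<^bsub>D\<^esub> \<kappa> a)"
      by (simp add: D.Cmp_Add_right[OF \<Phi>_Hom[OF S(1)] \<Phi>_Hom[OF S(2)] \<kappa>_Hom[OF o(2)]] K(1,2))
    also have "\<dots> = Add D (ShA D (\<Phi> f)) (ShA D (\<Phi> g)) \<cdot>\<^bsub>D\<^esub> \<kappa> a"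
      by (rule D.Cmp_Add_left[OF \<kappa>_Hom[OF o(1)] sH, symmetric])
    also have "Add D (ShA D (\<Phi> f)) (ShA D (\<Phi> g)) = ShA D (\<Phi> (Add U f g))"
      by (simp add: \<Phi>.F1_Add[OF f g] D.shift_add.F1_Add[OF \<Phi>_Hom[OF f] \<Phi>_Hom[OF g]])
    finally show "\<kappa> b \<cdot>\<^bsub>D\<^esub> \<Phi> (ShA U (Add U f g)) = \<kappa> b \<cdot>\<^bsub>D\<^esub> \<Phi> (Add U (ShA U f) (ShA U g))"
      using K(3) by simp
  qed
qed

text \<open>\<open>\<kappa>\<close> carries an arrow between shifts to an arrow between shifts in
  \<open>D\<close>, where fullness of the shift applies. Essential surjectivity combines those of
  \<open>R\<close> and of the shift of \<open>D\<close>.\<close>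

lemma U_shift_equivalence: "equivalence_functor U U (ShO U) (ShA U)"
proof (rule cat_functor.equivalence_functorI[OF U_shift])
  fix a b assume o: "a \<in> Obj U" "b \<in> Obj U"
  have inj: "inj_on (ShA U) (Hom U a b)"
  proof (rule inj_onI)
    fix f g assume f: "f \<in> Hom U a b" and g: "g \<in> Hom U a b" and "ShA U f = ShA U g"
    then have "ShA D (\<Phi> f) \<cdot>\<^bsub>D\<^esub> \<kappa> a = ShA D (\<Phi> g) \<cdot>\<^bsub>D\<^esub> \<kappa> a"
      using \<Phi>_ShA[OF f] \<Phi>_ShA[OF g] by simp
    then have "ShA D (\<Phi> f) = ShA D (\<Phi> g)"
      using D.iso_arr_cancel_right[OF _ _ D.ShA_Hom[OF \<Phi>_Hom[OF f]] D.ShA_Hom[OF \<Phi>_Hom[OF g]]] \<kappa>_iso[OF o(1)]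
      by blast
    then have "\<Phi> f = \<Phi> g" by (rule D.shift_equiv.faithful[OF \<Phi>_Hom[OF f] \<Phi>_Hom[OF g]])
    then show "f = g" by (rule \<Phi>_inj[OF _ f g])
  qed
  have "h \<in> ShA U ` Hom U a b" if h: "h \<in> Hom U (ShO U a) (ShO U b)" for h
  proof -
    have ka: "\<kappa> a \<in> Hom D (R (ShO U a)) (ShO D (R a))" "iso_arr D (\<kappa> a)" using \<kappa>_iso[OF o(1)] by auto
    obtain n where n: "n \<in> Hom D (ShO D (R a)) (R (ShO U a))" "n \<cdot>\<^bsub>D\<^esub> \<kappa> a = Ide D (R (ShO U a))"
      using D.iso_arr_inverse[OF ka(2,1)] by metis
    have kh: "\<kappa> b \<cdot>\<^bsub>D\<^esub> \<Phi> h \<in> Hom D (R (ShO U a)) (ShO D (R b))"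
      using D.Cmp_Hom[OF \<Phi>_Hom[OF h] \<kappa>_Hom[OF o(2)]] .
    obtain f0 where f0: "f0 \<in> Hom D (R a) (R b)" "ShA D f0 = (\<kappa> b \<cdot>\<^bsub>D\<^esub> \<Phi> h) \<cdot>\<^bsub>D\<^esub> n"
      using D.shift_equiv.full[OF D.Cmp_Hom[OF n(1) kh] R_Obj[OF o(1)] R_Obj[OF o(2)]] .
    obtain f where f: "f \<in> Hom U a b" "\<Phi> f = f0" using \<Phi>_surj[OF f0(1) o] .
    note s = \<Phi>_ShA[OF f(1)]
    have "ShA U f = h"
    proof (rule \<kappa>_cancel[OF _ conjunct1[OF s] h o(2)])
      have "\<kappa> b \<cdot>\<^bsub>D\<^esub> \<Phi> (ShA U f) = ((\<kappa> b \<cdot>\<^bsub>D\<^esub> \<Phi> h) \<cdot>\<^bsub>D\<^esub> n) \<cdot>\<^bsub>D\<^esub> \<kappa> a"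
        using s f f0 by simp
      also have "\<dots> = \<kappa> b \<cdot>\<^bsub>D\<^esub> \<Phi> h" using n ka \<Phi>_Hom[OF h] \<kappa>_Hom[OF o(2)] by (simp add: Hom_iff)
      finally show "\<kappa> b \<cdot>\<^bsub>D\<^esub> \<Phi> (ShA U f) = \<kappa> b \<cdot>\<^bsub>D\<^esub> \<Phi> h" .
    qed
    then show ?thesis using f by blast
  qed
  then show "bij_betw (ShA U) (Hom U a b) (Hom U (ShO U a) (ShO U b))"
    unfolding bij_betw_def using inj \<Phi>_ShA by blast
next
  fix d assume d: "d \<in> Obj U"
  obtain x where x: "x \<in> Obj D" "isomorphic D (ShO D x) (R d)"
    using D.shift_equiv.essentially_surjective[OF R_Obj[OF d]] by blast
  obtain a where a: "a \<in> Obj U" "isomorphic D (R a) x" using R_surj[OF x(1)] by blast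
  have "isomorphic D (R (ShO U a)) (ShO D (R a))" using \<kappa>_iso[OF a(1)] by (auto simp: isomorphic_def)
  moreover have "isomorphic D (ShO D (R a)) (ShO D x)" by (rule D.shift_equiv.F0_isomorphic[OF a(2)])
  ultimately have "isomorphic D (R (ShO U a)) (R d)" using x(2) D.isomorphic_trans by blast
  then have "isomorphic U (ShO U a) d" by (rule isomorphic_reflected[OF _ U_ShO[OF a(1)] d])
  then show "\<exists>c\<in>Obj U. isomorphic U (ShO U c) d" using a by blast
qed

lemma is_triangleD:
  assumes "is_triangle U f g h a b c"
  shows "f \<in> Hom U a b" "g \<in> Hom U b c" "h \<in> Hom U c (ShO U a)" "a \<in> Obj U" "b \<in> Obj U" "c \<in> Obj U"
  using assms U_Hom_Obj[of f a b] U_Hom_Obj[of g b c] by (auto simp: is_triangle_def)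

lemma \<Phi>_is_triangle:
  assumes "is_triangle U f g h a b c"
  shows "\<Phi> f \<in> Hom D (R a) (R b)" "\<Phi> g \<in> Hom D (R b) (R c)" "\<kappa> a \<cdot>\<^bsub>D\<^esub> \<Phi> h \<in> Hom D (R c) (ShO D (R a))"
    "\<Phi> h \<in> Hom D (R c) (R (ShO U a))" "\<kappa> a \<in> Hom D (R (ShO U a)) (ShO D (R a))"
  using is_triangleD[OF assms] \<Phi>_Hom D.Cmp_Hom[OF \<Phi>_Hom \<kappa>_Hom] \<kappa>_Hom by auto

text \<open>Translates the third square of a map of triangles: by naturality, the correction by
  \<open>\<kappa>\<close> passes from the source to the target.\<close>

lemma \<kappa>_shift:
  assumes u: "u \<in> Hom U a a'" and h: "h \<in> Hom U c (ShO U a)"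
  shows "ShA D (\<Phi> u) \<cdot>\<^bsub>D\<^esub> (\<kappa> a \<cdot>\<^bsub>D\<^esub> \<Phi> h) = \<kappa> a' \<cdot>\<^bsub>D\<^esub> \<Phi> (ShA U u \<cdot>\<^bsub>U\<^esub> h)"
proof -
  note s = \<Phi>_ShA[OF u]
  have o: "a \<in> Obj U" "a' \<in> Obj U" using U_Hom_Obj[OF u] by auto
  have "\<kappa> a' \<cdot>\<^bsub>D\<^esub> \<Phi> (ShA U u \<cdot>\<^bsub>U\<^esub> h) = \<kappa> a' \<cdot>\<^bsub>D\<^esub> (\<Phi> (ShA U u) \<cdot>\<^bsub>D\<^esub> \<Phi> h)"
    using \<Phi>.F1_Cmp[OF h conjunct1[OF s]] by simp
  also have "\<dots> = ShA D (\<Phi> u) \<cdot>\<^bsub>D\<^esub> (\<kappa> a \<cdot>\<^bsub>D\<^esub> \<Phi> h)"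
    using \<kappa>_Hom[OF o(1)] \<kappa>_Hom[OF o(2)] \<Phi>_Hom[OF h] \<Phi>_Hom[OF u] \<Phi>_Hom[OF conjunct1[OF s]]
    by (simp add: Hom_iff D.reassoc[OF conjunct2[OF s]])
  finally show ?thesis by simp
qed

end

text \<open>Since \<open>\<Phi> h\<close> ends in \<open>R (ShO U a)\<close> and not in the shift of
  \<open>R a\<close>, the third arrow is corrected by \<open>\<kappa> a\<close>.\<close>

locale tri_transport = shift_transport +
  assumes U_Tri: "(f, g, h) \<in> Tri U \<longleftrightarrow> (\<exists>a b c. is_triangle U f g h a b c \<and>
      tri D (\<Phi> f) (\<Phi> g) (\<kappa> a \<cdot>\<^bsub>D\<^esub> \<Phi> h) (R a) (R b) (R c))"
begin

text \<open>The vertices are determined by the domains and codomains of the arrows, so the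
  existential quantifiers collapse.\<close>

lemma U_Tri_iff:
  assumes "is_triangle U f g h a b c"
  shows "(f, g, h) \<in> Tri U \<longleftrightarrow> tri D (\<Phi> f) (\<Phi> g) (\<kappa> a \<cdot>\<^bsub>D\<^esub> \<Phi> h) (R a) (R b) (R c)"
proof -
  have "a' = a \<and> b' = b \<and> c' = c" if "is_triangle U f g h a' b' c'" for a' b' c'
    using that assms by (auto simp: is_triangle_def Hom_iff)
  then show ?thesis unfolding U_Tri using assms by metis
qed

text \<open>Every axiom is lifted from \<open>D\<close>. Cones are found in \<open>D\<close> and
  replaced by objects \<open>R c\<close>; arrows produced there are pulled back along
  \<open>\<Phi>\<close>, and equations into shifted objects are checked with
  \<open>\<kappa>_cancel\<close>.\<close>

lemma U_triangulated: "triangulated_category U"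
proof (intro triangulated_category.intro triangulated_category_axioms.intro U_additive
    U_shift_equivalence U_shift_additive)
  show "\<exists>a b c. is_triangle U f g h a b c" if "(f, g, h) \<in> Tri U" for f g h
    using that unfolding U_Tri by blast
next
  fix t t' assume t: "t \<in> Tri U" "triangle_iso U t t'"
  obtain f g h f' g' h' where e: "t = (f, g, h)" "t' = (f', g', h')" by (metis prod_cases3)
  from t(2) obtain a b c a' b' c' u v w where
    i: "is_triangle U f g h a b c" "is_triangle U f' g' h' a' b' c'"
      "u \<in> Hom U a a'" "v \<in> Hom U b b'" "w \<in> Hom U c c'"
      "iso_arr U u" "iso_arr U v" "iso_arr U w"
      "v \<cdot>\<^bsub>U\<^esub> f = f' \<cdot>\<^bsub>U\<^esub> u" "w \<cdot>\<^bsub>U\<^esub> g = g' \<cdot>\<^bsub>U\<^esub> v" "ShA U u \<cdot>\<^bsub>U\<^esub> h = h' \<cdot>\<^bsub>U\<^esub> w"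
    unfolding e triangle_iso_def prod.case by blast
  note T = is_triangleD[OF i(1)] and T' = is_triangleD[OF i(2)]
  note tD = t(1)[unfolded e U_Tri_iff[OF i(1)]]
  have "tri D (\<Phi> f') (\<Phi> g') (\<kappa> a' \<cdot>\<^bsub>D\<^esub> \<Phi> h') (R a') (R b') (R c')"
  proof (rule D.tri_iso[OF tD \<Phi>_Hom[OF i(3)] \<Phi>_Hom[OF i(4)] \<Phi>_Hom[OF i(5)]
      \<Phi>.F1_iso_arr[OF i(6)] \<Phi>.F1_iso_arr[OF i(7)] \<Phi>.F1_iso_arr[OF i(8)] \<Phi>_is_triangle(1-3)[OF i(2)]])
    show "\<Phi> v \<cdot>\<^bsub>D\<^esub> \<Phi> f = \<Phi> f' \<cdot>\<^bsub>D\<^esub> \<Phi> u"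
      using \<Phi>.F1_Cmp[OF T(1) i(4)] \<Phi>.F1_Cmp[OF i(3) T'(1)] i(9) by simp
    show "\<Phi> w \<cdot>\<^bsub>D\<^esub> \<Phi> g = \<Phi> g' \<cdot>\<^bsub>D\<^esub> \<Phi> v"
      using \<Phi>.F1_Cmp[OF T(2) i(5)] \<Phi>.F1_Cmp[OF i(4) T'(2)] i(10) by simp
    show "ShA D (\<Phi> u) \<cdot>\<^bsub>D\<^esub> (\<kappa> a \<cdot>\<^bsub>D\<^esub> \<Phi> h) = (\<kappa> a' \<cdot>\<^bsub>D\<^esub> \<Phi> h') \<cdot>\<^bsub>D\<^esub> \<Phi> w"
      using \<kappa>_shift[OF i(3) T(3)] \<Phi>.F1_Cmp[OF i(5) T'(3)] i(11) \<Phi>_is_triangle[OF i(2)] \<Phi>_Hom[OF i(5)]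
      by (simp add: Hom_iff)
  qed
  then show "t' \<in> Tri U" unfolding e U_Tri_iff[OF i(2)] .
next
  fix a z assume a: "a \<in> Obj U" and z: "zero_object U z"
  have zO: "z \<in> Obj U" using z U.zero_object_iff by blast
  have i: "is_triangle U (Ide U a) (Zer U a z) (Zer U z (ShO U a)) a a z"
    unfolding is_triangle_def using U.Ide_Hom U.Zer_Hom a zO U_ShO by simp
  have "\<kappa> a \<cdot>\<^bsub>D\<^esub> Zer D (R z) (R (ShO U a)) = Zer D (R z) (ShO D (R a))"
    using \<kappa>_Hom[OF a] R_Obj[OF zO] by (simp add: Hom_iff)
  then show "(Ide U a, Zer U a z, Zer U z (ShO U a)) \<in> Tri U"
    unfolding U_Tri_iff[OF i]
    using D.tri_Ide[OF R_Obj[OF a] \<Phi>.F0_zero_object[OF z]] \<Phi>_Ide[OF a] \<Phi>_Zer[OF a zO] \<Phi>_Zer[OF zO U_ShO[OF a]]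
    by simp
next
  fix f assume "f \<in> Arr U"
  then obtain a b where f: "f \<in> Hom U a b" by (auto simp: Hom_iff)
  have o: "a \<in> Obj U" "b \<in> Obj U" using U_Hom_Obj[OF f] by auto
  obtain c0 g0 h0 where t: "tri D (\<Phi> f) g0 h0 (R a) (R b) c0" using D.tri_cone[OF \<Phi>_Hom[OF f]] .
  obtain c where c: "c \<in> Obj U" "isomorphic D (R c) c0" using R_surj D.tri_Obj[OF t] by blast
  then obtain m where m: "m \<in> Hom D (R c) c0" "iso_arr D m" by (auto simp: isomorphic_def)
  obtain n where n: "n \<in> Hom D c0 (R c)" "n \<cdot>\<^bsub>D\<^esub> m = Ide D (R c)" "m \<cdot>\<^bsub>D\<^esub> n = Ide D c0" "iso_arr D n"
    using D.iso_arr_inverse[OF m(2,1)] .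
  have ka: "\<kappa> a \<in> Hom D (R (ShO U a)) (ShO D (R a))" "iso_arr D (\<kappa> a)" using \<kappa>_iso[OF o(1)] by auto
  \<comment> \<open>The inverse of \<open>\<kappa> a\<close> turns the connecting arrow of
    \<open>D\<close> into one that ends in \<open>R (ShO U a)\<close>.\<close>
  obtain l where l: "l \<in> Hom D (ShO D (R a)) (R (ShO U a))" "\<kappa> a \<cdot>\<^bsub>D\<^esub> l = Ide D (ShO D (R a))"
    using D.iso_arr_inverse[OF ka(2,1)] by metis
  note T = triD(3-5)[OF t]
  obtain g where g: "g \<in> Hom U b c" "\<Phi> g = n \<cdot>\<^bsub>D\<^esub> g0" using \<Phi>_surj[OF D.Cmp_Hom[OF T(2) n(1)] o(2) c(1)] .
  obtain h where h: "h \<in> Hom U c (ShO U a)" "\<Phi> h = l \<cdot>\<^bsub>D\<^esub> (h0 \<cdot>\<^bsub>D\<^esub> m)"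
    using \<Phi>_surj[OF D.Cmp_Hom[OF D.Cmp_Hom[OF m(1) T(3)] l(1)] c(1) U_ShO[OF o(1)]] .
  have i: "is_triangle U f g h a b c" using f g h by (simp add: is_triangle_def)
  have kh: "\<kappa> a \<cdot>\<^bsub>D\<^esub> \<Phi> h = h0 \<cdot>\<^bsub>D\<^esub> m"
    using h(2) T m l ka by (simp add: Hom_iff D.reassoc[OF l(2)])
  have "tri D (\<Phi> f) (\<Phi> g) (\<kappa> a \<cdot>\<^bsub>D\<^esub> \<Phi> h) (R a) (R b) (R c)"
    by (rule D.tri_iso[OF t D.Ide_Hom[OF R_Obj[OF o(1)]] D.Ide_Hom[OF R_Obj[OF o(2)]] n(1)
          D.iso_arr_Ide[OF R_Obj[OF o(1)]] D.iso_arr_Ide[OF R_Obj[OF o(2)]] n(4)])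
      (use \<Phi>_is_triangle[OF i] g(2) kh T m n R_Obj[OF o(1)] in \<open>simp_all add: Hom_iff\<close>)
  then show "\<exists>g h. (f, g, h) \<in> Tri U" using U_Tri_iff[OF i] by blast
next
  fix f g h a b c assume i: "is_triangle U f g h a b c"
  note T = is_triangleD[OF i] and P = \<Phi>_is_triangle[OF i]
  note s = \<Phi>_ShA[OF T(1)]
  note sf = conjunct1[OF s]
  have i': "is_triangle U g h (Neg U (ShA U f)) b c (ShO U a)"
    using T U.Neg_Hom[OF sf] by (simp add: is_triangle_def)
  note P' = \<Phi>_is_triangle[OF i']
  have N: "\<kappa> b \<cdot>\<^bsub>D\<^esub> \<Phi> (Neg U (ShA U f)) = Neg D (ShA D (\<Phi> f)) \<cdot>\<^bsub>D\<^esub> \<kappa> a"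
  proof -
    have "\<kappa> b \<cdot>\<^bsub>D\<^esub> \<Phi> (Neg U (ShA U f)) = Neg D (\<kappa> b \<cdot>\<^bsub>D\<^esub> \<Phi> (ShA U f))"
      using \<kappa>_Hom[OF T(5)] \<Phi>_Hom[OF sf] by (simp add: \<Phi>.F1_Neg[OF sf] D.Cmp_Neg Hom_iff)
    also have "\<dots> = Neg D (ShA D (\<Phi> f)) \<cdot>\<^bsub>D\<^esub> \<kappa> a"
      using P by (simp add: conjunct2[OF s] D.Cmp_Neg Hom_iff)
    finally show ?thesis .
  qed
  have ka: "iso_arr D (\<kappa> a)" using \<kappa>_iso T by blast
  obtain l where l: "l \<in> Hom D (ShO D (R a)) (R (ShO U a))" "l \<cdot>\<^bsub>D\<^esub> \<kappa> a = Ide D (R (ShO U a))"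
      "\<kappa> a \<cdot>\<^bsub>D\<^esub> l = Ide D (ShO D (R a))" "iso_arr D l"
    using D.iso_arr_inverse[OF ka P(5)] .
  have b: "R b \<in> Obj D" and c: "R c \<in> Obj D" using R_Obj T by auto
  let ?n = "Neg D (ShA D (\<Phi> f))"
  have n: "?n \<in> Hom D (ShO D (R a)) (ShO D (R b))" by (rule D.Neg_Hom[OF D.ShA_Hom[OF P(1)]])
  have "(f, g, h) \<in> Tri U \<longleftrightarrow> tri D (\<Phi> g) (\<kappa> a \<cdot>\<^bsub>D\<^esub> \<Phi> h) ?n (R b) (R c) (ShO D (R a))"
    unfolding U_Tri_iff[OF i] using D.tri_rot_iff[OF P(1-3)] by simp
  \<comment> \<open>The rotation in \<open>D\<close> has third vertex \<open>ShO D (R a)\<close>,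
    that in \<open>U\<close> has \<open>R (ShO U a)\<close>; \<open>\<kappa> a\<close> is an
    isomorphism between the two triangles, and \<open>N\<close> is its last square.\<close>
  also have "\<dots> \<longleftrightarrow> tri D (\<Phi> g) (\<Phi> h) (\<kappa> b \<cdot>\<^bsub>D\<^esub> \<Phi> (Neg U (ShA U f))) (R b) (R c) (R (ShO U a))"
  proof
    assume t: "tri D (\<Phi> g) (\<kappa> a \<cdot>\<^bsub>D\<^esub> \<Phi> h) ?n (R b) (R c) (ShO D (R a))"
    show "tri D (\<Phi> g) (\<Phi> h) (\<kappa> b \<cdot>\<^bsub>D\<^esub> \<Phi> (Neg U (ShA U f))) (R b) (R c) (R (ShO U a))"
      by (rule D.tri_iso[OF t D.Ide_Hom[OF b] D.Ide_Hom[OF c] l(1) D.iso_arr_Ide[OF b] D.iso_arr_Ide[OF c] l(4) P'(1-3)])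
        (use P n l(1) b c in \<open>simp_all add: N Hom_iff D.reassoc[OF l(2)] l(3)\<close>)
  next
    assume t: "tri D (\<Phi> g) (\<Phi> h) (\<kappa> b \<cdot>\<^bsub>D\<^esub> \<Phi> (Neg U (ShA U f))) (R b) (R c) (R (ShO U a))"
    show "tri D (\<Phi> g) (\<kappa> a \<cdot>\<^bsub>D\<^esub> \<Phi> h) ?n (R b) (R c) (ShO D (R a))"
      by (rule D.tri_iso[OF t D.Ide_Hom[OF b] D.Ide_Hom[OF c] P(5) D.iso_arr_Ide[OF b] D.iso_arr_Ide[OF c] ka P(2,3) n])
        (use P n b c in \<open>simp_all add: N Hom_iff\<close>)
  qed
  also have "\<dots> \<longleftrightarrow> (g, h, Neg U (ShA U f)) \<in> Tri U" unfolding U_Tri_iff[OF i'] ..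
  finally show "(f, g, h) \<in> Tri U \<longleftrightarrow> (g, h, Neg U (ShA U f)) \<in> Tri U" .
next
  fix f g h a b c f' g' h' a' b' c' u v
  assume t: "(f, g, h) \<in> Tri U" and i: "is_triangle U f g h a b c"
    and t': "(f', g', h') \<in> Tri U" and i': "is_triangle U f' g' h' a' b' c'"
    and u: "u \<in> Hom U a a'" and v: "v \<in> Hom U b b'" and e: "v \<cdot>\<^bsub>U\<^esub> f = f' \<cdot>\<^bsub>U\<^esub> u"
  note T = is_triangleD[OF i] and T' = is_triangleD[OF i']
  have e': "\<Phi> v \<cdot>\<^bsub>D\<^esub> \<Phi> f = \<Phi> f' \<cdot>\<^bsub>D\<^esub> \<Phi> u"
    using \<Phi>.F1_Cmp[OF T(1) v] \<Phi>.F1_Cmp[OF u T'(1)] e by simp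
  obtain w0 where w0: "w0 \<in> Hom D (R c) (R c')" "w0 \<cdot>\<^bsub>D\<^esub> \<Phi> g = \<Phi> g' \<cdot>\<^bsub>D\<^esub> \<Phi> v"
    "ShA D (\<Phi> u) \<cdot>\<^bsub>D\<^esub> (\<kappa> a \<cdot>\<^bsub>D\<^esub> \<Phi> h) = (\<kappa> a' \<cdot>\<^bsub>D\<^esub> \<Phi> h') \<cdot>\<^bsub>D\<^esub> w0"
    using D.tri_map[OF t[unfolded U_Tri_iff[OF i]] t'[unfolded U_Tri_iff[OF i']] \<Phi>_Hom[OF u] \<Phi>_Hom[OF v] e'] .
  obtain w where w: "w \<in> Hom U c c'" "\<Phi> w = w0" using \<Phi>_surj[OF w0(1) T(6) T'(6)] .
  have "w \<cdot>\<^bsub>U\<^esub> g = g' \<cdot>\<^bsub>U\<^esub> v"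
    by (rule \<Phi>_inj[OF _ U.Cmp_Hom[OF T(2) w(1)] U.Cmp_Hom[OF v T'(2)]])
      (simp add: \<Phi>.F1_Cmp[OF T(2) w(1)] \<Phi>.F1_Cmp[OF v T'(2)] w(2) w0(2))
  moreover have "ShA U u \<cdot>\<^bsub>U\<^esub> h = h' \<cdot>\<^bsub>U\<^esub> w"
  proof (rule \<kappa>_cancel[OF _ U.Cmp_Hom[OF T(3)] U.Cmp_Hom[OF w(1) T'(3)] T'(4)])
    show "ShA U u \<in> Hom U (ShO U a) (ShO U a')" using \<Phi>_ShA[OF u] by blast
    show "\<kappa> a' \<cdot>\<^bsub>D\<^esub> \<Phi> (ShA U u \<cdot>\<^bsub>U\<^esub> h) = \<kappa> a' \<cdot>\<^bsub>D\<^esub> \<Phi> (h' \<cdot>\<^bsub>U\<^esub> w)"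
      using \<kappa>_shift[OF u T(3)] w0 w(2) \<Phi>_is_triangle[OF i'] by (simp add: \<Phi>.F1_Cmp[OF w(1) T'(3)] Hom_iff)
  qed
  ultimately show "\<exists>w\<in>Hom U c c'. w \<cdot>\<^bsub>U\<^esub> g = g' \<cdot>\<^bsub>U\<^esub> v \<and> ShA U u \<cdot>\<^bsub>U\<^esub> h = h' \<cdot>\<^bsub>U\<^esub> w" using w by blast
next
  fix f f1 f2 x y z' g g1 g2 z x' h1 h2 y'
  assume t1: "(f, f1, f2) \<in> Tri U" and i1: "is_triangle U f f1 f2 x y z'"
    and t2: "(g, g1, g2) \<in> Tri U" and i2: "is_triangle U g g1 g2 y z x'"
    and t3: "(g \<cdot>\<^bsub>U\<^esub> f, h1, h2) \<in> Tri U" and i3: "is_triangle U (g \<cdot>\<^bsub>U\<^esub> f) h1 h2 x z y'"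
  note T1 = is_triangleD[OF i1] and T2 = is_triangleD[OF i2] and T3 = is_triangleD[OF i3]
  note P1 = \<Phi>_is_triangle[OF i1] and P2 = \<Phi>_is_triangle[OF i2] and P3 = \<Phi>_is_triangle[OF i3]
  note gf = \<Phi>.F1_Cmp[OF T1(1) T2(1)]
  obtain u0 v0 where u0: "u0 \<in> Hom D (R z') (R y')" and v0: "v0 \<in> Hom D (R y') (R x')"
    and t0: "(u0, v0, ShA D (\<Phi> f1) \<cdot>\<^bsub>D\<^esub> (\<kappa> y \<cdot>\<^bsub>D\<^esub> \<Phi> g2)) \<in> Tri D"
    and e0: "u0 \<cdot>\<^bsub>D\<^esub> \<Phi> f1 = \<Phi> h1 \<cdot>\<^bsub>D\<^esub> \<Phi> g" "(\<kappa> x \<cdot>\<^bsub>D\<^esub> \<Phi> h2) \<cdot>\<^bsub>D\<^esub> u0 = \<kappa> x \<cdot>\<^bsub>D\<^esub> \<Phi> f2"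
      "v0 \<cdot>\<^bsub>D\<^esub> \<Phi> h1 = \<Phi> g1" "(\<kappa> y \<cdot>\<^bsub>D\<^esub> \<Phi> g2) \<cdot>\<^bsub>D\<^esub> v0 = ShA D (\<Phi> f) \<cdot>\<^bsub>D\<^esub> (\<kappa> x \<cdot>\<^bsub>D\<^esub> \<Phi> h2)"
    using D.TR4[OF triD(1,2)[OF t1[unfolded U_Tri_iff[OF i1]]] triD(1,2)[OF t2[unfolded U_Tri_iff[OF i2]]]
        triD(1,2)[OF t3[unfolded U_Tri_iff[OF i3] gf]]] by blast
  obtain u where u: "u \<in> Hom U z' y'" "\<Phi> u = u0" using \<Phi>_surj[OF u0 T1(6) T3(6)] .
  obtain v where v: "v \<in> Hom U y' x'" "\<Phi> v = v0" using \<Phi>_surj[OF v0 T3(6) T2(6)] .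
  have sf: "ShA U f \<in> Hom U (ShO U x) (ShO U y)" and sf1: "ShA U f1 \<in> Hom U (ShO U y) (ShO U z')"
    using \<Phi>_ShA[OF T1(1)] \<Phi>_ShA[OF T1(2)] by auto
  \<comment> \<open>Rewrites the third arrow supplied by the octahedral axiom in \<open>D\<close> as
    the corrected image of \<open>ShA U f1 \<cdot> g2\<close>.\<close>
  note k = \<kappa>_shift[OF T1(2) T2(3)]
  have i: "is_triangle U u v (ShA U f1 \<cdot>\<^bsub>U\<^esub> g2) z' y' x'"
    using u v U.Cmp_Hom[OF T2(3) sf1] by (simp add: is_triangle_def)
  have "tri D u0 v0 (ShA D (\<Phi> f1) \<cdot>\<^bsub>D\<^esub> (\<kappa> y \<cdot>\<^bsub>D\<^esub> \<Phi> g2)) (R z') (R y') (R x')"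
    by (rule triI[OF t0 u0 v0 D.Cmp_Hom[OF P2(3) D.ShA_Hom[OF P1(2)]]])
  then have "(u, v, ShA U f1 \<cdot>\<^bsub>U\<^esub> g2) \<in> Tri U"
    unfolding U_Tri_iff[OF i] k u(2) v(2) .
  moreover have "u \<cdot>\<^bsub>U\<^esub> f1 = h1 \<cdot>\<^bsub>U\<^esub> g"
    by (rule \<Phi>_inj[OF _ U.Cmp_Hom[OF T1(2) u(1)] U.Cmp_Hom[OF T2(1) T3(2)]])
      (simp add: \<Phi>.F1_Cmp[OF T1(2) u(1)] \<Phi>.F1_Cmp[OF T2(1) T3(2)] u(2) e0)
  moreover have "h2 \<cdot>\<^bsub>U\<^esub> u = f2"
    by (rule \<kappa>_cancel[OF _ U.Cmp_Hom[OF u(1) T3(3)] T1(3) T1(4)])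
      (use e0(2) P3 u0 in \<open>simp add: \<Phi>.F1_Cmp[OF u(1) T3(3)] u(2) Hom_iff\<close>)
  moreover have "v \<cdot>\<^bsub>U\<^esub> h1 = g1"
    by (rule \<Phi>_inj[OF _ U.Cmp_Hom[OF T3(2) v(1)] T2(2)])
      (simp add: \<Phi>.F1_Cmp[OF T3(2) v(1)] v(2) e0)
  moreover have "g2 \<cdot>\<^bsub>U\<^esub> v = ShA U f \<cdot>\<^bsub>U\<^esub> h2"
    by (rule \<kappa>_cancel[OF _ U.Cmp_Hom[OF v(1) T2(3)] U.Cmp_Hom[OF T3(3) sf] T2(4)])
      (use e0(4) P2 v0 \<kappa>_shift[OF T1(1) T3(3)] in \<open>simp add: \<Phi>.F1_Cmp[OF v(1) T2(3)] v(2) Hom_iff\<close>)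
  ultimately show "\<exists>u\<in>Hom U z' y'. \<exists>v\<in>Hom U y' x'. (u, v, ShA U f1 \<cdot>\<^bsub>U\<^esub> g2) \<in> Tri U \<and>
      u \<cdot>\<^bsub>U\<^esub> f1 = h1 \<cdot>\<^bsub>U\<^esub> g \<and> h2 \<cdot>\<^bsub>U\<^esub> u = f2 \<and> v \<cdot>\<^bsub>U\<^esub> h1 = g1 \<and> g2 \<cdot>\<^bsub>U\<^esub> v = ShA U f \<cdot>\<^bsub>U\<^esub> h2"
    using u v by blast
qed

end

section \<open>The Verdier quotient as a transport of \<open>Z\<close>\<close>

context torsion_setting
begin

text \<open>Objects of \<open>Z\<close> receive the identity resolution, so that \<open>R\<close>
  and \<open>F\<close> restrict to the identity on \<open>Z\<close> and not merely to something
  isomorphic to it.\<close>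

definition resolution :: "'o \<Rightarrow> 'o \<times> 'o \<times> 'm \<times> 'm" where
  "resolution t = (if t \<in> Z then (t, t, Ide C t, Ide C t) else (SOME (w, z, e, p). res t w z e p))"

definition W0 where "W0 t = fst (resolution t)"
definition R where "R t = fst (snd (resolution t))"
definition E where "E t = fst (snd (snd (resolution t)))"
definition P where "P t = snd (snd (snd (resolution t)))"

lemma resolution_Z: "z \<in> Z \<Longrightarrow> W0 z = z" "z \<in> Z \<Longrightarrow> R z = z" "z \<in> Z \<Longrightarrow> E z = Ide C z" "z \<in> Z \<Longrightarrow> P z = Ide C z"
  by (simp_all add: resolution_def W0_def R_def E_def P_def)

lemma res_resolution:
  assumes "t \<in> Obj C"
  shows "res t (W0 t) (R t) (E t) (P t)"
proof (cases "t \<in> Z")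
  case True
  then show ?thesis using res_Ide by (simp add: resolution_Z)
next
  case False
  obtain w z e p where "res t w z e p" using res_exists[OF assms] .
  then have "\<exists>x. case x of (w, z, e, p) \<Rightarrow> res t w z e p" by (intro exI[of _ "(w, z, e, p)"]) simp
  note some = someI_ex[OF this]
  obtain w' z' e' p' where eq: "(SOME (w, z, e, p). res t w z e p) = (w', z', e', p')" by (rule prod_cases4)
  show ?thesis
    using some False by (simp add: resolution_def W0_def R_def E_def P_def eq)
qed

definition F where "F f = L (E (Dom C f)) (P (Dom C f)) (E (Cod C f)) (P (Cod C f)) f"

lemma R_Z: "t \<in> Obj C \<Longrightarrow> R t \<in> Z"
  using resD(4)[OF res_resolution] .

lemma F_eq: "f \<in> Hom C a b \<Longrightarrow> F f = L (E a) (P a) (E b) (P b) f"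
  by (auto simp: F_def Hom_iff)

lemma F_Hom: "f \<in> Hom C a b \<Longrightarrow> F f \<in> Hom C (R a) (R b)"
  using L_Hom[OF res_resolution res_resolution] Hom_Obj[of f a b] by (simp add: F_eq)

sublocale F: additive_functor C C R F
proof unfold_locales
  fix f g a b c assume f: "f \<in> Hom C a b" and g: "g \<in> Hom C b c"
  show "F (g \<cdot> f) = F g \<cdot> F f"
    using L_Cmp[OF res_resolution res_resolution res_resolution f g] Hom_Obj[OF f] Hom_Obj[OF g]
    by (simp add: F_eq[OF f] F_eq[OF g] F_eq[OF Cmp_Hom[OF f g]])
next
  fix f g a b assume f: "f \<in> Hom C a b" and g: "g \<in> Hom C a b"
  show "F (Add C f g) = Add C (F f) (F g)"
    using L_Add[OF res_resolution res_resolution f g] Hom_Obj[OF f]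
    by (simp add: F_eq[OF f] F_eq[OF g] F_eq[OF Add_Hom[OF f g]])
next
  fix a assume a: "a \<in> Obj C"
  show "F (Ide C a) = Ide C (R a)" using L_Ide[OF res_resolution[OF a]] by (simp add: F_eq[OF Ide_Hom[OF a]])
  show "R a \<in> Obj C" using R_Z[OF a] thickD(1)[OF Z_thick] by blast
qed (rule F_Hom)

lemma F_Z: "f \<in> Hom C a b \<Longrightarrow> a \<in> Z \<Longrightarrow> b \<in> Z \<Longrightarrow> F f = f"
  by (simp add: F_eq resolution_Z L_Ide_Z)

lemma F_inverts:
  assumes "s \<in> cone_in C S" "s \<in> Hom C a b"
  shows "iso_arr C (F s)"
  using L_inverts[OF res_resolution res_resolution assms(2,1)] Hom_Obj[OF assms(2)] by (simp add: F_eq[OF assms(2)])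

lemma F_iso_cancel:
  assumes "s \<in> cone_in C S" "s \<in> Hom C a b" "f \<in> Hom C (R b) c" "g \<in> Hom C (R b) c" "f \<cdot> F s = g \<cdot> F s"
  shows "f = g"
  using iso_arr_cancel_right[OF F_inverts[OF assms(1,2)] F_Hom[OF assms(2)] assms(3-5)] .

text \<open>Two resolutions of \<open>ShO C t\<close> compete: the chosen one and the shift of the
  one chosen for \<open>t\<close>. The identity induces the comparison between them.\<close>

definition \<kappa> where
  "\<kappa> t = L (E (ShO C t)) (P (ShO C t)) (ShA C (E t)) (ShA C (P t)) (Ide C (ShO C t))"

lemma \<kappa>_props:
  assumes "t \<in> Obj C"
  shows "\<kappa> t \<in> Hom C (R (ShO C t)) (ShO C (R t))" "iso_arr C (\<kappa> t)"
proof -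
  note r = res_resolution[OF ShO_Obj[OF assms]] and r' = res_ShA[OF res_resolution[OF assms]]
  note i = Ide_Hom[OF ShO_Obj[OF assms]]
  show "\<kappa> t \<in> Hom C (R (ShO C t)) (ShO C (R t))" "iso_arr C (\<kappa> t)"
    unfolding \<kappa>_def using L_Hom[OF r r' i] L_iso[OF r r' i iso_arr_Ide] assms by auto
qed

lemma \<kappa>_Z:
  assumes "z \<in> Z"
  shows "\<kappa> z = Ide C (ShO C z)"
proof -
  have z: "z \<in> Obj C" "ShO C z \<in> Z" using thickD(1,3)[OF Z_thick] assms by auto
  show ?thesis using L_Ide[OF res_Ide[OF z(2)]] z assms by (simp add: \<kappa>_def resolution_Z)
qed

text \<open>In \<open>L_tri\<close> the third arrow ends in the shifted resolution of
  \<open>a\<close>, whereas \<open>F h\<close> ends in the chosen resolution of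
  \<open>ShO C a\<close>; \<open>\<kappa> a\<close> mediates.\<close>

lemma L_to_shift:
  assumes h: "h \<in> Hom C c (ShO C a)" and a: "a \<in> Obj C"
  shows "L (E c) (P c) (ShA C (E a)) (ShA C (P a)) h = \<kappa> a \<cdot> F h"
proof -
  note r = res_resolution[OF Hom_Obj(1)[OF h]] res_resolution[OF ShO_Obj[OF a]] res_ShA[OF res_resolution[OF a]]
  show ?thesis
    using L_Cmp[OF r h Ide_Hom[OF ShO_Obj[OF a]]] h by (simp add: \<kappa>_def F_eq[OF h] Hom_iff)
qed

text \<open>Both composites are the arrow induced by \<open>ShA C f\<close> from the chosen
  resolution of \<open>ShO C a\<close> to the shifted resolution of \<open>b\<close>.\<close>

lemma \<kappa>_natural:
  assumes f: "f \<in> Hom C a b"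
  shows "\<kappa> b \<cdot> F (ShA C f) = ShA C (F f) \<cdot> \<kappa> a"
proof -
  have o: "a \<in> Obj C" "b \<in> Obj C" using Hom_Obj[OF f] by auto
  note r = res_resolution[OF ShO_Obj[OF o(1)]] res_ShA[OF res_resolution[OF o(1)]] res_ShA[OF res_resolution[OF o(2)]]
  have "\<kappa> b \<cdot> F (ShA C f) = L (E (ShO C a)) (P (ShO C a)) (ShA C (E b)) (ShA C (P b)) (ShA C f)"
    by (rule L_to_shift[OF ShA_Hom[OF f] o(2), symmetric])
  also have "\<dots> = ShA C (F f) \<cdot> \<kappa> a"
    using L_Cmp[OF r Ide_Hom[OF ShO_Obj[OF o(1)]] ShA_Hom[OF f]] f
      L_ShA[OF res_resolution[OF o(1)] res_resolution[OF o(2)] f]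
    by (simp add: \<kappa>_def F_eq[OF f] Hom_iff)
  finally show ?thesis .
qed

lemma F_tri:
  assumes t: "tri C f g h a b c"
  shows "tri C (F f) (F g) (\<kappa> a \<cdot> F h) (R a) (R b) (R c)"
  using L_tri[OF res_resolution res_resolution res_resolution t] tri_Obj[OF t]
  by (simp add: F_eq[OF triD(3)[OF t]] F_eq[OF triD(4)[OF t]] L_to_shift[OF triD(5)[OF t]])

text \<open>The roof \<open>(s, f)\<close> represents the arrow \<open>h = F f (F s)\<^sup>-\<^sup>1\<close> of \<open>Z\<close>.\<close>

definition repr where
  "repr a b s f h \<longleftrightarrow> (s, f) \<in> roofs C S a b \<and> h \<in> Hom C (R a) (R b) \<and> h \<cdot> F s = F f"

lemma reprD:
  assumes "repr a b s f h"
  obtains d where "s \<in> cone_in C S" "s \<in> Hom C d a" "f \<in> Hom C d b" "h \<in> Hom C (R a) (R b)" "h \<cdot> F s = F f"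
  using assms unfolding repr_def roofs_def by blast

lemma reprI:
  assumes "s \<in> cone_in C S" "s \<in> Hom C d a" "f \<in> Hom C d b" "h \<in> Hom C (R a) (R b)" "h \<cdot> F s = F f"
  shows "repr a b s f h"
  using assms unfolding repr_def roofs_def by blast

lemma repr_exists:
  assumes "(s, f) \<in> roofs C S a b"
  obtains h where "repr a b s f h"
proof -
  obtain d where s: "s \<in> cone_in C S" "s \<in> Hom C d a" and f: "f \<in> Hom C d b"
    using assms unfolding roofs_def by blast
  obtain g where g: "g \<in> Hom C (R a) (R d)" "g \<cdot> F s = Ide C (R d)"
    using iso_arr_inverse[OF F_inverts[OF s] F_Hom[OF s(2)]] by metis
  have "(F f \<cdot> g) \<cdot> F s = F f" using g F_Hom[OF f] F_Hom[OF s(2)] by (simp add: Hom_iff)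
  then show thesis using that reprI[OF s f Cmp_Hom[OF g(1) F_Hom[OF f]]] by blast
qed

lemma repr_unique:
  assumes "repr a b s f h" "repr a b s f h'"
  shows "h = h'"
proof -
  obtain d where s: "s \<in> cone_in C S" "s \<in> Hom C d a" and h: "h \<in> Hom C (R a) (R b)" "h \<cdot> F s = F f"
    using reprD[OF assms(1)] by metis
  obtain d' where h': "h' \<in> Hom C (R a) (R b)" "h' \<cdot> F s = F f" using reprD[OF assms(2)] by metis
  show ?thesis by (rule F_iso_cancel[OF s h(1) h'(1)]) (simp add: h h')
qed

lemma roof_exists:
  assumes h: "h \<in> Hom C (R a) (R b)" and o: "a \<in> Obj C" "b \<in> Obj C"
  obtains s f where "repr a b s f h"
proof -
  obtain d s f where s: "s \<in> cone_in C S" "s \<in> Hom C d a" and f: "f \<in> Hom C d b"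
    and e: "\<And>w z e p. res d w z e p \<Longrightarrow> h \<cdot> L e p (E a) (P a) s = L e p (E b) (P b) f"
    by (rule L_roof[OF res_resolution[OF o(1)] res_resolution[OF o(2)] h]) (rule that)
  have "h \<cdot> F s = F f"
    using e[OF res_resolution[OF Hom_Obj(1)[OF f]]] by (simp add: F_eq[OF s(2)] F_eq[OF f])
  then show thesis using that reprI[OF s f h] by blast
qed

text \<open>Equivalence classes of roofs are thus the fibres of the value \<open>h\<close>.
  Forwards, a common refinement gives the value after cancelling \<open>F u'\<close>. Backwards, an
  Ore square equalises the denominators; the numerators then have the same image under
  \<open>F\<close>, so \<open>L_eq_Zer\<close> makes them equal after one more refinement.\<close>

lemma roof_equiv_iff:
  assumes r: "repr a b s f h"
  shows "roof_equiv C S a b (s, f) (s', f') \<longleftrightarrow> repr a b s' f' h"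
proof
  obtain d where s: "s \<in> cone_in C S" "s \<in> Hom C d a" and f: "f \<in> Hom C d b"
    and h: "h \<in> Hom C (R a) (R b)" "h \<cdot> F s = F f" using reprD[OF r] .
  {
    assume e: "roof_equiv C S a b (s, f) (s', f')"
    then have "(s', f') \<in> roofs C S a b" by (simp add: roof_equiv_def)
    then obtain d' where s': "s' \<in> cone_in C S" "s' \<in> Hom C d' a" and f': "f' \<in> Hom C d' b"
      by (auto simp: roofs_def)
    have D: "Dom C s = d" "Dom C s' = d'" using s s' by (auto simp: Hom_iff)
    obtain c u u' where u: "u \<in> Hom C c d" and u': "u' \<in> Hom C c d'"
      and su: "s \<cdot> u \<in> cone_in C S" "s \<cdot> u = s' \<cdot> u'" and fu: "f \<cdot> u = f' \<cdot> u'"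
      using e unfolding roof_equiv_def prod.case D by blast
    \<comment> \<open>Of the refinement only the composite \<open>s \<cdot> u\<close> is known to
      have its cone in \<open>S\<close>; \<open>F u'\<close> is invertible because
      \<open>F s'\<close> and \<open>F s' \<cdot> F u'\<close> are.\<close>
    have iso: "iso_arr C (F s' \<cdot> F u')"
      using F_inverts[OF su(1) Cmp_Hom[OF u s(2)]] F.F1_Cmp[OF u' s'(2)] by (simp add: su(2))
    obtain m where m: "m \<in> Hom C (R a) (R d')" "m \<cdot> F s' = Ide C (R d')"  "F s' \<cdot> m = Ide C (R a)"
      using iso_arr_inverse[OF F_inverts[OF s'] F_Hom[OF s'(2)]] .
    have iso': "iso_arr C (F u')"
    proof -
      have "iso_arr C (m \<cdot> (F s' \<cdot> F u'))"
        by (rule iso_arr_Cmp[OF iso _ Cmp_Hom[OF F_Hom[OF u'] F_Hom[OF s'(2)]] m(1)])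
          (rule iso_arrI[OF m(1) F_Hom[OF s'(2)] m(3,2)])
      then show ?thesis using m F_Hom[OF s'(2)] F_Hom[OF u'] by (simp add: Hom_iff reassoc[OF m(2)])
    qed
    have "h \<cdot> F s' = F f'"
    proof (rule iso_arr_cancel_right[OF iso' F_Hom[OF u'] Cmp_Hom[OF F_Hom[OF s'(2)] h(1)] F_Hom[OF f']])
      have "(h \<cdot> F s') \<cdot> F u' = h \<cdot> F (s \<cdot> u)"
        using F_Hom[OF s'(2)] F_Hom[OF u'] h(1) by (simp add: su(2) F.F1_Cmp[OF u' s'(2)] Hom_iff)
      also have "\<dots> = F f \<cdot> F u"
        using F_Hom[OF s(2)] F_Hom[OF u] h(1) by (simp add: F.F1_Cmp[OF u s(2)] Hom_iff reassoc[OF h(2)])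
      also have "\<dots> = F f' \<cdot> F u'" by (simp add: fu flip: F.F1_Cmp[OF u f] F.F1_Cmp[OF u' f'])
      finally show "(h \<cdot> F s') \<cdot> F u' = F f' \<cdot> F u'" .
    qed
    then show "repr a b s' f' h" by (rule reprI[OF s' f' h(1)])
  }
  assume r': "repr a b s' f' h"
  obtain d' where s': "s' \<in> cone_in C S" "s' \<in> Hom C d' a" and f': "f' \<in> Hom C d' b"
    and h': "h \<cdot> F s' = F f'" using reprD[OF r'] by metis
  obtain c u u' where u: "u \<in> cone_in C S" "u \<in> Hom C c d" and u': "u' \<in> Hom C c d'" and su: "s \<cdot> u = s' \<cdot> u'"
    using Ore[OF s' s(2)] .
  note fu = Cmp_Hom[OF u(2) f] and fu' = Cmp_Hom[OF u' f']
  have "F (f \<cdot> u) = h \<cdot> F (s \<cdot> u)"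
    using F_Hom[OF s(2)] F_Hom[OF u(2)] h(1)
    by (simp add: F.F1_Cmp[OF u(2) f] F.F1_Cmp[OF u(2) s(2)] Hom_iff reassoc[OF h(2)])
  also have "\<dots> = F (f' \<cdot> u')"
    using F_Hom[OF s'(2)] F_Hom[OF u'] h(1)
    by (simp add: su F.F1_Cmp[OF u' f'] F.F1_Cmp[OF u' s'(2)] Hom_iff reassoc[OF h'])
  finally have "F (Sub (f \<cdot> u) (f' \<cdot> u')) = Zer C (R c) (R b)"
    using Sub_eq_Zer_iff[OF F_Hom[OF fu] F_Hom[OF fu']] by (simp add: F.F1_Sub[OF fu fu'])
  then have 0: "L (E c) (P c) (E b) (P b) (Sub (f \<cdot> u) (f' \<cdot> u')) = Zer C (R c) (R b)"
    by (simp add: F_eq[OF Sub_Hom[OF fu fu']])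
  have o: "c \<in> Obj C" "b \<in> Obj C" using Hom_Obj[OF fu] by auto
  obtain k v where v: "v \<in> Hom C k c" "v \<in> cone_in C S" "Sub (f \<cdot> u) (f' \<cdot> u') \<cdot> v = Zer C k b"
    using L_eq_Zer[OF res_resolution[OF o(1)] res_resolution[OF o(2)] Sub_Hom[OF fu fu'] 0] .
  have fv: "(f \<cdot> u) \<cdot> v = (f' \<cdot> u') \<cdot> v"
    using v(3) Sub_eq_Zer_iff[OF Cmp_Hom[OF v(1) fu] Cmp_Hom[OF v(1) fu']] by (simp add: Sub_Cmp[OF v(1) fu fu'])
  have D: "Dom C s = d" "Dom C s' = d'" using s s' by (auto simp: Hom_iff)
  note uv = Cmp_Hom[OF v(1) u(2)] and uv' = Cmp_Hom[OF v(1) u']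
  have "s \<cdot> (u \<cdot> v) = s' \<cdot> (u' \<cdot> v)" using s s' u u' v(1) by (simp add: Hom_iff reassoc[OF su])
  moreover have "f \<cdot> (u \<cdot> v) = f' \<cdot> (u' \<cdot> v)" using fv f f' u u' v(1) by (simp add: Hom_iff)
  moreover have "s \<cdot> (u \<cdot> v) \<in> cone_in C S"
    by (rule cone_in_Cmp[OF S_thick cone_in_Cmp[OF S_thick v(2,1) u] uv s])
  moreover have "(s, f) \<in> roofs C S a b" "(s', f') \<in> roofs C S a b" using r r' by (auto simp: repr_def)
  ultimately show "roof_equiv C S a b (s, f) (s', f')"
    unfolding roof_equiv_def prod.case D using uv uv' by blast
qed

definition cls where "cls a b h = {(s, f). repr a b s f h}"

lemma roof_class_eq:
  assumes "repr a b s f h"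
  shows "roof_class C S a b (s, f) = cls a b h"
  using roof_equiv_iff[OF assms] by (auto simp: roof_class_def cls_def)

definition frac where "frac a b h = (a, b, cls a b h)"

text \<open>Recovers the value of a fraction. It is determined because every arrow from
  \<open>R a\<close> to \<open>R b\<close> is the value of some roof, so different values have
  different classes.\<close>

definition \<Phi> where
  "\<Phi> \<phi> = (THE h. h \<in> Hom C (R (fst \<phi>)) (R (fst (snd \<phi>))) \<and> \<phi> = frac (fst \<phi>) (fst (snd \<phi>)) h)"

lemma frac_inj:
  assumes "frac a b h = frac a b h'" "h \<in> Hom C (R a) (R b)" "a \<in> Obj C" "b \<in> Obj C"
  shows "h = h'"
proof -
  obtain s f where r: "repr a b s f h" using roof_exists[OF assms(2-4)] .
  have "repr a b s f h \<longleftrightarrow> repr a b s f h'" for s f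
    using assms(1) unfolding frac_def cls_def by (auto simp: set_eq_iff)
  then show ?thesis using r repr_unique by blast
qed

lemma \<Phi>_frac:
  assumes "h \<in> Hom C (R a) (R b)" "a \<in> Obj C" "b \<in> Obj C"
  shows "\<Phi> (frac a b h) = h"
proof -
  have D: "fst (frac a b h) = a" "fst (snd (frac a b h)) = b" by (simp_all add: frac_def)
  show ?thesis
    unfolding \<Phi>_def D using frac_inj[OF _ assms] assms(1) by (intro the_equality) auto
qed

section \<open>The operations of the Verdier quotient on fractions\<close>

definition U where "U = verdier_quotient C S"

lemma U_simps [simp]:
  "Obj U = Obj C" "Dom U = fst" "Cod U = fst \<circ> snd" "Ide U = (\<lambda>a. quot_arr C S (Ide C a))"
  "Cmp U = quot_Cmp C S" "Add U = quot_Add C S" "Zer U = (\<lambda>a b. quot_arr C S (Zer C a b))"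
  "ShO U = ShO C" "ShA U = quot_ShA C S"
  by (simp_all add: U_def verdier_quotient_def verdier_pre_def)

lemma U_Arr: "\<phi> \<in> Arr U \<longleftrightarrow> (\<exists>a\<in>Obj C. \<exists>b\<in>Obj C. \<exists>h \<in> Hom C (R a) (R b). \<phi> = frac a b h)"
proof
  assume "\<phi> \<in> Arr U"
  then obtain a b s f where "a \<in> Obj C" "b \<in> Obj C" and r: "(s, f) \<in> roofs C S a b"
    and "\<phi> = (a, b, roof_class C S a b (s, f))"
    by (auto simp: U_def verdier_quotient_def verdier_pre_def)
  moreover obtain h where "repr a b s f h" using repr_exists[OF r] .
  ultimately show "\<exists>a\<in>Obj C. \<exists>b\<in>Obj C. \<exists>h \<in> Hom C (R a) (R b). \<phi> = frac a b h"
    using roof_class_eq reprD unfolding frac_def by metis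
next
  assume "\<exists>a\<in>Obj C. \<exists>b\<in>Obj C. \<exists>h \<in> Hom C (R a) (R b). \<phi> = frac a b h"
  then obtain a b h where o: "a \<in> Obj C" "b \<in> Obj C" and h: "h \<in> Hom C (R a) (R b)" and \<phi>: "\<phi> = frac a b h" by blast
  obtain s f where r: "repr a b s f h" using roof_exists[OF h o] .
  then have "(s, f) \<in> roofs C S a b" by (simp add: repr_def)
  then show "\<phi> \<in> Arr U"
    using o roof_class_eq[OF r] \<phi> unfolding frac_def
    by (auto simp: U_def verdier_quotient_def verdier_pre_def)
qed

lemma frac_Hom: "h \<in> Hom C (R a) (R b) \<Longrightarrow> a \<in> Obj C \<Longrightarrow> b \<in> Obj C \<Longrightarrow> frac a b h \<in> Hom U a b"
  unfolding Hom_iff[of _ U] U_Arr by (auto simp: frac_def)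

lemma U_HomE:
  assumes "\<phi> \<in> Hom U a b"
  obtains h where "h \<in> Hom C (R a) (R b)" "\<phi> = frac a b h" "a \<in> Obj C" "b \<in> Obj C"
  using assms that unfolding Hom_iff[of _ U] U_Arr by (auto simp: frac_def)

lemma quot_arr_eq:
  assumes "f \<in> Hom C a b"
  shows "quot_arr C S f = frac a b (F f)"
proof -
  have o: "a \<in> Obj C" using Hom_Obj[OF assms] by auto
  have "repr a b (Ide C a) f (F f)"
    by (rule reprI[OF cone_in_Ide[OF S_thick o] Ide_Hom[OF o] assms F_Hom[OF assms]])
      (use F_Hom[OF assms] in \<open>simp add: F.F1_Ide[OF o] Hom_iff\<close>)
  from roof_class_eq[OF this] show ?thesis using assms by (auto simp: quot_arr_def frac_def Hom_iff)
qed

text \<open>All admissible choices contribute the same class, that of \<open>k \<cdot> h\<close>,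
  and an Ore square shows that there is at least one. The union is therefore this class, and
  independence of representatives comes with the computation.\<close>

lemma quot_Cmp_eq:
  assumes h: "h \<in> Hom C (R a) (R b)" and k: "k \<in> Hom C (R b) (R c)"
    and o: "a \<in> Obj C" "b \<in> Obj C" "c \<in> Obj C"
  shows "quot_Cmp C S (frac b c k) (frac a b h) = frac a c (k \<cdot> h)"
proof -
  let ?A = "{roof_class C S a c (s \<cdot> u, g \<cdot> v) | s f t g u v d.
        (s, f) \<in> cls a b h \<and> (t, g) \<in> cls b c k \<and>
        u \<in> cone_in C S \<and> u \<in> Hom C d (Dom C s) \<and> v \<in> Hom C d (Dom C t) \<and> f \<cdot> u = t \<cdot> v}"
  have K: "roof_class C S a c (s \<cdot> u, g \<cdot> v) = cls a c (k \<cdot> h)"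
    if "(s, f) \<in> cls a b h" "(t, g) \<in> cls b c k" "u \<in> cone_in C S" "u \<in> Hom C d (Dom C s)"
      "v \<in> Hom C d (Dom C t)" and e: "f \<cdot> u = t \<cdot> v" for s f t g u v d
  proof -
    have "repr a b s f h" using that by (simp add: cls_def)
    from reprD[OF this] obtain x where s: "s \<in> cone_in C S" "s \<in> Hom C x a" and f: "f \<in> Hom C x b" and hs: "h \<cdot> F s = F f"
      by metis
    have "repr b c t g k" using that by (simp add: cls_def)
    from reprD[OF this] obtain y where t: "t \<in> cone_in C S" "t \<in> Hom C y b" and g: "g \<in> Hom C y c" and kt: "k \<cdot> F t = F g"
      by metis
    have u: "u \<in> cone_in C S" "u \<in> Hom C d x" and v: "v \<in> Hom C d y" using that s t by (auto simp: Hom_iff)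
    have "(k \<cdot> h) \<cdot> F (s \<cdot> u) = k \<cdot> F (f \<cdot> u)"
      using h k F_Hom[OF s(2)] F_Hom[OF u(2)]
      by (simp add: F.F1_Cmp[OF u(2) s(2)] F.F1_Cmp[OF u(2) f] Hom_iff reassoc[OF hs])
    also have "\<dots> = F (g \<cdot> v)"
      using k F_Hom[OF t(2)] F_Hom[OF v]
      by (simp add: e F.F1_Cmp[OF v t(2)] F.F1_Cmp[OF v g] Hom_iff reassoc[OF kt])
    finally have "repr a c (s \<cdot> u) (g \<cdot> v) (k \<cdot> h)"
      by (rule reprI[OF cone_in_Cmp[OF S_thick u s] Cmp_Hom[OF u(2) s(2)] Cmp_Hom[OF v g] Cmp_Hom[OF h k]])
    then show ?thesis by (rule roof_class_eq)
  qed
  obtain s f where r: "repr a b s f h" using roof_exists[OF h o(1,2)] .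
  from reprD[OF r] obtain x where s: "s \<in> Hom C x a" and f: "f \<in> Hom C x b" by metis
  obtain t g where r': "repr b c t g k" using roof_exists[OF k o(2,3)] .
  from reprD[OF r'] obtain y where t: "t \<in> cone_in C S" "t \<in> Hom C y b" by metis
  obtain d u v where u: "u \<in> cone_in C S" "u \<in> Hom C d x" "v \<in> Hom C d y" "f \<cdot> u = t \<cdot> v"
    using Ore[OF t f] .
  have "(s, f) \<in> cls a b h" "(t, g) \<in> cls b c k" using r r' by (simp_all add: cls_def)
  moreover have "u \<in> Hom C d (Dom C s)" "v \<in> Hom C d (Dom C t)" using u s t by (auto simp: Hom_iff)
  ultimately have "roof_class C S a c (s \<cdot> u, g \<cdot> v) \<in> ?A" using u by blast
  moreover have "B = cls a c (k \<cdot> h)" if "B \<in> ?A" for B using that K by blast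
  ultimately have "\<Union>?A = cls a c (k \<cdot> h)" by blast
  then show ?thesis by (simp add: quot_Cmp_def frac_def)
qed

text \<open>A sum is formed only from roofs with the same denominator \<open>s\<close>. An Ore
  square refines arbitrary roofs of \<open>h\<close> and \<open>k\<close> to such a pair, so the
  union is not empty; each of its members has value \<open>Add C h k\<close>.\<close>

lemma quot_Add_eq:
  assumes h: "h \<in> Hom C (R a) (R b)" and k: "k \<in> Hom C (R a) (R b)"
    and o: "a \<in> Obj C" "b \<in> Obj C"
  shows "quot_Add C S (frac a b h) (frac a b k) = frac a b (Add C h k)"
proof -
  let ?A = "{roof_class C S a b (s, Add C f g) | s f g. (s, f) \<in> cls a b h \<and> (s, g) \<in> cls a b k}"
  have K: "roof_class C S a b (s, Add C f g) = cls a b (Add C h k)"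
    if "(s, f) \<in> cls a b h" "(s, g) \<in> cls a b k" for s f g
  proof -
    have "repr a b s f h" using that by (simp add: cls_def)
    from reprD[OF this] obtain x where s: "s \<in> cone_in C S" "s \<in> Hom C x a" and f: "f \<in> Hom C x b" and hs: "h \<cdot> F s = F f"
      by metis
    have "repr a b s g k" using that by (simp add: cls_def)
    from reprD[OF this] obtain y where s': "s \<in> Hom C y a" and g: "g \<in> Hom C y b" and ks: "k \<cdot> F s = F g"
      by metis
    have g: "g \<in> Hom C x b" using g s s' by (simp add: Hom_iff)
    have "Add C h k \<cdot> F s = F (Add C f g)"
      by (simp add: F.F1_Add[OF f g] Cmp_Add_left[OF F_Hom[OF s(2)] h k] hs ks)
    then have "repr a b s (Add C f g) (Add C h k)"
      by (rule reprI[OF s Add_Hom[OF f g] Add_Hom[OF h k]])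
    then show ?thesis by (rule roof_class_eq)
  qed
  obtain s f where r: "repr a b s f h" using roof_exists[OF h o] .
  from reprD[OF r] obtain x where s: "s \<in> cone_in C S" "s \<in> Hom C x a" and f: "f \<in> Hom C x b" and hs: "h \<cdot> F s = F f" by metis
  obtain t g where r': "repr a b t g k" using roof_exists[OF k o] .
  from reprD[OF r'] obtain y where t: "t \<in> cone_in C S" "t \<in> Hom C y a" and g: "g \<in> Hom C y b" and kt: "k \<cdot> F t = F g" by metis
  obtain d u v where u: "u \<in> cone_in C S" "u \<in> Hom C d x" and v: "v \<in> Hom C d y" and e: "s \<cdot> u = t \<cdot> v"
    using Ore[OF t s(2)] .
  note su = cone_in_Cmp[OF S_thick u s] Cmp_Hom[OF u(2) s(2)]
  have "h \<cdot> F (s \<cdot> u) = F (f \<cdot> u)"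
    using h F_Hom[OF s(2)] F_Hom[OF u(2)]
    by (simp add: F.F1_Cmp[OF u(2) s(2)] F.F1_Cmp[OF u(2) f] Hom_iff reassoc[OF hs])
  then have 1: "repr a b (s \<cdot> u) (f \<cdot> u) h" by (rule reprI[OF su Cmp_Hom[OF u(2) f] h])
  have "k \<cdot> F (s \<cdot> u) = F (g \<cdot> v)"
    using k F_Hom[OF t(2)] F_Hom[OF v]
    by (simp add: e F.F1_Cmp[OF v t(2)] F.F1_Cmp[OF v g] Hom_iff reassoc[OF kt])
  then have 2: "repr a b (s \<cdot> u) (g \<cdot> v) k" by (rule reprI[OF su Cmp_Hom[OF v g] k])
  have "roof_class C S a b (s \<cdot> u, Add C (f \<cdot> u) (g \<cdot> v)) \<in> ?A"
    using 1 2 by (auto simp: cls_def)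
  moreover have "B = cls a b (Add C h k)" if "B \<in> ?A" for B using that K by blast
  ultimately have "\<Union>?A = cls a b (Add C h k)" by blast
  then show ?thesis by (simp add: quot_Add_def frac_def)
qed

text \<open>The value \<open>h'\<close> is \<open>ShA C h\<close> conjugated by
  \<open>\<kappa>\<close>; naturality of \<open>\<kappa>\<close> shows that shifting any roof with
  value \<open>h\<close> gives a roof with value \<open>h'\<close>.\<close>

lemma quot_ShA_eq:
  assumes h: "h \<in> Hom C (R a) (R b)" and o: "a \<in> Obj C" "b \<in> Obj C"
  obtains h' where "h' \<in> Hom C (R (ShO C a)) (R (ShO C b))" "\<kappa> b \<cdot> h' = ShA C h \<cdot> \<kappa> a"
    "quot_ShA C S (frac a b h) = frac (ShO C a) (ShO C b) h'"
proof -
  note ka = \<kappa>_props[OF o(1)] and kb = \<kappa>_props[OF o(2)]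
  obtain l where l: "l \<in> Hom C (ShO C (R b)) (R (ShO C b))" "l \<cdot> \<kappa> b = Ide C (R (ShO C b))" "\<kappa> b \<cdot> l = Ide C (ShO C (R b))"
    using iso_arr_inverse[OF kb(2,1)] .
  define h' where "h' = l \<cdot> (ShA C h \<cdot> \<kappa> a)"
  have h': "h' \<in> Hom C (R (ShO C a)) (R (ShO C b))"
    unfolding h'_def by (rule Cmp_Hom[OF Cmp_Hom[OF ka(1) ShA_Hom[OF h]] l(1)])
  have e: "\<kappa> b \<cdot> h' = ShA C h \<cdot> \<kappa> a"
    unfolding h'_def using l ka(1) kb(1) h by (simp add: Hom_iff reassoc[OF l(3)])
  let ?A = "{roof_class C S (ShO C a) (ShO C b) (ShA C s, ShA C f) | s f. (s, f) \<in> cls a b h}"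
  have K: "roof_class C S (ShO C a) (ShO C b) (ShA C s, ShA C f) = cls (ShO C a) (ShO C b) h'"
    if "(s, f) \<in> cls a b h" for s f
  proof -
    have "repr a b s f h" using that by (simp add: cls_def)
    from reprD[OF this] obtain d where s: "s \<in> cone_in C S" "s \<in> Hom C d a" and f: "f \<in> Hom C d b" and hs: "h \<cdot> F s = F f"
      by metis
    have d: "d \<in> Obj C" using Hom_Obj[OF f] by auto
    note kd = \<kappa>_props[OF d]
    have "\<kappa> b \<cdot> (h' \<cdot> F (ShA C s)) = ShA C h \<cdot> (\<kappa> a \<cdot> F (ShA C s))"
      using ka(1) kb(1) h h' F_Hom[OF ShA_Hom[OF s(2)]] by (simp add: Hom_iff reassoc[OF e])
    also have "\<dots> = ShA C h \<cdot> (ShA C (F s) \<cdot> \<kappa> d)" by (simp add: \<kappa>_natural[OF s(2)])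
    also have "\<dots> = ShA C (h \<cdot> F s) \<cdot> \<kappa> d"
      using h kd(1) F_Hom[OF s(2)] by (simp add: Hom_iff ShA_Cmp)
    also have "\<dots> = \<kappa> b \<cdot> F (ShA C f)" by (simp add: hs \<kappa>_natural[OF f])
    finally have "h' \<cdot> F (ShA C s) = F (ShA C f)"
      by (rule iso_arr_cancel_left[OF kb(2,1) Cmp_Hom[OF F_Hom[OF ShA_Hom[OF s(2)]] h'] F_Hom[OF ShA_Hom[OF f]]])
    then have "repr (ShO C a) (ShO C b) (ShA C s) (ShA C f) h'"
      by (rule reprI[OF cone_in_ShA[OF S_thick s(1)] ShA_Hom[OF s(2)] ShA_Hom[OF f] h'])
    then show ?thesis by (rule roof_class_eq)
  qed
  obtain s f where r: "repr a b s f h" using roof_exists[OF h o] .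
  then have "roof_class C S (ShO C a) (ShO C b) (ShA C s, ShA C f) \<in> ?A" by (auto simp: cls_def)
  moreover have "B = cls (ShO C a) (ShO C b) h'" if "B \<in> ?A" for B using that K by blast
  ultimately have "\<Union>?A = cls (ShO C a) (ShO C b) h'" by blast
  then have "quot_ShA C S (frac a b h) = frac (ShO C a) (ShO C b) h'" by (simp add: quot_ShA_def frac_def)
  then show thesis using that h' e by blast
qed

abbreviation D where "D \<equiv> full_sub C Z"

text \<open>\<open>frac\<close> witnesses the bijection on Hom-sets, and the values computed for the
  operations are exactly the compatibilities required of \<open>\<Phi>\<close>.\<close>

lemma U_shift_transport: "shift_transport D U R \<Phi> \<kappa>"
proof (intro shift_transport.intro shift_transport_axioms.intro full_sub_triangulated[OF Z_thick])
  have RZ: "R a \<in> Z" if "a \<in> Obj C" for a using R_Z[OF that] .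
  have HD: "Hom D (R a) (R b) = Hom C (R a) (R b)" if "a \<in> Obj C" "b \<in> Obj C" for a b
    using full_sub_Hom_eq RZ that by metis
  show "Dom U f \<in> Obj U \<and> Cod U f \<in> Obj U" if "f \<in> Arr U" for f
    using that unfolding U_Arr by (auto simp: frac_def)
  show "R a \<in> Obj D" if "a \<in> Obj U" for a using RZ that by simp
  show "\<exists>a\<in>Obj U. isomorphic D (R a) d" if "d \<in> Obj D" for d
  proof
    have d: "d \<in> Z" "d \<in> Obj C" using that thickD(1)[OF Z_thick] by auto
    then show "d \<in> Obj U" by simp
    show "isomorphic D (R d) d" using isomorphic_refl[OF d(2)] d by (simp add: resolution_Z full_sub_isomorphic)
  qed
  show "bij_betw \<Phi> (Hom U a b) (Hom D (R a) (R b))" if "a \<in> Obj U" "b \<in> Obj U" for a b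
  proof (rule bij_betw_byWitness[where f' = "frac a b"])
    have o: "a \<in> Obj C" "b \<in> Obj C" using that by auto
    show "\<forall>\<phi>\<in>Hom U a b. frac a b (\<Phi> \<phi>) = \<phi>" using \<Phi>_frac by (auto elim!: U_HomE)
    show "\<forall>h\<in>Hom D (R a) (R b). \<Phi> (frac a b h) = h" using \<Phi>_frac o by (simp add: HD)
    show "\<Phi> ` Hom U a b \<subseteq> Hom D (R a) (R b)" using \<Phi>_frac HD[OF o] by (auto elim!: U_HomE)
    show "frac a b ` Hom D (R a) (R b) \<subseteq> Hom U a b" using frac_Hom o by (auto simp: HD)
  qed
  show "Ide U a \<in> Hom U a a \<and> \<Phi> (Ide U a) = Ide D (R a)" if "a \<in> Obj U" for a
    using that Ide_Hom[of a] Ide_Hom[of "R a"] F_Hom[OF Ide_Hom[of a]]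
    by (simp add: quot_arr_eq F.F1_Ide \<Phi>_frac frac_Hom)
  show "Zer U a b \<in> Hom U a b \<and> \<Phi> (Zer U a b) = Zer D (R a) (R b)" if "a \<in> Obj U" "b \<in> Obj U" for a b
    using that Zer_Hom[of a b] F_Hom[OF Zer_Hom[of a b]]
    by (simp add: quot_arr_eq F.F1_Zer \<Phi>_frac frac_Hom)
  show "g \<cdot>\<^bsub>U\<^esub> f \<in> Hom U a c \<and> \<Phi> (g \<cdot>\<^bsub>U\<^esub> f) = \<Phi> g \<cdot>\<^bsub>D\<^esub> \<Phi> f"
    if f: "f \<in> Hom U a b" and g: "g \<in> Hom U b c" for f g a b c
  proof -
    obtain h where h: "h \<in> Hom C (R a) (R b)" "f = frac a b h" and o: "a \<in> Obj C" "b \<in> Obj C" using U_HomE[OF f] .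
    obtain k where k: "k \<in> Hom C (R b) (R c)" "g = frac b c k" and c: "c \<in> Obj C" using U_HomE[OF g] .
    show ?thesis
      using quot_Cmp_eq[OF h(1) k(1) o c] Cmp_Hom[OF h(1) k(1)] h k o c by (simp add: \<Phi>_frac frac_Hom)
  qed
  show "Add U f g \<in> Hom U a b \<and> \<Phi> (Add U f g) = Add D (\<Phi> f) (\<Phi> g)"
    if f: "f \<in> Hom U a b" and g: "g \<in> Hom U a b" for f g a b
  proof -
    obtain h where h: "h \<in> Hom C (R a) (R b)" "f = frac a b h" and o: "a \<in> Obj C" "b \<in> Obj C" using U_HomE[OF f] .
    obtain k where k: "k \<in> Hom C (R a) (R b)" "g = frac a b k" using U_HomE[OF g] .
    show ?thesis
      using quot_Add_eq[OF h(1) k(1) o] Add_Hom[OF h(1) k(1)] h k o by (simp add: \<Phi>_frac frac_Hom)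
  qed
  show "ShO U a \<in> Obj U" if "a \<in> Obj U" for a using that by simp
  show "\<kappa> a \<in> Hom D (R (ShO U a)) (ShO D (R a)) \<and> iso_arr D (\<kappa> a)" if "a \<in> Obj U" for a
    using that \<kappa>_props[of a] RZ[of a] RZ[of "ShO C a"] thickD(3)[OF Z_thick, of "R a"]
    by (simp add: full_sub_Hom full_sub_iso_arr) (simp add: Hom_iff F.F0_Obj)
  show "ShA U f \<in> Hom U (ShO U a) (ShO U b) \<and> \<kappa> b \<cdot>\<^bsub>D\<^esub> \<Phi> (ShA U f) = ShA D (\<Phi> f) \<cdot>\<^bsub>D\<^esub> \<kappa> a"
    if f: "f \<in> Hom U a b" for f a b
  proof -
    obtain h where h: "h \<in> Hom C (R a) (R b)" "f = frac a b h" and o: "a \<in> Obj C" "b \<in> Obj C" using U_HomE[OF f] .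
    obtain h' where h': "h' \<in> Hom C (R (ShO C a)) (R (ShO C b))" "\<kappa> b \<cdot> h' = ShA C h \<cdot> \<kappa> a"
      "quot_ShA C S (frac a b h) = frac (ShO C a) (ShO C b) h'" using quot_ShA_eq[OF h(1) o] .
    show ?thesis using h h' o by (simp add: \<Phi>_frac frac_Hom)
  qed
qed

end

section \<open>Distinguished triangles of the quotient\<close>

lemma iso_arr_cong:
  assumes "Arr U = Arr U'" "Dom U = Dom U'" "Cod U = Cod U'" "Cmp U = Cmp U'" "Ide U = Ide U'"
  shows "iso_arr U f \<longleftrightarrow> iso_arr U' f"
  using assms by (simp add: iso_arr_def Hom_def)

text \<open>The triangles of \<open>verdier_quotient\<close> are defined by isomorphism in
  \<open>verdier_pre\<close>, a different record. The notion does not look at \<open>Tri\<close>, so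
  it means the same in both.\<close>

lemma triangle_iso_cong:
  assumes "Arr U = Arr U'" "Dom U = Dom U'" "Cod U = Cod U'" "Cmp U = Cmp U'" "Ide U = Ide U'"
    "ShO U = ShO U'" "ShA U = ShA U'"
  shows "triangle_iso U t t' \<longleftrightarrow> triangle_iso U' t t'"
  using assms by (simp add: triangle_iso_def is_triangle_def Hom_def iso_arr_cong[of U U'])

context torsion_setting
begin

lemma U_Tri_triangle_iso: "t \<in> Tri U \<longleftrightarrow>
    (\<exists>f g h. (f, g, h) \<in> Tri C \<and> triangle_iso U (quot_arr C S f, quot_arr C S g, quot_arr C S h) t)"
proof -
  have eq: "triangle_iso (verdier_pre C S) t t' \<longleftrightarrow> triangle_iso U t t'" for t t'
    by (rule triangle_iso_cong) (simp_all add: U_def verdier_quotient_def verdier_pre_def)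
  have "Tri U = {t. \<exists>(f, g, h) \<in> Tri C.
      triangle_iso (verdier_pre C S) (quot_arr C S f, quot_arr C S g, quot_arr C S h) t}"
    by (simp add: U_def verdier_quotient_def)
  then show ?thesis by (simp only: eq mem_Collect_eq Bex_def split_paired_Ex prod.case)
qed

lemma quot_arr_Hom: "f \<in> Hom C a b \<Longrightarrow> quot_arr C S f \<in> Hom U a b"
  using frac_Hom[OF F_Hom] Hom_Obj[of f a b] by (simp add: quot_arr_eq)

lemma \<Phi>_quot_arr: "f \<in> Hom C a b \<Longrightarrow> \<Phi> (quot_arr C S f) = F f"
  using \<Phi>_frac[OF F_Hom] Hom_Obj[of f a b] by (simp add: quot_arr_eq)

lemma Z_ShO: "\<forall>z\<in>Z. ShO C z \<in> Z"
  using thickD(1,3)[OF Z_thick] by blast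

lemma R_R: "a \<in> Obj C \<Longrightarrow> R (R a) = R a"
  by (simp add: R_Z resolution_Z)

text \<open>Forwards, \<open>F\<close> sends the triangle of \<open>C\<close> behind a triangle of
  the quotient to a triangle of \<open>Z\<close>, which is moved along the given isomorphism.
  Backwards, the triangle in \<open>Z\<close> is itself a triangle of \<open>C\<close>; its image in
  the quotient is isomorphic to the given one through arrows \<open>R x \<rightarrow> x\<close> with
  value the identity.\<close>

lemma U_tri_transport: "tri_transport D U R \<Phi> \<kappa>"
proof (intro tri_transport.intro tri_transport_axioms.intro U_shift_transport)
  interpret T: shift_transport D U R \<Phi> \<kappa> by (rule U_shift_transport)
  note TH = T.\<Phi>_Hom[unfolded full_sub_Hom, THEN conjunct1]
  have sub_iso: "iso_arr C (\<Phi> u)" if "iso_arr U u" for u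
    using T.\<Phi>.F1_iso_arr[OF that] by (simp add: full_sub_iso_arr)
  fix f g h
  show "(f, g, h) \<in> Tri U \<longleftrightarrow> (\<exists>a b c. is_triangle U f g h a b c \<and>
      tri D (\<Phi> f) (\<Phi> g) (\<kappa> a \<cdot>\<^bsub>D\<^esub> \<Phi> h) (R a) (R b) (R c))"
  proof
    assume "(f, g, h) \<in> Tri U"
    then obtain f' g' h' where t': "(f', g', h') \<in> Tri C"
      and "triangle_iso U (quot_arr C S f', quot_arr C S g', quot_arr C S h') (f, g, h)"
      unfolding U_Tri_triangle_iso by blast
    then obtain a b c a' b' c' u v w where
      i': "is_triangle U (quot_arr C S f') (quot_arr C S g') (quot_arr C S h') a' b' c'"
      and i: "is_triangle U f g h a b c"
      and H: "u \<in> Hom U a' a" "v \<in> Hom U b' b" "w \<in> Hom U c' c"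
      and iso: "iso_arr U u" "iso_arr U v" "iso_arr U w"
      and e: "v \<cdot>\<^bsub>U\<^esub> quot_arr C S f' = f \<cdot>\<^bsub>U\<^esub> u" "w \<cdot>\<^bsub>U\<^esub> quot_arr C S g' = g \<cdot>\<^bsub>U\<^esub> v"
        "ShA U u \<cdot>\<^bsub>U\<^esub> quot_arr C S h' = h \<cdot>\<^bsub>U\<^esub> w"
      unfolding triangle_iso_def prod.case by blast
    \<comment> \<open>The vertices in \<open>C\<close> match those in the quotient because fractions
      remember their domains and codomains.\<close>
    obtain x y z where "is_triangle C f' g' h' x y z" using Tri_is_triangle[OF t'] by blast
    moreover from this have "x = a'" "y = b'" "z = c'"
      using i' quot_arr_Hom[of f' x y] quot_arr_Hom[of g' y z] by (auto simp: is_triangle_def Hom_iff)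
    ultimately have t: "tri C f' g' h' a' b' c'" using t' by (simp add: tri_def)
    note q = \<Phi>_quot_arr[OF triD(3)[OF t]] \<Phi>_quot_arr[OF triD(4)[OF t]] \<Phi>_quot_arr[OF triD(5)[OF t]]
    note Q = T.is_triangleD[OF i'] and I = T.is_triangleD[OF i]
    have "tri C (\<Phi> f) (\<Phi> g) (\<kappa> a \<cdot> \<Phi> h) (R a) (R b) (R c)"
    proof (rule tri_iso[OF F_tri[OF t] TH[OF H(1)] TH[OF H(2)] TH[OF H(3)]
          sub_iso[OF iso(1)] sub_iso[OF iso(2)] sub_iso[OF iso(3)] TH[OF I(1)] TH[OF I(2)]])
      show "\<kappa> a \<cdot> \<Phi> h \<in> Hom C (R c) (ShO C (R a))"
        using T.\<Phi>_is_triangle(3)[OF i] by (simp add: full_sub_Hom)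
      show "\<Phi> v \<cdot> F f' = \<Phi> f \<cdot> \<Phi> u"
        using T.\<Phi>.F1_Cmp[OF Q(1) H(2)] T.\<Phi>.F1_Cmp[OF H(1) I(1)] by (simp add: e(1)[simplified] q)
      show "\<Phi> w \<cdot> F g' = \<Phi> g \<cdot> \<Phi> v"
        using T.\<Phi>.F1_Cmp[OF Q(2) H(3)] T.\<Phi>.F1_Cmp[OF H(2) I(2)] by (simp add: e(2)[simplified] q)
      have "ShA C (\<Phi> u) \<cdot> (\<kappa> a' \<cdot> F h') = \<kappa> a \<cdot> (\<Phi> h \<cdot> \<Phi> w)"
        using T.\<kappa>_shift[OF H(1) Q(3)] T.\<Phi>.F1_Cmp[OF H(3) I(3)] by (simp add: e(3)[simplified] q)
      then show "ShA C (\<Phi> u) \<cdot> (\<kappa> a' \<cdot> F h') = (\<kappa> a \<cdot> \<Phi> h) \<cdot> \<Phi> w"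
        using TH[OF H(3)] TH[OF I(3)] \<kappa>_props(1)[of a] I(4) by (simp add: Hom_iff)
    qed
    then show "\<exists>a b c. is_triangle U f g h a b c \<and>
        tri D (\<Phi> f) (\<Phi> g) (\<kappa> a \<cdot>\<^bsub>D\<^esub> \<Phi> h) (R a) (R b) (R c)"
      using i I R_Z unfolding full_sub_tri[OF Z_ShO] by auto
  next
    assume "\<exists>a b c. is_triangle U f g h a b c \<and>
        tri D (\<Phi> f) (\<Phi> g) (\<kappa> a \<cdot>\<^bsub>D\<^esub> \<Phi> h) (R a) (R b) (R c)"
    then obtain a b c where i: "is_triangle U f g h a b c"
      and t: "tri C (\<Phi> f) (\<Phi> g) (\<kappa> a \<cdot> \<Phi> h) (R a) (R b) (R c)"
      unfolding full_sub_tri[OF Z_ShO] by auto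
    note I = T.is_triangleD[OF i] and Tt = triD(3-5)[OF t]
    have o: "a \<in> Obj C" "b \<in> Obj C" "c \<in> Obj C" using I by auto
    note RO = F.F0_Obj[OF o(1)] F.F0_Obj[OF o(2)] F.F0_Obj[OF o(3)]
    note RZ = R_Z[OF o(1)] R_Z[OF o(2)] R_Z[OF o(3)]
    \<comment> \<open>Because \<open>R (R x) = R x\<close>, the identity of \<open>R x\<close> is
      also the value of a fraction from \<open>R x\<close> to \<open>x\<close>; this is the
      isomorphism in the quotient between an object and the end of its resolution.\<close>
    have e: "\<exists>u. u \<in> Hom U (R x) x \<and> iso_arr U u \<and> \<Phi> u = Ide C (R x)" if x: "x \<in> Obj C" for x
    proof -
      have i: "Ide C (R x) \<in> Hom C (R (R x)) (R x)" using Ide_Hom F.F0_Obj[OF x] R_R[OF x] by simp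
      have "frac (R x) x (Ide C (R x)) \<in> Hom U (R x) x" by (rule frac_Hom[OF i F.F0_Obj[OF x] x])
      moreover have P: "\<Phi> (frac (R x) x (Ide C (R x))) = Ide C (R x)" by (rule \<Phi>_frac[OF i F.F0_Obj[OF x] x])
      moreover have "iso_arr D (\<Phi> (frac (R x) x (Ide C (R x))))"
        using iso_arr_Ide[OF F.F0_Obj[OF x]] R_Z[OF x] F.F0_Obj[OF x] unfolding P by (simp add: full_sub_iso_arr)
      ultimately show ?thesis using T.\<Phi>_iso_arr_iff by blast
    qed
    obtain u where u: "u \<in> Hom U (R a) a" "iso_arr U u" "\<Phi> u = Ide C (R a)" using e[OF o(1)] by blast
    obtain v where v: "v \<in> Hom U (R b) b" "iso_arr U v" "\<Phi> v = Ide C (R b)" using e[OF o(2)] by blast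
    obtain w where w: "w \<in> Hom U (R c) c" "iso_arr U w" "\<Phi> w = Ide C (R c)" using e[OF o(3)] by blast
    let ?f = "quot_arr C S (\<Phi> f)" and ?g = "quot_arr C S (\<Phi> g)" and ?h = "quot_arr C S (\<kappa> a \<cdot> \<Phi> h)"
    have Q: "?f \<in> Hom U (R a) (R b)" "?g \<in> Hom U (R b) (R c)" "?h \<in> Hom U (R c) (ShO C (R a))"
      using quot_arr_Hom Tt by blast+
    have RSh: "ShO C (R a) \<in> Z" using Z_ShO RZ by blast
    \<comment> \<open>The triangle lies in \<open>Z\<close>, where \<open>F\<close> is the identity;
      passing to the quotient and back changes no arrow.\<close>
    have PQ: "\<Phi> ?f = \<Phi> f" "\<Phi> ?g = \<Phi> g" "\<Phi> ?h = \<kappa> a \<cdot> \<Phi> h"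
      using \<Phi>_quot_arr[OF Tt(1)] F_Z[OF Tt(1) RZ(1,2)] \<Phi>_quot_arr[OF Tt(2)] F_Z[OF Tt(2) RZ(2,3)]
        \<Phi>_quot_arr[OF Tt(3)] F_Z[OF Tt(3) RZ(3) RSh] by auto
    have i': "is_triangle U ?f ?g ?h (R a) (R b) (R c)" using Q by (simp add: is_triangle_def)
    have "v \<cdot>\<^bsub>U\<^esub> ?f = f \<cdot>\<^bsub>U\<^esub> u"
      by (rule T.\<Phi>_inj[OF _ T.U.Cmp_Hom[OF Q(1) v(1)] T.U.Cmp_Hom[OF u(1) I(1)]])
        (use Tt(1) RO in \<open>simp add: T.\<Phi>.F1_Cmp[OF Q(1) v(1), simplified] T.\<Phi>.F1_Cmp[OF u(1) I(1), simplified] PQ u v Hom_iff\<close>)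
    moreover have "w \<cdot>\<^bsub>U\<^esub> ?g = g \<cdot>\<^bsub>U\<^esub> v"
      by (rule T.\<Phi>_inj[OF _ T.U.Cmp_Hom[OF Q(2) w(1)] T.U.Cmp_Hom[OF v(1) I(2)]])
        (use Tt(2) RO in \<open>simp add: T.\<Phi>.F1_Cmp[OF Q(2) w(1), simplified] T.\<Phi>.F1_Cmp[OF v(1) I(2), simplified] PQ v w Hom_iff\<close>)
    moreover have "ShA U u \<cdot>\<^bsub>U\<^esub> ?h = h \<cdot>\<^bsub>U\<^esub> w"
    proof (rule T.\<kappa>_cancel[OF _ T.U.Cmp_Hom T.U.Cmp_Hom[OF w(1) I(3)] I(4)])
      have Q3: "?h \<in> Hom U (R c) (ShO U (R a))" using Q by simp
      show "?h \<in> Hom U (R c) (ShO U (R a))" by (rule Q3)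
      show "ShA U u \<in> Hom U (ShO U (R a)) (ShO U a)" using T.\<Phi>_ShA[OF u(1)] by blast
      have "\<kappa> a \<cdot> \<Phi> (ShA U u \<cdot>\<^bsub>U\<^esub> ?h) = ShA C (\<Phi> u) \<cdot> (\<kappa> (R a) \<cdot> \<Phi> ?h)"
        using T.\<kappa>_shift[OF u(1) Q3] by simp
      also have "\<dots> = \<kappa> a \<cdot> \<Phi> h"
        using Tt(3) RO by (simp add: u \<kappa>_Z[OF RZ(1)] PQ Hom_iff)
      finally have "\<kappa> a \<cdot> \<Phi> (ShA U u \<cdot>\<^bsub>U\<^esub> ?h) = \<kappa> a \<cdot> \<Phi> h" .
      moreover have "\<Phi> (h \<cdot>\<^bsub>U\<^esub> w) = \<Phi> h"
        using T.\<Phi>.F1_Cmp[OF w(1) I(3)] TH[OF I(3)] by (simp add: w Hom_iff)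
      ultimately show "\<kappa> a \<cdot>\<^bsub>D\<^esub> \<Phi> (ShA U u \<cdot>\<^bsub>U\<^esub> ?h) = \<kappa> a \<cdot>\<^bsub>D\<^esub> \<Phi> (h \<cdot>\<^bsub>U\<^esub> w)" by simp
    qed
    ultimately have "triangle_iso U (?f, ?g, ?h) (f, g, h)"
      unfolding triangle_iso_def prod.case using i' i u(1,2) v(1,2) w(1,2) by blast
    then show "(f, g, h) \<in> Tri U" using triD(1)[OF t] unfolding U_Tri_triangle_iso by blast
  qed
qed

sublocale U: tri_transport D U R \<Phi> \<kappa>
  by (rule U_tri_transport)

section \<open>The equivalence of \<open>Z\<close> with the quotient\<close>

lemma Z_functor: "additive_functor D U (\<lambda>a. a) (quot_arr C S)"
proof (intro additive_functor.intro additive_functor_axioms.intro cat_functor.intro cat_functor_axioms.intro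
    full_sub_additive[OF Z_thick] full_sub_category[OF Z_thick] U.U_category U.U_additive)
  fix f g a b c assume f: "f \<in> Hom D a b" and g: "g \<in> Hom D b c"
  then have H: "f \<in> Hom C a b" "g \<in> Hom C b c" by (auto simp: full_sub_Hom)
  note Q = quot_arr_Hom[OF H(1)] quot_arr_Hom[OF H(2)] quot_arr_Hom[OF Cmp_Hom[OF H]]
  have "quot_arr C S (g \<cdot> f) = quot_arr C S g \<cdot>\<^bsub>U\<^esub> quot_arr C S f"
    by (rule U.\<Phi>_inj[OF _ Q(3) U.U.Cmp_Hom[OF Q(1,2)]])
      (use U.\<Phi>.F1_Cmp[OF Q(1,2)] in
        \<open>simp add: \<Phi>_quot_arr[OF H(1)] \<Phi>_quot_arr[OF H(2)] \<Phi>_quot_arr[OF Cmp_Hom[OF H]] F.F1_Cmp[OF H]\<close>)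
  then show "quot_arr C S (g \<cdot>\<^bsub>D\<^esub> f) = quot_arr C S g \<cdot>\<^bsub>U\<^esub> quot_arr C S f" by simp
next
  fix f g a b assume f: "f \<in> Hom D a b" and g: "g \<in> Hom D a b"
  then have H: "f \<in> Hom C a b" "g \<in> Hom C a b" by (auto simp: full_sub_Hom)
  note Q = quot_arr_Hom[OF H(1)] quot_arr_Hom[OF H(2)] quot_arr_Hom[OF Add_Hom[OF H]]
  have "quot_arr C S (Add C f g) = Add U (quot_arr C S f) (quot_arr C S g)"
    by (rule U.\<Phi>_inj[OF _ Q(3) U.U.Add_Hom[OF Q(1,2)]])
      (use U.\<Phi>.F1_Add[OF Q(1,2)] in
        \<open>simp add: \<Phi>_quot_arr[OF H(1)] \<Phi>_quot_arr[OF H(2)] \<Phi>_quot_arr[OF Add_Hom[OF H]] F.F1_Add[OF H]\<close>)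
  then show "quot_arr C S (Add D f g) = Add U (quot_arr C S f) (quot_arr C S g)" by simp
qed (use thickD(1)[OF Z_thick] quot_arr_Hom in \<open>auto simp: full_sub_Hom\<close>)

text \<open>Between objects of \<open>Z\<close> the quotient functor and \<open>\<Phi>\<close> are
  inverse on arrows, because \<open>F\<close> fixes such arrows. An object \<open>d\<close> is
  isomorphic in the quotient to \<open>R d\<close>, both having the same image under
  \<open>R\<close>.\<close>

lemma Z_equivalence: "equivalence_functor D U (\<lambda>a. a) (quot_arr C S)"
proof (rule cat_functor.equivalence_functorI)
  show "cat_functor D U (\<lambda>a. a) (quot_arr C S)" using Z_functor by (rule additive_functor.axioms)
  show "bij_betw (quot_arr C S) (Hom D a b) (Hom U a b)" if "a \<in> Obj D" "b \<in> Obj D" for a b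
  proof -
    have z: "a \<in> Z" "b \<in> Z" using that by auto
    then have o: "a \<in> Obj C" "b \<in> Obj C" using thickD(1)[OF Z_thick] by auto
    show ?thesis
    proof (rule bij_betw_byWitness[where f' = \<Phi>])
      show "\<forall>f\<in>Hom D a b. \<Phi> (quot_arr C S f) = f"
        using z by (auto simp: full_sub_Hom \<Phi>_quot_arr F_Z)
      show "\<forall>\<phi>\<in>Hom U a b. quot_arr C S (\<Phi> \<phi>) = \<phi>"
        using z o by (auto elim!: U_HomE simp: \<Phi>_frac quot_arr_eq[of _ a b] F_Z resolution_Z)
      show "quot_arr C S ` Hom D a b \<subseteq> Hom U a b" using quot_arr_Hom by (auto simp: full_sub_Hom)
      show "\<Phi> ` Hom U a b \<subseteq> Hom D a b" using z U.\<Phi>_Hom[of _ a b] by (auto simp: resolution_Z)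
    qed
  qed
  show "\<exists>c\<in>Obj D. isomorphic U c d" if "d \<in> Obj U" for d
  proof
    have d: "d \<in> Obj C" using that by simp
    show "R d \<in> Obj D" using R_Z[OF d] by simp
    show "isomorphic U (R d) d"
      by (rule U.isomorphic_reflected)
        (use d isomorphic_refl[OF F.F0_Obj[OF d]] R_Z[OF d] F.F0_Obj[OF d] in \<open>simp_all add: R_R full_sub_isomorphic\<close>)
  qed
qed

text \<open>The quotient functor commutes with the shift on the nose, so identities serve as the
  structure isomorphism.\<close>

lemma Z_triangle_equivalence:
  "triangle_equivalence D U (\<lambda>a. a) (\<lambda>f. quot_arr C S f) (\<lambda>a. Ide U (ShO C a))"
proof (intro triangle_equivalence.intro triangle_functor.intro triangle_functor_axioms.intro
    full_sub_triangulated[OF Z_thick] U.U_triangulated Z_functor Z_equivalence)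
  have U_Ide: "Ide U a \<in> Hom U a a" "iso_arr U (Ide U a)" if "a \<in> Obj C" for a
    using that U.U.Ide_Hom[of a] U.U.iso_arr_Ide[of a] by auto
  show "natural_iso D U ((\<lambda>a. a) \<circ> ShO D) (quot_arr C S \<circ> ShA D) (ShO U \<circ> (\<lambda>a. a)) (ShA U \<circ> quot_arr C S)
      (\<lambda>a. Ide U (ShO C a))"
    unfolding natural_iso_def
  proof (intro conjI ballI)
    fix a assume "a \<in> Obj D"
    then have "ShO C a \<in> Obj C" using thickD(1)[OF Z_thick] by auto
    then show "Ide U (ShO C a) \<in> Hom U (((\<lambda>a. a) \<circ> ShO D) a) ((ShO U \<circ> (\<lambda>a. a)) a)"
      "iso_arr U (Ide U (ShO C a))" using U_Ide by (simp_all del: U_simps(4))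
  next
    fix f assume "f \<in> Arr D"
    then obtain a b where f: "f \<in> Hom C a b" and ab: "a \<in> Z" "b \<in> Z" by (auto simp: full_sub_Arr Hom_iff)
    have o: "a \<in> Obj C" "b \<in> Obj C" using Hom_Obj[OF f] by auto
    note q = quot_arr_Hom[OF f] and q' = quot_arr_Hom[OF ShA_Hom[OF f]]
    have s: "ShA U (quot_arr C S f) \<in> Hom U (ShO C a) (ShO C b)" using U.\<Phi>_ShA[OF q] by simp
    \<comment> \<open>Both sides satisfy the same naturality square with \<open>\<kappa> b\<close>,
      which determines them.\<close>
    have "ShA U (quot_arr C S f) = quot_arr C S (ShA C f)"
    proof (rule U.\<kappa>_cancel[of b _ _ "ShO C a"])
      have "\<kappa> b \<cdot> \<Phi> (ShA U (quot_arr C S f)) = ShA C (F f) \<cdot> \<kappa> a"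
        using U.\<Phi>_ShA[OF q] by (simp add: \<Phi>_quot_arr[OF f])
      also have "\<dots> = \<kappa> b \<cdot> \<Phi> (quot_arr C S (ShA C f))"
        by (simp add: \<Phi>_quot_arr[OF ShA_Hom[OF f]] \<kappa>_natural[OF f])
      finally show "\<kappa> b \<cdot>\<^bsub>D\<^esub> \<Phi> (ShA U (quot_arr C S f)) = \<kappa> b \<cdot>\<^bsub>D\<^esub> \<Phi> (quot_arr C S (ShA C f))" by simp
    qed (use s q' o in simp_all)
    moreover have "quot_arr C S (ShA C f) \<cdot>\<^bsub>U\<^esub> Ide U (ShO C a) = quot_arr C S (ShA C f)"
      "Ide U (ShO C b) \<cdot>\<^bsub>U\<^esub> quot_arr C S (ShA C f) = quot_arr C S (ShA C f)"
      using U.U.Cmp_Ide_right[OF q'] U.U.Cmp_Ide_left[OF q'] by auto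
    moreover have "Dom D f = a" "Cod D f = b" using f by (auto simp: Hom_iff)
    ultimately show "(ShA U \<circ> quot_arr C S) f \<cdot>\<^bsub>U\<^esub> Ide U (ShO C (Dom D f)) =
        Ide U (ShO C (Cod D f)) \<cdot>\<^bsub>U\<^esub> (quot_arr C S \<circ> ShA D) f" by simp
  qed
  fix f g h a b c assume "(f, g, h) \<in> Tri D" "is_triangle D f g h a b c"
  then have t: "tri C f g h a b c" and z: "a \<in> Z" "b \<in> Z" "c \<in> Z"
    using full_sub_tri[OF Z_ShO, of f g h a b c] by (auto simp: tri_def)
  note H = triD(3-5)[OF t]
  have i: "is_triangle U (quot_arr C S f) (quot_arr C S g) (quot_arr C S h) a b c"
    using quot_arr_Hom[OF H(1)] quot_arr_Hom[OF H(2)] quot_arr_Hom[OF H(3)] by (simp add: is_triangle_def)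
  have "Ide U (ShO C a) \<cdot>\<^bsub>U\<^esub> quot_arr C S h = quot_arr C S h"
    using U.U.Cmp_Ide_left[OF quot_arr_Hom[OF H(3)]] .
  moreover have "(quot_arr C S f, quot_arr C S g, quot_arr C S h) \<in> Tri U"
    unfolding U.U_Tri_iff[OF i]
    using t z H F_Z[OF H(1)] F_Z[OF H(2)] F_tri[OF t] R_Z tri_Obj[OF t] thickD(1)[OF Z_thick]
    by (simp add: full_sub_tri[OF Z_ShO] \<Phi>_quot_arr[OF H(1)] \<Phi>_quot_arr[OF H(2)] \<Phi>_quot_arr[OF H(3)])
  ultimately show "(quot_arr C S f, quot_arr C S g, Ide U (ShO C a) \<cdot>\<^bsub>U\<^esub> quot_arr C S h) \<in> Tri U" by simp
qed

section \<open>The semi-orthogonal decomposition\<close>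

lemma hom_vanishI: "A \<subseteq> left_perp C B \<Longrightarrow> hom_vanish C A B"
  by (auto simp: left_perp_def hom_vanish_def)

text \<open>\<open>V\<close> contains both factors and is closed under extensions. Conversely, for
  \<open>w\<close> in \<open>V\<close> the cone of its \<open>X\<close>-part is again in
  \<open>V\<close>, hence in \<open>V \<inter> W\<close>.\<close>

lemma star_XZ: "star C X Z = V"
proof
  show "star C X Z \<subseteq> V"
    using thick_tri(3)[OF V_thick] X_V Z_VW by (auto simp: star_def tri_def)
  show "V \<subseteq> star C X Z"
  proof
    fix w assume w: "w \<in> V"
    then have o: "w \<in> Obj C" using thickD(1)[OF V_thick] by blast
    obtain f g h x z where x: "x \<in> X" "z \<in> W" and t: "tri C f g h x w z"
      using decomp_X[OF o] unfolding W_def by blast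
    have "z \<in> V" using thick_tri(1)[OF V_thick t X_V[OF x(1)] w] .
    then have "z \<in> Z" using x by (simp add: Z_def)
    then show "w \<in> star C X Z" using o x t unfolding star_def tri_def by blast
  qed
qed

lemma star_VY: "star C V Y = Obj C"
  using decomp_Y unfolding star_def V_def tri_def by blast

text \<open>With the bracketing of \<open>is_perp\<close> the first product is \<open>V\<close>, and
  the torsion pair for \<open>Y\<close> then reaches every object.\<close>

lemma XZY_decomposition: "weak_semiorthogonal_decomposition C [X, Z, Y]"
proof -
  have "hom_vanish C X Z"
    using Z_VW unfolding W_def right_perp_def hom_vanish_def by blast
  then have "is_perp C ([X] @ [Z]) (star C X Z)"
    by (intro is_perp.snoc is_perp.single thickD(1)[OF X_thick] thickD(1)[OF Z_thick])
  then have "is_perp C (([X] @ [Z]) @ [Y]) (star C (star C X Z) Y)"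
    by (rule is_perp.snoc[OF _ thickD(1)[OF Y_thick]]) (simp add: star_XZ V_def hom_vanishI)
  then show ?thesis
    unfolding weak_semiorthogonal_decomposition_def
    using X_thick Y_thick Z_thick by (simp add: star_XZ star_VY)
qed

end

section \<open>Torsion pairs\<close>

text \<open>In the inductive case the list would be \<open>[A]\<close> with an empty front, and no
  rule derives \<open>is_perp\<close> for the empty list.\<close>

lemma is_perp_single: "is_perp C [A] W \<Longrightarrow> W = A \<and> A \<subseteq> Obj C"
proof (erule is_perp.cases)
  fix Xs W' B assume "[A] = Xs @ [B]" "is_perp C Xs W'"
  then have "is_perp C [] W'" by simp
  then show "W = A \<and> A \<subseteq> Obj C" by (cases rule: is_perp.cases) auto
qed auto

lemma is_perp_pair:
  assumes "is_perp C [A, B] W"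
  shows "W = star C A B" "hom_vanish C A B"
proof -
  have "W = star C A B \<and> hom_vanish C A B"
    using assms
  proof (cases rule: is_perp.cases)
    case (snoc Xs W' B')
    then have "Xs = [A]" "B' = B" by auto
    with snoc is_perp_single[of C A W'] show ?thesis by simp
  qed
  then show "W = star C A B" "hom_vanish C A B" by auto
qed

lemma torsion_pairD:
  assumes "torsion_pair C A B"
  shows "A = left_perp C B" "B = right_perp C A" "hom_vanish C A B"
    "t \<in> Obj C \<Longrightarrow> \<exists>f g h x y. x \<in> A \<and> y \<in> B \<and> tri C f g h x t y"
proof -
  show "A = left_perp C B" "B = right_perp C A" using assms unfolding torsion_pair_def by blast+
  have p: "is_perp C [A, B] (Obj C)" using assms unfolding torsion_pair_def by blast
  show "hom_vanish C A B" using is_perp_pair(2)[OF p] .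
  assume "t \<in> Obj C"
  then have "t \<in> star C A B" using is_perp_pair(1)[OF p] by simp
  then have "\<exists>x\<in>A. \<exists>y\<in>B. \<exists>f g h. tri C f g h x t y" by (simp add: star_def tri_def)
  then show "\<exists>f g h x y. x \<in> A \<and> y \<in> B \<and> tri C f g h x t y" by blast
qed

context triangulated_category
begin

text \<open>Serves while \<open>X\<close> is known only as a perpendicular category, before
  thickness provides closure under isomorphism.\<close>

lemma perp_isomorphic:
  assumes "X \<subseteq> Obj C" "isomorphic C a b"
  shows "a \<in> left_perp C X \<Longrightarrow> b \<in> left_perp C X" "a \<in> right_perp C X \<Longrightarrow> b \<in> right_perp C X"
proof -
  obtain i where i: "i \<in> Hom C a b" "iso_arr C i" using assms(2) by (auto simp: isomorphic_def)
  have XO: "x \<in> Obj C" if "x \<in> X" for x using that assms(1) by blast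
  have o: "a \<in> Obj C" "b \<in> Obj C" using Hom_Obj[OF i(1)] by auto
  show "b \<in> left_perp C X" if a: "a \<in> left_perp C X"
    unfolding left_perp_iff[OF assms(1)]
  proof (intro conjI ballI o)
    fix x f assume x: "x \<in> X" and f: "f \<in> Hom C b x"
    have "f \<cdot> i = Zer C a x" using a[unfolded left_perp_iff[OF assms(1)]] x Cmp_Hom[OF i(1) f] by blast
    then have "f \<cdot> i = Zer C b x \<cdot> i" using i o XO[OF x] by (simp add: Hom_iff)
    then show "f = Zer C b x" by (rule iso_arr_cancel_right[OF i(2,1) f Zer_Hom[OF o(2) XO[OF x]]])
  qed
  obtain j where j: "j \<in> Hom C b a" "iso_arr C j" using iso_arr_inverse[OF i(2,1)] by metis
  show "b \<in> right_perp C X" if a: "a \<in> right_perp C X"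
    unfolding right_perp_iff[OF assms(1)]
  proof (intro conjI ballI o)
    fix x f assume x: "x \<in> X" and f: "f \<in> Hom C x b"
    have "j \<cdot> f = Zer C x a" using a[unfolded right_perp_iff[OF assms(1)]] x Cmp_Hom[OF f j(1)] by blast
    then have "j \<cdot> f = j \<cdot> Zer C x b" using j o XO[OF x] by (simp add: Hom_iff)
    then show "f = Zer C x b" by (rule iso_arr_cancel_left[OF j(2,1) f Zer_Hom[OF XO[OF x] o(2)]])
  qed
qed

lemma shift_sub_eq:
  assumes Y: "shift_closed C Y"
  shows "shift_sub C Y = Y"
proof
  show "shift_sub C Y \<subseteq> Y"
    using shift_closedD[OF Y] isomorphic_sym unfolding shift_sub_def by blast
  show "Y \<subseteq> shift_sub C Y"
  proof
    fix y assume y: "y \<in> Y"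
    then have o: "y \<in> Obj C" using shift_closedD(1)[OF Y] by blast
    obtain a where a: "a \<in> Obj C" "isomorphic C (ShO C a) y" using shift_equiv.essentially_surjective[OF o] by blast
    then have "a \<in> Y" using shift_closedD(2,3)[OF Y] isomorphic_sym y by blast
    then show "y \<in> shift_sub C Y" using a isomorphic_sym o unfolding shift_sub_def by blast
  qed
qed

end

text \<open>Thickness is obtained in a fixed order. Stability and the double perpendicular make
  \<open>X\<close> shift-closed, so its right perpendicular is thick; \<open>X\<close>, the left
  perpendicular of that, is thick; and \<open>Y\<close>, cut out of \<open>S\<close> by the right
  perpendicular of \<open>X\<close>, inherits thickness from both.\<close>

lemma torsion_settingI:
  assumes "triangulated_category T"
    and S: "thick T S"
    and st: "stable_t_structure (full_sub T S) X Y"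
    and tX: "torsion_pair T X (right_perp T X)"
    and tY: "torsion_pair T (left_perp T Y) Y"
  shows "torsion_setting T S X Y"
proof -
  interpret triangulated_category T by (rule assms(1))
  have ts: "torsion_pair (full_sub T S) X Y" and shX: "shift_sub (full_sub T S) X = X"
    using st by (auto simp: stable_t_structure_def)
  note s = torsion_pairD[OF ts] and x = torsion_pairD[OF tX] and y = torsion_pairD[OF tY]
  have XS: "X \<subseteq> S" by (subst s(1)) (auto simp: left_perp_def)
  have YS: "Y \<subseteq> S" by (subst s(2)) (auto simp: right_perp_def)
  have SO: "S \<subseteq> Obj T" using thickD(1)[OF S] .
  have XO: "X \<subseteq> Obj T" using XS SO by blast
  have hom: "Hom (full_sub T S) a b = Hom T a b" if "a \<in> S" "b \<in> S" for a b
    using that by (rule full_sub_Hom_eq)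
  \<comment> \<open>The torsion pair in \<open>T\<close> makes \<open>X\<close> a perpendicular
    category of \<open>T\<close>, hence closed under all isomorphisms of \<open>T\<close>.\<close>
  have Xiso: "b \<in> X" if "a \<in> X" "isomorphic T a b" for a b
    using perp_isomorphic(1)[OF _ that(2), of "right_perp T X"] that(1) x(1) by (auto simp: right_perp_def)
  have ShX: "ShO T a \<in> X \<longleftrightarrow> a \<in> X" if a: "a \<in> Obj T" for a
  proof
    assume "a \<in> X"
    then have "ShO T a \<in> S" using XS thickD(3)[OF S a] by blast
    then have "ShO T a \<in> shift_sub (full_sub T S) X"
      using \<open>a \<in> X\<close> isomorphic_refl[OF ShO_Obj[OF a]] unfolding shift_sub_def by (auto simp: full_sub_isomorphic)
    then show "ShO T a \<in> X" by (simp add: shX)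
  next
    \<comment> \<open>Stability exhibits \<open>ShO T a\<close> as isomorphic to the shift of some
      \<open>b\<close> in \<open>X\<close>; the isomorphism descends along the fully faithful
      shift.\<close>
    assume "ShO T a \<in> X"
    then have "ShO T a \<in> shift_sub (full_sub T S) X" by (simp add: shX)
    then obtain b where b: "b \<in> X" "isomorphic T (ShO T a) (ShO T b)"
      unfolding shift_sub_def by (auto simp: full_sub_isomorphic)
    have bO: "b \<in> Obj T" using b XO by blast
    obtain i where i: "i \<in> Hom T (ShO T a) (ShO T b)" "iso_arr T i" using b(2) by (auto simp: isomorphic_def)
    obtain j where j: "j \<in> Hom T a b" "ShA T j = i" using shift_equiv.full[OF i(1) a bO] .
    have "iso_arr T j" using shift_equiv.reflects_iso[OF j(1)] j(2) i(2) by simp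
    then have "isomorphic T a b" using j by (auto simp: isomorphic_def)
    then show "a \<in> X" using Xiso[OF b(1)] isomorphic_sym by blast
  qed
  have "shift_closed T X" unfolding shift_closed_def using XO ShX Xiso by blast
  then have XP: "thick T (right_perp T X)" by (rule right_perp_thick)
  have X: "thick T X" by (subst x(1)) (rule left_perp_thick[OF thick_shift_closed[OF XP]])
  \<comment> \<open>The torsion pair of \<open>S\<close> forms its perpendiculars inside
    \<open>S\<close>; fullness of the subcategory relates them to those of \<open>T\<close>.\<close>
  have Y_eq: "Y = S \<inter> right_perp T X"
    by (subst s(2)) (use XS SO hom in \<open>auto simp: right_perp_def hom_vanish_def subset_iff\<close>)
  obtain z where "zero_object T z" using zero_object_exists by blast
  then have "S \<inter> right_perp T X \<noteq> {}" using thick_zero[OF S] thick_zero[OF XP] by blast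
  then have Y: "thick T Y" by (subst Y_eq) (rule thick_Int[OF S XP])
  have "hom_vanish T X Y"
    using s(3) XS YS hom unfolding hom_vanish_def by (metis full_sub_simps(7) subset_iff)
  then have XY: "X \<subseteq> left_perp T Y" using XO unfolding left_perp_def hom_vanish_def by blast
  show "torsion_setting T S X Y"
  proof (intro torsion_setting.intro torsion_setting_axioms.intro assms(1) S X Y XS YS XY
      x(1)[symmetric] y(2)[symmetric] x(4) y(4))
    fix t assume "t \<in> S"
    then have "\<exists>f g h x y. x \<in> X \<and> y \<in> Y \<and> tri (full_sub T S) f g h x t y" using s(4)[of t] by simp
    then show "\<exists>f g h x y. x \<in> X \<and> y \<in> Y \<and> tri T f g h x t y"
      using full_sub_tri[of S T] thickD(1,3)[OF S] by blast
  qed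
qed

theorem corollary1p3:
  fixes T :: "('o, 'm) tri_cat" and S X Y Z :: "'o set"
    and U :: "('o, ('o, 'm) fraction) tri_cat"
  assumes "triangulated_category T"
    and "thick T S"
    and "U = verdier_quotient T S"
    and "stable_t_structure (full_sub T S) X Y"
    and "torsion_pair T X (right_perp T X)"
    and "torsion_pair T (left_perp T Y) Y"
    and "Z = right_perp T X \<inter> left_perp T (shift_sub T Y)"
  shows "weak_semiorthogonal_decomposition T [X, Z, Y] \<and>
         triangle_equivalence (full_sub T Z) U
           (\<lambda>a. a) (\<lambda>f. quot_arr T S f) (\<lambda>a. Ide U (ShO T a))"
proof -
  interpret t: torsion_setting T S X Y by (rule torsion_settingI) (use assms in auto)
  \<comment> \<open>\<open>Y\<close> is thick, so its shift, closed under isomorphism, is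
    \<open>Y\<close> itself.\<close>
  have "Z = t.Z"
    unfolding assms(7) t.shift_sub_eq[OF t.thick_shift_closed[OF t.Y_thick]] t.Z_def t.V_def t.W_def by blast
  moreover have "U = t.U" by (simp add: assms(3) t.U_def)
  ultimately show ?thesis using t.XZY_decomposition t.Z_triangle_equivalence by simp
qed

end
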